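(* Let $p\in\mathbb{R}$ with $p>1$, let $n\in\mathbb{N}$, and let $G$ be a group of type $FP_n$ whose center $Z(G)$ has infinitely many elements. Then $\overline{H^{(p)}_i(G)}=0$ and $\overline{H_{(p)}^i(G)}=0$ for all $i\le n$.
   Context: $\mathbb{Z}[G]$ is the integral group ring and $\mathbb{Z}$ is the trivial $\mathbb{Z}[G]$-module. A group $G$ is of type $FP_n$ if there is an exact sequence $F_n\to\dots\to F_0\to\mathbb{Z}\to 0$ of $\mathbb{Z}[G]$-modules with $F_0,\dots,F_n$ projective and finitely generated. For real $p\ge 1$, $l^p(G)$ is the Banach space of formal sums $f=\sum_{g\in G}f_g g$ with $f_g\in\mathbb{C}$, only countably many $f_g\ne 0$, and $\sum_{g}|f_g|^p=(|f|_p)^p<\infty$; it is a $\mathbb{Z}[G]$-module via translation by $G$. For a projective resolution $\cdots\to F_2\xrightarrow{\partial_2}F_1\xrightarrow{\partial_1}F_0\xrightarrow{\varepsilon}\mathbb{Z}\to 0$ over $\mathbb{Z}[G]$, consider the chain complex $F_i\otimes_{\mathbb{Z}[G]}l^p(G)$, $i\ge0$, with boundary maps $\partial_i\otimes 1$ (left modules being turned into right modules via $xg=g^{-1}x$ when forming tensor products), and the cochain complex $\operatorname{Hom}_{\mathbb{Z}[G]}(F_i,l^p(G))$, $i\ge 0$, with $\widetilde\partial_i(\varphi)=\varphi\circ\partial_i$ (maps with index $0$ are zero). The reduced $l^p$-homology and $l^p$-cohomology are $\overline{H^{(p)}_i(G)}=\ker(\partial_i\otimes1)/\overline{\operatorname{im}(\partial_{i+1}\otimes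 1)}$ and $\overline{H_{(p)}^i(G)}=\ker(\widetilde\partial_{i+1})/\overline{\operatorname{im}(\widetilde\partial_i)}$. For $G$ of type $FP_n$ the resolution is taken with $F_0,\dots,F_n$ finitely generated; then for $i\le n$ the spaces $F_i\otimes_{\mathbb{Z}[G]}l^p(G)$ and $\operatorname{Hom}_{\mathbb{Z}[G]}(F_i,l^p(G))$ carry natural Banach space topologies (both are $l^p(G)^{m_i}$ if $F_i$ is free of rank $m_i$), in which the closures are taken. *)

theory Defs
  imports "HOL-Analysis.Analysis" "HOL-Algebra.Module" "HOL-Algebra.Free_Abelian_Groups"
begin

section \<open>Modules over a not necessarily commutative ring\<close>

text \<open>
  The locale \<open>module\<close> of HOL-Algebra requires a commutative ring of scalars, so that only its
  record type is used here. The fields \<open>mult\<close> and \<open>one\<close> of a module carry no meaning.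
\<close>

locale left_module = R?: ring R + M?: abelian_group M
    for R :: "('r, 'c) ring_scheme" (structure) and M :: "('r, 'm, 'd) module_scheme" (structure) +
  assumes smult_closed [simp, intro]:
      "\<lbrakk>a \<in> carrier R; x \<in> carrier M\<rbrakk> \<Longrightarrow> a \<odot>\<^bsub>M\<^esub> x \<in> carrier M"
    and smult_l_distr:
      "\<lbrakk>a \<in> carrier R; b \<in> carrier R; x \<in> carrier M\<rbrakk> \<Longrightarrow>
       (a \<oplus> b) \<odot>\<^bsub>M\<^esub> x = a \<odot>\<^bsub>M\<^esub> x \<oplus>\<^bsub>M\<^esub> b \<odot>\<^bsub>M\<^esub> x"
    and smult_r_distr:
      "\<lbrakk>a \<in> carrier R; x \<in> carrier M; y \<in> carrier M\<rbrakk> \<Longrightarrow>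
       a \<odot>\<^bsub>M\<^esub> (x \<oplus>\<^bsub>M\<^esub> y) = a \<odot>\<^bsub>M\<^esub> x \<oplus>\<^bsub>M\<^esub> a \<odot>\<^bsub>M\<^esub> y"
    and smult_assoc1:
      "\<lbrakk>a \<in> carrier R; b \<in> carrier R; x \<in> carrier M\<rbrakk> \<Longrightarrow>
       (a \<otimes> b) \<odot>\<^bsub>M\<^esub> x = a \<odot>\<^bsub>M\<^esub> (b \<odot>\<^bsub>M\<^esub> x)"
    and smult_one [simp]: "x \<in> carrier M \<Longrightarrow> \<one> \<odot>\<^bsub>M\<^esub> x = x"

definition mod_hom ::
    "('r, 'c) ring_scheme \<Rightarrow> ('r, 'm, 'd) module_scheme \<Rightarrow> ('r, 'n, 'e) module_scheme \<Rightarrow> ('m \<Rightarrow> 'n) set"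
  where "mod_hom R M N = {f \<in> carrier M \<rightarrow> carrier N.
    (\<forall>x\<in>carrier M. \<forall>y\<in>carrier M. f (x \<oplus>\<^bsub>M\<^esub> y) = f x \<oplus>\<^bsub>N\<^esub> f y) \<and>
    (\<forall>r\<in>carrier R. \<forall>x\<in>carrier M. f (r \<odot>\<^bsub>M\<^esub> x) = r \<odot>\<^bsub>N\<^esub> f x)}"

definition finitely_generated ::
    "('r, 'c) ring_scheme \<Rightarrow> ('r, 'm, 'd) module_scheme \<Rightarrow> bool"
  where "finitely_generated R M \<longleftrightarrow> (\<exists>S. finite S \<and> S \<subseteq> carrier M \<and>
    (\<forall>x\<in>carrier M. \<exists>a\<in>S \<rightarrow> carrier R. x = (\<Oplus>\<^bsub>M\<^esub>s\<in>S. a s \<odot>\<^bsub>M\<^esub> s)))"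

text \<open>
  Projectivity is the lifting property. A definition cannot quantify over types, so the test
  modules \<open>M \<rightarrow> N\<close> live on the types of the free module on \<open>carrier P\<close> and of \<open>P\<close>. This is no
  restriction: \<open>projective_lift\<close> below gives the lifting property for modules on arbitrary types.
\<close>

definition projective ::
    "('r, 'c) ring_scheme \<Rightarrow> ('r, 'm) module \<Rightarrow> bool"
  where "projective R P \<longleftrightarrow> left_module R P \<and>
    (\<forall>(M :: ('r, 'm \<Rightarrow> 'r) module) (N :: ('r, 'm) module) f g.
       left_module R M \<and> left_module R N \<and> f \<in> mod_hom R P N \<and>
       g \<in> mod_hom R M N \<and> g ` carrier M = carrier N \<longrightarrow>
       (\<exists>h\<in>mod_hom R P M. \<forall>x\<in>carrier P. g (h x) = f x))"

context
begin

private definition free_mod :: "('r, 'c) ring_scheme \<Rightarrow> 'm set \<Rightarrow> ('r, 'm \<Rightarrow> 'r) module"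
  where "free_mod R X =
    \<lparr>carrier = {c. (\<forall>x. c x \<in> carrier R) \<and> (\<forall>x. x \<notin> X \<longrightarrow> c x = \<zero>\<^bsub>R\<^esub>) \<and> finite {x. c x \<noteq> \<zero>\<^bsub>R\<^esub>}},
     monoid.mult = undefined, one = undefined, ring.zero = (\<lambda>x. \<zero>\<^bsub>R\<^esub>),
     ring.add = (\<lambda>c d x. c x \<oplus>\<^bsub>R\<^esub> d x), smult = (\<lambda>r c x. r \<otimes>\<^bsub>R\<^esub> c x)\<rparr>"

private definition lin :: "('r, 'c) ring_scheme \<Rightarrow> ('r, 'n, 'd) module_scheme \<Rightarrow> ('m \<Rightarrow> 'n) \<Rightarrow> ('m \<Rightarrow> 'r) \<Rightarrow> 'n"
  where "lin R N v c = (\<Oplus>\<^bsub>N\<^esub>x\<in>{x. c x \<noteq> \<zero>\<^bsub>R\<^esub>}. c x \<odot>\<^bsub>N\<^esub> v x)"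

private lemma smult_zeros:
  assumes "left_module R N"
  shows "y \<in> carrier N \<Longrightarrow> \<zero>\<^bsub>R\<^esub> \<odot>\<^bsub>N\<^esub> y = \<zero>\<^bsub>N\<^esub>"
    and "r \<in> carrier R \<Longrightarrow> r \<odot>\<^bsub>N\<^esub> \<zero>\<^bsub>N\<^esub> = \<zero>\<^bsub>N\<^esub>"
proof -
  interpret left_module R N by fact
  show "\<zero>\<^bsub>R\<^esub> \<odot>\<^bsub>N\<^esub> y = \<zero>\<^bsub>N\<^esub>" if "y \<in> carrier N"
  proof -
    have "\<zero>\<^bsub>R\<^esub> \<odot>\<^bsub>N\<^esub> y \<oplus>\<^bsub>N\<^esub> \<zero>\<^bsub>R\<^esub> \<odot>\<^bsub>N\<^esub> y = \<zero>\<^bsub>R\<^esub> \<odot>\<^bsub>N\<^esub> y"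
      using that smult_l_distr[of "\<zero>\<^bsub>R\<^esub>" "\<zero>\<^bsub>R\<^esub>" y] by simp
    then show ?thesis using that by (simp add: M.add.l_cancel_one')
  qed
  show "r \<odot>\<^bsub>N\<^esub> \<zero>\<^bsub>N\<^esub> = \<zero>\<^bsub>N\<^esub>" if "r \<in> carrier R"
  proof -
    have "r \<odot>\<^bsub>N\<^esub> \<zero>\<^bsub>N\<^esub> \<oplus>\<^bsub>N\<^esub> r \<odot>\<^bsub>N\<^esub> \<zero>\<^bsub>N\<^esub> = r \<odot>\<^bsub>N\<^esub> \<zero>\<^bsub>N\<^esub>"
      using that smult_r_distr[of r "\<zero>\<^bsub>N\<^esub>" "\<zero>\<^bsub>N\<^esub>"] by simp
    then show ?thesis using that by (simp add: M.add.l_cancel_one')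
  qed
qed

private lemma free_mod:
  fixes R :: "('r, 'c) ring_scheme" and X :: "'m set"
  assumes "ring R"
  shows "left_module R (free_mod R X)"
proof -
  interpret ring R by fact
  have fin: "finite {x. c x \<oplus>\<^bsub>R\<^esub> d x \<noteq> \<zero>\<^bsub>R\<^esub>}"
    if "finite {x. c x \<noteq> \<zero>\<^bsub>R\<^esub>}" "finite {x. d x \<noteq> \<zero>\<^bsub>R\<^esub>}" for c d :: "'m \<Rightarrow> 'r"
    by (rule finite_subset[OF _ finite_UnI[OF that]]) auto
  have fin': "finite {x. r \<otimes>\<^bsub>R\<^esub> c x \<noteq> \<zero>\<^bsub>R\<^esub>}"
    if "finite {x. c x \<noteq> \<zero>\<^bsub>R\<^esub>}" "r \<in> carrier R" for r and c :: "'m \<Rightarrow> 'r"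
    by (rule finite_subset[OF _ that(1)]) (use that(2) in auto)
  have "abelian_group (free_mod R X)"
  proof (rule abelian_groupI)
    fix c assume c: "c \<in> carrier (free_mod R X)"
    show "\<exists>d\<in>carrier (free_mod R X). d \<oplus>\<^bsub>free_mod R X\<^esub> c = \<zero>\<^bsub>free_mod R X\<^esub>"
    proof (rule bexI[of _ "\<lambda>x. \<ominus>\<^bsub>R\<^esub> c x"])
      show "(\<lambda>x. \<ominus>\<^bsub>R\<^esub> c x) \<oplus>\<^bsub>free_mod R X\<^esub> c = \<zero>\<^bsub>free_mod R X\<^esub>"
        using c by (auto simp: free_mod_def l_neg)
      have "{x. \<ominus>\<^bsub>R\<^esub> c x \<noteq> \<zero>\<^bsub>R\<^esub>} \<subseteq> {x. c x \<noteq> \<zero>\<^bsub>R\<^esub>}"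
        using minus_zero by auto
      with c show "(\<lambda>x. \<ominus>\<^bsub>R\<^esub> c x) \<in> carrier (free_mod R X)"
        by (auto simp: free_mod_def intro: finite_subset)
    qed
  qed (auto simp: free_mod_def fin a_ac)
  moreover have "left_module_axioms R (free_mod R X)"
    by unfold_locales (auto simp: free_mod_def fin' l_distr r_distr m_assoc)
  ultimately show ?thesis
    by (intro left_module.intro \<open>ring R\<close>)
qed

private lemma lin_superset:
  assumes "left_module R N" "c \<in> carrier (free_mod R X)" "v \<in> X \<rightarrow> carrier N"
    and "finite S" "{x. c x \<noteq> \<zero>\<^bsub>R\<^esub>} \<subseteq> S" "S \<subseteq> X"
  shows "lin R N v c = (\<Oplus>\<^bsub>N\<^esub>x\<in>S. c x \<odot>\<^bsub>N\<^esub> v x)"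
proof -
  interpret left_module R N by fact
  show ?thesis
    unfolding lin_def
  proof (rule M.add.finprod_mono_neutral_cong_left[OF assms(4,5)])
    show "c x \<odot>\<^bsub>N\<^esub> v x = \<zero>\<^bsub>N\<^esub>" if "x \<in> S - {x. c x \<noteq> \<zero>\<^bsub>R\<^esub>}" for x
      using that assms(3,6) by (auto intro!: smult_zeros[OF assms(1)])
    show "(\<lambda>x. c x \<odot>\<^bsub>N\<^esub> v x) \<in> S \<rightarrow> carrier N"
      using assms(2,3,6) by (auto simp: free_mod_def Pi_iff subset_iff)
  qed auto
qed

private lemma lin_hom:
  assumes "left_module R N" "v \<in> X \<rightarrow> carrier N"
  shows "lin R N v \<in> mod_hom R (free_mod R X) N"
proof -
  interpret left_module R N by fact
  have cl: "(\<lambda>x. c x \<odot>\<^bsub>N\<^esub> v x) \<in> S \<rightarrow> carrier N" if "c \<in> carrier (free_mod R X)" "S \<subseteq> X" for c S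
    using that assms(2) by (auto simp: free_mod_def Pi_iff subset_iff)
  have sub: "{x. c x \<noteq> \<zero>\<^bsub>R\<^esub>} \<subseteq> X" "finite {x. c x \<noteq> \<zero>\<^bsub>R\<^esub>}" if "c \<in> carrier (free_mod R X)" for c
    using that by (auto simp: free_mod_def)
  interpret fm: left_module R "free_mod R X" by (rule free_mod[OF R.ring_axioms])
  show ?thesis
    unfolding mod_hom_def
  proof (intro CollectI conjI ballI Pi_I)
    fix c assume c: "c \<in> carrier (free_mod R X)"
    show "lin R N v c \<in> carrier N"
      unfolding lin_def by (intro M.finsum_closed cl c sub)
    fix d assume d: "d \<in> carrier (free_mod R X)"
    define S where "S = {x. c x \<noteq> \<zero>\<^bsub>R\<^esub>} \<union> {x. d x \<noteq> \<zero>\<^bsub>R\<^esub>}"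
    have S: "finite S" "S \<subseteq> X"
      using sub[OF c] sub[OF d] by (auto simp: S_def)
    have cd: "c \<oplus>\<^bsub>free_mod R X\<^esub> d \<in> carrier (free_mod R X)"
      using c d by simp
    have "lin R N v (c \<oplus>\<^bsub>free_mod R X\<^esub> d)
        = (\<Oplus>\<^bsub>N\<^esub>x\<in>S. (c \<oplus>\<^bsub>free_mod R X\<^esub> d) x \<odot>\<^bsub>N\<^esub> v x)"
      by (intro lin_superset[OF assms(1) cd assms(2)] S) (auto simp: S_def free_mod_def)
    also have "\<dots> = (\<Oplus>\<^bsub>N\<^esub>x\<in>S. c x \<odot>\<^bsub>N\<^esub> v x \<oplus>\<^bsub>N\<^esub> d x \<odot>\<^bsub>N\<^esub> v x)"
    proof (rule M.finsum_cong'[OF refl])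
      show "(\<lambda>x. c x \<odot>\<^bsub>N\<^esub> v x \<oplus>\<^bsub>N\<^esub> d x \<odot>\<^bsub>N\<^esub> v x) \<in> S \<rightarrow> carrier N"
        using cl[OF c S(2)] cl[OF d S(2)] by (auto simp: Pi_iff)
      show "(c \<oplus>\<^bsub>free_mod R X\<^esub> d) x \<odot>\<^bsub>N\<^esub> v x = c x \<odot>\<^bsub>N\<^esub> v x \<oplus>\<^bsub>N\<^esub> d x \<odot>\<^bsub>N\<^esub> v x" if "x \<in> S" for x
        using that S(2) assms(2) c d by (auto simp: free_mod_def Pi_iff subset_iff smult_l_distr)
    qed
    also have "\<dots> = (\<Oplus>\<^bsub>N\<^esub>x\<in>S. c x \<odot>\<^bsub>N\<^esub> v x) \<oplus>\<^bsub>N\<^esub> (\<Oplus>\<^bsub>N\<^esub>x\<in>S. d x \<odot>\<^bsub>N\<^esub> v x)"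
      by (intro M.finsum_addf cl c d S)
    also have "\<dots> = lin R N v c \<oplus>\<^bsub>N\<^esub> lin R N v d"
      using lin_superset[OF assms(1) c assms(2) S(1) _ S(2)]
        lin_superset[OF assms(1) d assms(2) S(1) _ S(2)] by (auto simp: S_def)
    finally show "lin R N v (c \<oplus>\<^bsub>free_mod R X\<^esub> d) = lin R N v c \<oplus>\<^bsub>N\<^esub> lin R N v d" .
  next
    fix r c assume r: "r \<in> carrier R" and c: "c \<in> carrier (free_mod R X)"
    define S where "S = {x. c x \<noteq> \<zero>\<^bsub>R\<^esub>}"
    have S: "finite S" "S \<subseteq> X"
      using sub[OF c] by (auto simp: S_def)
    have rc: "r \<odot>\<^bsub>free_mod R X\<^esub> c \<in> carrier (free_mod R X)"
      using r c by simp
    have "lin R N v (r \<odot>\<^bsub>free_mod R X\<^esub> c) = (\<Oplus>\<^bsub>N\<^esub>x\<in>S. (r \<odot>\<^bsub>free_mod R X\<^esub> c) x \<odot>\<^bsub>N\<^esub> v x)"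
      by (intro lin_superset[OF assms(1) rc assms(2)] S) (use r in \<open>auto simp: S_def free_mod_def\<close>)
    also have "\<dots> = (\<Oplus>\<^bsub>N\<^esub>x\<in>S. r \<odot>\<^bsub>N\<^esub> (c x \<odot>\<^bsub>N\<^esub> v x))"
    proof (rule M.finsum_cong'[OF refl])
      show "(\<lambda>x. r \<odot>\<^bsub>N\<^esub> (c x \<odot>\<^bsub>N\<^esub> v x)) \<in> S \<rightarrow> carrier N"
        using cl[OF c S(2)] r by (auto simp: Pi_iff)
      show "(r \<odot>\<^bsub>free_mod R X\<^esub> c) x \<odot>\<^bsub>N\<^esub> v x = r \<odot>\<^bsub>N\<^esub> (c x \<odot>\<^bsub>N\<^esub> v x)" if "x \<in> S" for x
        using that S(2) assms(2) c r by (auto simp: free_mod_def Pi_iff subset_iff smult_assoc1)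
    qed
    also have "\<dots> = r \<odot>\<^bsub>N\<^esub> (\<Oplus>\<^bsub>N\<^esub>x\<in>S. c x \<odot>\<^bsub>N\<^esub> v x)"
      using S(1) cl[OF c S(2)]
    proof (induction S)
      case empty
      then show ?case using r by (simp add: smult_zeros[OF assms(1)])
    next
      case (insert y S)
      then show ?case using r
        by (subst (1 2) M.finsum_insert) (auto simp: Pi_iff smult_r_distr M.finsum_closed)
    qed
    finally show "lin R N v (r \<odot>\<^bsub>free_mod R X\<^esub> c) = r \<odot>\<^bsub>N\<^esub> lin R N v c"
      by (simp add: lin_def S_def)
  qed
qed

private lemma hom_lin:
  assumes "left_module R M" "left_module R N" "g \<in> mod_hom R M N"
    and "v \<in> X \<rightarrow> carrier M" "c \<in> carrier (free_mod R X)"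
  shows "g (lin R M v c) = lin R N (\<lambda>x. g (v x)) c"
proof -
  interpret M: left_module R M by fact
  interpret N: left_module R N by fact
  have gc: "g x \<in> carrier N" if "x \<in> carrier M" for x
    using assms(3) that by (auto simp: mod_hom_def)
  have ga: "g (x \<oplus>\<^bsub>M\<^esub> y) = g x \<oplus>\<^bsub>N\<^esub> g y" if "x \<in> carrier M" "y \<in> carrier M" for x y
    using assms(3) that by (auto simp: mod_hom_def)
  have gs: "g (r \<odot>\<^bsub>M\<^esub> x) = r \<odot>\<^bsub>N\<^esub> g x" if "r \<in> carrier R" "x \<in> carrier M" for r x
    using assms(3) that by (auto simp: mod_hom_def)
  have g0: "g \<zero>\<^bsub>M\<^esub> = \<zero>\<^bsub>N\<^esub>"
    using ga[of "\<zero>\<^bsub>M\<^esub>" "\<zero>\<^bsub>M\<^esub>"] gc[of "\<zero>\<^bsub>M\<^esub>"] by (simp add: N.M.add.l_cancel_one')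
  define S where "S = {x. c x \<noteq> \<zero>\<^bsub>R\<^esub>}"
  have c: "c x \<in> carrier R" for x
    using assms(5) by (auto simp: free_mod_def)
  have "finite S" "v \<in> S \<rightarrow> carrier M"
    using assms(4,5) by (auto simp: S_def free_mod_def Pi_iff)
  then have "g (\<Oplus>\<^bsub>M\<^esub>x\<in>S. c x \<odot>\<^bsub>M\<^esub> v x) = (\<Oplus>\<^bsub>N\<^esub>x\<in>S. c x \<odot>\<^bsub>N\<^esub> g (v x))"
  proof (induction S)
    case empty
    then show ?case by (simp add: g0)
  next
    case (insert y S)
    then show ?case
      by (subst M.M.finsum_insert, auto simp: Pi_iff c, subst N.M.finsum_insert)
        (auto simp: Pi_iff c gc ga gs M.M.finsum_closed)
  qed
  then show ?thesis by (simp add: lin_def S_def)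
qed

lemma projective_lift:
  fixes P :: "('r, 'm) module"
    and M :: "('r, 'a, 'd) module_scheme" and N :: "('r, 'b, 'e) module_scheme"
  assumes P: "projective R P" and M: "left_module R M" and N: "left_module R N"
    and f: "f \<in> mod_hom R P N" and g: "g \<in> mod_hom R M N"
    and surj: "g ` carrier M = carrier N"
  shows "\<exists>h\<in>mod_hom R P M. \<forall>x\<in>carrier P. g (h x) = f x"
proof -
  have P': "left_module R P"
    using P by (simp add: projective_def)
  then interpret P: left_module R P .
  define X where "X = carrier P"
  define L where "L = (free_mod R X :: ('r, 'm \<Rightarrow> 'r) module)"
  have L: "left_module R L"
    unfolding L_def by (rule free_mod[OF P.R.ring_axioms])
  have q: "lin R P id \<in> mod_hom R L P"
    unfolding L_def by (rule lin_hom[OF P']) (simp add: X_def)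
  have "x \<in> lin R P id ` carrier L" if x: "x \<in> carrier P" for x
  proof (cases "\<one>\<^bsub>R\<^esub> = \<zero>\<^bsub>R\<^esub>")
    case True
    then have "x = \<zero>\<^bsub>P\<^esub>"
      using P.smult_one[OF x] smult_zeros(1)[OF P' x] by simp
    moreover have "lin R P id (\<lambda>_. \<zero>\<^bsub>R\<^esub>) = \<zero>\<^bsub>P\<^esub>" "(\<lambda>_. \<zero>\<^bsub>R\<^esub>) \<in> carrier L"
      by (simp_all add: lin_def L_def free_mod_def)
    ultimately show ?thesis by (metis image_eqI)
  next
    case False
    define c where "c = (\<lambda>y. if y = x then \<one>\<^bsub>R\<^esub> else \<zero>\<^bsub>R\<^esub>)"
    have "{y. c y \<noteq> \<zero>\<^bsub>R\<^esub>} = {x}"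
      using False by (auto simp: c_def)
    moreover have "c \<in> carrier L"
      using x by (auto simp: c_def L_def free_mod_def X_def)
    moreover have "c x = \<one>\<^bsub>R\<^esub>" by (simp add: c_def)
    ultimately have "lin R P id c = x"
      using x by (simp add: lin_def)
    with \<open>c \<in> carrier L\<close> show ?thesis by blast
  qed
  then have qs: "lin R P id ` carrier L = carrier P"
    using q by (auto simp: mod_hom_def)
  have "(\<lambda>x. x) \<in> mod_hom R P P"
    by (auto simp: mod_hom_def)
  then obtain s where s: "s \<in> mod_hom R P L" "\<And>x. x \<in> carrier P \<Longrightarrow> lin R P id (s x) = x"
    using P L P' q qs unfolding projective_def by meson
  define v where "v = (\<lambda>x. SOME y. y \<in> carrier M \<and> g y = f x)"
  have v: "v x \<in> carrier M \<and> g (v x) = f x" if "x \<in> X" for x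
  proof -
    have "f x \<in> g ` carrier M"
      using that f surj by (auto simp: X_def mod_hom_def)
    then show ?thesis
      unfolding v_def by (intro someI_ex[of "\<lambda>y. y \<in> carrier M \<and> g y = f x"]) auto
  qed
  then have vX: "v \<in> X \<rightarrow> carrier M" by auto
  have u: "lin R M v \<in> mod_hom R L M"
    unfolding L_def by (rule lin_hom[OF M vX])
  have "(\<lambda>x. lin R M v (s x)) \<in> mod_hom R P M"
    using u s(1) by (auto simp: mod_hom_def Pi_iff)
  moreover have "g (lin R M v (s x)) = f x" if x: "x \<in> carrier P" for x
  proof -
    have sx: "s x \<in> carrier (free_mod R X)"
      using s(1) x by (auto simp: mod_hom_def L_def)
    have "g (lin R M v (s x)) = lin R N (\<lambda>y. g (v y)) (s x)"
      by (rule hom_lin[OF M N g vX sx])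
    also have "\<dots> = lin R N (\<lambda>y. f (id y)) (s x)"
    proof -
      interpret N: left_module R N by fact
      show ?thesis
        unfolding lin_def
      proof (rule N.M.finsum_cong'[OF refl])
        show "(\<lambda>y. s x y \<odot>\<^bsub>N\<^esub> f (id y)) \<in> {y. s x y \<noteq> \<zero>\<^bsub>R\<^esub>} \<rightarrow> carrier N"
          using sx f by (auto simp: free_mod_def mod_hom_def X_def Pi_iff)
        show "s x y \<odot>\<^bsub>N\<^esub> g (v y) = s x y \<odot>\<^bsub>N\<^esub> f (id y)" if "y \<in> {y. s x y \<noteq> \<zero>\<^bsub>R\<^esub>}" for y
        proof -
          have "y \<in> X" using that sx by (auto simp: free_mod_def)
          then show ?thesis by (simp add: v)
        qed
      qed
    qed
    also have "\<dots> = f (lin R P id (s x))"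
      by (rule hom_lin[OF P' N f _ sx, symmetric]) (simp add: X_def)
    also have "\<dots> = f x" using s(2)[OF x] by simp
    finally show ?thesis .
  qed
  ultimately show ?thesis by (intro bexI[of _ "\<lambda>x. lin R M v (s x)"] ballI)
qed

end


section \<open>Tensor products\<close>

text \<open>
  In \<open>tensor R M N\<close> the first factor is a right module, whose action \<open>x r\<close> is written
  \<open>r \<odot>\<^bsub>M\<^esub> x\<close> in the record. The group operation is written multiplicatively.
\<close>

definition tensor_relations ::
    "('r, 'c) ring_scheme \<Rightarrow> ('r, 'm, 'd) module_scheme \<Rightarrow> ('r, 'n, 'e) module_scheme \<Rightarrow>
     ('m \<times> 'n \<Rightarrow>\<^sub>0 int) set"
  where "tensor_relations R M N =
    {frag_of (x \<oplus>\<^bsub>M\<^esub> x', y) - frag_of (x, y) - frag_of (x', y) | x x' y.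
       x \<in> carrier M \<and> x' \<in> carrier M \<and> y \<in> carrier N} \<union>
    {frag_of (x, y \<oplus>\<^bsub>N\<^esub> y') - frag_of (x, y) - frag_of (x, y') | x y y'.
       x \<in> carrier M \<and> y \<in> carrier N \<and> y' \<in> carrier N} \<union>
    {frag_of (r \<odot>\<^bsub>M\<^esub> x, y) - frag_of (x, r \<odot>\<^bsub>N\<^esub> y) | r x y.
       r \<in> carrier R \<and> x \<in> carrier M \<and> y \<in> carrier N}"

abbreviation tensor_free ::
    "('r, 'm, 'd) module_scheme \<Rightarrow> ('r, 'n, 'e) module_scheme \<Rightarrow> ('m \<times> 'n \<Rightarrow>\<^sub>0 int) monoid"
  where "tensor_free M N \<equiv> free_Abelian_group (carrier M \<times> carrier N)"

definition tensor_null ::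
    "('r, 'c) ring_scheme \<Rightarrow> ('r, 'm, 'd) module_scheme \<Rightarrow> ('r, 'n, 'e) module_scheme \<Rightarrow>
     ('m \<times> 'n \<Rightarrow>\<^sub>0 int) set"
  where "tensor_null R M N = generate (tensor_free M N) (tensor_relations R M N)"

definition tensor ::
    "('r, 'c) ring_scheme \<Rightarrow> ('r, 'm, 'd) module_scheme \<Rightarrow> ('r, 'n, 'e) module_scheme \<Rightarrow>
     ('m \<times> 'n \<Rightarrow>\<^sub>0 int) set monoid"
  where "tensor R M N = tensor_free M N Mod tensor_null R M N"

definition pure_tensor ::
    "('r, 'c) ring_scheme \<Rightarrow> ('r, 'm, 'd) module_scheme \<Rightarrow> ('r, 'n, 'e) module_scheme \<Rightarrow>
     'm \<Rightarrow> 'n \<Rightarrow> ('m \<times> 'n \<Rightarrow>\<^sub>0 int) set"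
  where "pure_tensor R M N x y = tensor_null R M N #>\<^bsub>tensor_free M N\<^esub> frag_of (x, y)"

text \<open>The map \<open>\<phi> \<otimes> 1 : M \<otimes> N \<rightarrow> M' \<otimes> N\<close> on cosets.\<close>

definition tensor_map ::
    "('r, 'c) ring_scheme \<Rightarrow> ('r, 'm, 'd) module_scheme \<Rightarrow> ('r, 'm2, 'd2) module_scheme \<Rightarrow>
     ('r, 'n, 'e) module_scheme \<Rightarrow> ('m \<Rightarrow> 'm2) \<Rightarrow>
     ('m \<times> 'n \<Rightarrow>\<^sub>0 int) set \<Rightarrow> ('m2 \<times> 'n \<Rightarrow>\<^sub>0 int) set"
  where "tensor_map R M M' N \<phi> A =
    (\<Union>a\<in>A. tensor_null R M' N #>\<^bsub>tensor_free M' N\<^esub>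
       frag_extend (\<lambda>(x, y). frag_of (\<phi> x, y)) a)"


section \<open>Group rings, resolutions and finiteness properties\<close>

text \<open>The element \<open>\<Sum>\<^sub>g r\<^sub>g g\<close> is the finitely supported function \<open>r\<close>, and \<open>frag_of g\<close> is \<open>g\<close> itself.\<close>

definition group_ring :: "('g, 'b) monoid_scheme \<Rightarrow> ('g \<Rightarrow>\<^sub>0 int) ring"
  where "group_ring G =
    \<lparr>carrier = {r. Poly_Mapping.keys r \<subseteq> carrier G},
     monoid.mult = (\<lambda>r s. frag_extend (\<lambda>g. frag_extend (\<lambda>h. frag_of (g \<otimes>\<^bsub>G\<^esub> h)) s) r),
     one = frag_of \<one>\<^bsub>G\<^esub>, ring.zero = 0, ring.add = (+)\<rparr>"

definition trivial_module :: "('g \<Rightarrow>\<^sub>0 int, int) module"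
  where "trivial_module =
    \<lparr>carrier = UNIV, monoid.mult = (*), one = 1, ring.zero = 0, ring.add = (+),
     smult = (\<lambda>r k. (\<Sum>g\<in>Poly_Mapping.keys r. Poly_Mapping.lookup r g) * k)\<rparr>"

text \<open>The right module obtained from a left module by \<open>x g = g\<^sup>-\<^sup>1 x\<close>.\<close>

definition right_of_left ::
    "('g, 'b) monoid_scheme \<Rightarrow> ('g \<Rightarrow>\<^sub>0 int, 'm) module \<Rightarrow> ('g \<Rightarrow>\<^sub>0 int, 'm) module"
  where "right_of_left G M =
    M\<lparr>smult := (\<lambda>r x. frag_extend (\<lambda>g. frag_of (inv\<^bsub>G\<^esub> g)) r \<odot>\<^bsub>M\<^esub> x)\<rparr>"

text \<open>
  \<open>F\<^sub>n \<rightarrow> \<dots> \<rightarrow> F\<^sub>0 \<rightarrow> \<int> \<rightarrow> 0\<close> is exact with \<open>F\<^sub>0, \<dots>, F\<^sub>n\<close> projective, where \<open>d i : F\<^sub>i \<rightarrow> F\<^sub>i\<^sub>-\<^sub>1\<close> for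
  \<open>i \<ge> 1\<close>; the map \<open>d 0\<close> is not used.
\<close>

definition partial_resolution ::
    "nat \<Rightarrow> ('g, 'b) monoid_scheme \<Rightarrow> (nat \<Rightarrow> ('g \<Rightarrow>\<^sub>0 int, 'm) module) \<Rightarrow>
     (nat \<Rightarrow> 'm \<Rightarrow> 'm) \<Rightarrow> ('m \<Rightarrow> int) \<Rightarrow> bool"
  where "partial_resolution n G F d \<epsilon> \<longleftrightarrow>
    (\<forall>i\<le>n. projective (group_ring G) (F i)) \<and>
    \<epsilon> \<in> mod_hom (group_ring G) (F 0) trivial_module \<and>
    (\<forall>i<n. d (Suc i) \<in> mod_hom (group_ring G) (F (Suc i)) (F i)) \<and>
    \<epsilon> ` carrier (F 0) = UNIV \<and>
    (0 < n \<longrightarrow> d 1 ` carrier (F 1) = {x \<in> carrier (F 0). \<epsilon> x = 0}) \<and>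
    (\<forall>i. Suc i < n \<longrightarrow> d (Suc (Suc i)) ` carrier (F (Suc (Suc i))) =
       {x \<in> carrier (F (Suc i)). d (Suc i) x = \<zero>\<^bsub>F i\<^esub>})"

definition projective_resolution ::
    "('g, 'b) monoid_scheme \<Rightarrow> (nat \<Rightarrow> ('g \<Rightarrow>\<^sub>0 int, 'm) module) \<Rightarrow>
     (nat \<Rightarrow> 'm \<Rightarrow> 'm) \<Rightarrow> ('m \<Rightarrow> int) \<Rightarrow> bool"
  where "projective_resolution G F d \<epsilon> \<longleftrightarrow> (\<forall>n. partial_resolution n G F d \<epsilon>)"

text \<open>
  The modules may be taken on the type of \<open>\<int>[G]\<^sup>m\<close>, because a finitely generated projective
  module is isomorphic to a submodule (a direct summand) of some \<open>\<int>[G]\<^sup>m\<close>.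
\<close>

definition type_FP :: "nat \<Rightarrow> ('g, 'b) monoid_scheme \<Rightarrow> bool"
  where "type_FP n G \<longleftrightarrow>
    (\<exists>(F :: nat \<Rightarrow> ('g \<Rightarrow>\<^sub>0 int, nat \<Rightarrow> 'g \<Rightarrow>\<^sub>0 int) module) d \<epsilon>.
       partial_resolution n G F d \<epsilon> \<and> (\<forall>i\<le>n. finitely_generated (group_ring G) (F i)))"

definition center :: "('g, 'b) monoid_scheme \<Rightarrow> 'g set"
  where "center G = {z \<in> carrier G. \<forall>g\<in>carrier G. g \<otimes>\<^bsub>G\<^esub> z = z \<otimes>\<^bsub>G\<^esub> g}"


section \<open>The module \<open>l\<^sup>p(G)\<close>\<close>

text \<open>
  Formal sums are functions vanishing outside \<open>carrier G\<close>; summability forces the support to be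
  countable. The action extends \<open>(g f)\<^sub>h = f\<^bsub>g\<^sup>-\<^sup>1 h\<^esub>\<close>, that is \<open>g \<cdot> \<Sum> f\<^sub>h h = \<Sum> f\<^sub>h g h\<close>.
\<close>

definition lp_module ::
    "real \<Rightarrow> ('g, 'b) monoid_scheme \<Rightarrow> ('g \<Rightarrow>\<^sub>0 int, 'g \<Rightarrow> complex) module"
  where "lp_module p G =
    \<lparr>carrier = {f. (\<forall>g. g \<notin> carrier G \<longrightarrow> f g = 0) \<and>
                   (\<lambda>g. cmod (f g) powr p) summable_on carrier G},
     monoid.mult = undefined, one = undefined,
     ring.zero = (\<lambda>h. 0), ring.add = (\<lambda>f f' h. f h + f' h),
     smult = (\<lambda>r f h. if h \<in> carrier G
       then \<Sum>g\<in>Poly_Mapping.keys r. of_int (Poly_Mapping.lookup r g) * f (inv\<^bsub>G\<^esub> g \<otimes>\<^bsub>G\<^esub> h)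
       else 0)\<rparr>"

definition lp_norm :: "real \<Rightarrow> ('g, 'b) monoid_scheme \<Rightarrow> ('g \<Rightarrow> complex) \<Rightarrow> real"
  where "lp_norm p G f = (\<Sum>\<^sub>\<infinity>g\<in>carrier G. cmod (f g) powr p) powr (1 / p)"

definition lp_topology :: "real \<Rightarrow> ('g, 'b) monoid_scheme \<Rightarrow> ('g \<Rightarrow> complex) topology"
  where "lp_topology p G =
    Metric_space.mtopology (carrier (lp_module p G)) (\<lambda>f f'. lp_norm p G (\<lambda>g. f g - f' g))"


section \<open>Reduced \<open>l\<^sup>p\<close>-homology\<close>

abbreviation lp_tensor ::
    "real \<Rightarrow> ('g, 'b) monoid_scheme \<Rightarrow> ('g \<Rightarrow>\<^sub>0 int, 'm) module \<Rightarrow>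
     ('m \<times> ('g \<Rightarrow> complex) \<Rightarrow>\<^sub>0 int) set monoid"
  where "lp_tensor p G M \<equiv> tensor (group_ring G) (right_of_left G M) (lp_module p G)"

text \<open>
  For \<open>x\<^sub>1, \<dots>, x\<^sub>m\<close> in \<open>M\<close>, this is the map \<open>l\<^sup>p(G)\<^sup>m \<rightarrow> M \<otimes> l\<^sup>p(G)\<close>,
  \<open>(f\<^sub>1, \<dots>, f\<^sub>m) \<mapsto> \<Sum>\<^sub>j x\<^sub>j \<otimes> f\<^sub>j\<close>.
\<close>

definition tensor_sum ::
    "real \<Rightarrow> ('g, 'b) monoid_scheme \<Rightarrow> ('g \<Rightarrow>\<^sub>0 int, 'm) module \<Rightarrow> nat \<Rightarrow> (nat \<Rightarrow> 'm) \<Rightarrow>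
     (nat \<Rightarrow> 'g \<Rightarrow> complex) \<Rightarrow> ('m \<times> ('g \<Rightarrow> complex) \<Rightarrow>\<^sub>0 int) set"
  where "tensor_sum p G M m x f =
    (\<Otimes>\<^bsub>lp_tensor p G M\<^esub>j\<in>{..<m}.
       pure_tensor (group_ring G) (right_of_left G M) (lp_module p G) (x j) (f j))"

text \<open>
  \<open>M \<otimes> l\<^sup>p(G)\<close> carries the finest topology making all these maps continuous. If
  \<open>x\<^sub>1, \<dots>, x\<^sub>m\<close> generate \<open>M\<close>, every other such map factors through the one for \<open>x\<close> by a
  continuous map between powers of \<open>l\<^sup>p(G)\<close>, so this is the quotient topology from \<open>l\<^sup>p(G)\<^sup>m\<close>.
  In particular, if \<open>M\<close> is free with basis \<open>x\<^sub>1, \<dots>, x\<^sub>m\<close>, then it is the topology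
  of \<open>l\<^sup>p(G)\<^sup>m\<close>, and if \<open>M\<close> is a direct summand of such a module, it is the topology of
  the direct summand \<open>M \<otimes> l\<^sup>p(G)\<close> of \<open>l\<^sup>p(G)\<^sup>m\<close>.
\<close>

definition lp_tensor_open ::
    "real \<Rightarrow> ('g, 'b) monoid_scheme \<Rightarrow> ('g \<Rightarrow>\<^sub>0 int, 'm) module \<Rightarrow>
     ('m \<times> ('g \<Rightarrow> complex) \<Rightarrow>\<^sub>0 int) set set \<Rightarrow> bool"
  where "lp_tensor_open p G M U \<longleftrightarrow> U \<subseteq> carrier (lp_tensor p G M) \<and>
    (\<forall>m. \<forall>x\<in>{..<m} \<rightarrow> carrier M.
       openin (product_topology (\<lambda>j. lp_topology p G) {..<m})
         {f \<in> topspace (product_topology (\<lambda>j. lp_topology p G) {..<m}).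
            tensor_sum p G M m x f \<in> U})"

definition lp_tensor_topology ::
    "real \<Rightarrow> ('g, 'b) monoid_scheme \<Rightarrow> ('g \<Rightarrow>\<^sub>0 int, 'm) module \<Rightarrow>
     ('m \<times> ('g \<Rightarrow> complex) \<Rightarrow>\<^sub>0 int) set topology"
  where "lp_tensor_topology p G M = topology (lp_tensor_open p G M)"

lemma openin_lp_tensor_topology: "openin (lp_tensor_topology p G M) = lp_tensor_open p G M"
proof -
  have "istopology (lp_tensor_open p G M)"
    unfolding istopology_def
  proof (intro conjI allI impI)
    fix S T assume S: "lp_tensor_open p G M S" and T: "lp_tensor_open p G M T"
    have *: "{f \<in> A. b f \<in> S \<inter> T} = {f \<in> A. b f \<in> S} \<inter> {f \<in> A. b f \<in> T}" for A b
      by blast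
    show "lp_tensor_open p G M (S \<inter> T)"
      unfolding lp_tensor_open_def *
    proof (intro conjI allI ballI openin_Int)
      show "S \<inter> T \<subseteq> carrier (lp_tensor p G M)"
        using S unfolding lp_tensor_open_def by blast
    qed (use S T in \<open>auto simp only: lp_tensor_open_def\<close>)
  next
    fix K assume K: "\<forall>S\<in>K. lp_tensor_open p G M S"
    have *: "{f \<in> A. b f \<in> \<Union>K} = (\<Union>S\<in>K. {f \<in> A. b f \<in> S})" for A b
      by blast
    show "lp_tensor_open p G M (\<Union>K)"
      unfolding lp_tensor_open_def *
    proof (intro conjI allI ballI openin_Union)
      show "\<Union>K \<subseteq> carrier (lp_tensor p G M)"
        using K unfolding lp_tensor_open_def by blast
    qed (use K in \<open>auto simp only: lp_tensor_open_def\<close>)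
  qed
  then show ?thesis
    by (simp add: lp_tensor_topology_def)
qed

text \<open>\<open>d\<^sub>i \<otimes> 1\<close>, with the zero map for \<open>i = 0\<close>; as \<open>0 - 1 = 0\<close> on \<open>nat\<close>, that map goes from degree 0 to degree 0.\<close>

definition lp_boundary ::
    "real \<Rightarrow> ('g, 'b) monoid_scheme \<Rightarrow> (nat \<Rightarrow> ('g \<Rightarrow>\<^sub>0 int, 'm) module) \<Rightarrow> (nat \<Rightarrow> 'm \<Rightarrow> 'm) \<Rightarrow> nat \<Rightarrow>
     ('m \<times> ('g \<Rightarrow> complex) \<Rightarrow>\<^sub>0 int) set \<Rightarrow> ('m \<times> ('g \<Rightarrow> complex) \<Rightarrow>\<^sub>0 int) set"
  where "lp_boundary p G F d i =
    (if i = 0 then (\<lambda>_. \<one>\<^bsub>lp_tensor p G (F 0)\<^esub>)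
     else tensor_map (group_ring G) (right_of_left G (F i)) (right_of_left G (F (i - 1)))
            (lp_module p G) (d i))"

definition reduced_lp_homology ::
    "real \<Rightarrow> ('g, 'b) monoid_scheme \<Rightarrow> (nat \<Rightarrow> ('g \<Rightarrow>\<^sub>0 int, 'm) module) \<Rightarrow> (nat \<Rightarrow> 'm \<Rightarrow> 'm) \<Rightarrow> nat \<Rightarrow>
     ('m \<times> ('g \<Rightarrow> complex) \<Rightarrow>\<^sub>0 int) set set monoid"
  where "reduced_lp_homology p G F d i =
    (lp_tensor p G (F i))
      \<lparr>carrier := kernel (lp_tensor p G (F i)) (lp_tensor p G (F (i - 1))) (lp_boundary p G F d i)\<rparr>
    Mod (lp_tensor_topology p G (F i) closure_of
           (lp_boundary p G F d (Suc i) ` carrier (lp_tensor p G (F (Suc i)))))"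


section \<open>Reduced \<open>l\<^sup>p\<close>-cohomology\<close>

text \<open>Homomorphisms are normalised to be \<open>undefined\<close> outside \<open>carrier M\<close>.\<close>

definition lp_hom ::
    "real \<Rightarrow> ('g, 'b) monoid_scheme \<Rightarrow> ('g \<Rightarrow>\<^sub>0 int, 'm) module \<Rightarrow> ('m \<Rightarrow> 'g \<Rightarrow> complex) monoid"
  where "lp_hom p G M =
    \<lparr>carrier = mod_hom (group_ring G) M (lp_module p G) \<inter> extensional (carrier M),
     monoid.mult = (\<lambda>\<phi> \<psi>. \<lambda>x\<in>carrier M. \<phi> x \<oplus>\<^bsub>lp_module p G\<^esub> \<psi> x),
     one = (\<lambda>x\<in>carrier M. \<zero>\<^bsub>lp_module p G\<^esub>)\<rparr>"

text \<open>
  The topology of pointwise convergence. If \<open>x\<^sub>1, \<dots>, x\<^sub>m\<close> generate \<open>M\<close>, it is induced by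
  the injection \<open>\<phi> \<mapsto> (\<phi> x\<^sub>1, \<dots>, \<phi> x\<^sub>m)\<close> into \<open>l\<^sup>p(G)\<^sup>m\<close>; this injection is bijective if the
  \<open>x\<^sub>j\<close> form a basis.
\<close>

definition lp_hom_topology ::
    "real \<Rightarrow> ('g, 'b) monoid_scheme \<Rightarrow> ('g \<Rightarrow>\<^sub>0 int, 'm) module \<Rightarrow> ('m \<Rightarrow> 'g \<Rightarrow> complex) topology"
  where "lp_hom_topology p G M =
    subtopology (product_topology (\<lambda>x. lp_topology p G) (carrier M)) (carrier (lp_hom p G M))"

text \<open>\<open>\<phi> \<mapsto> \<phi> \<circ> d\<^sub>i\<close>, with the zero map for \<open>i = 0\<close>, again from degree 0 to degree 0.\<close>

definition lp_coboundary ::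
    "real \<Rightarrow> ('g, 'b) monoid_scheme \<Rightarrow> (nat \<Rightarrow> ('g \<Rightarrow>\<^sub>0 int, 'm) module) \<Rightarrow> (nat \<Rightarrow> 'm \<Rightarrow> 'm) \<Rightarrow> nat \<Rightarrow>
     ('m \<Rightarrow> 'g \<Rightarrow> complex) \<Rightarrow> ('m \<Rightarrow> 'g \<Rightarrow> complex)"
  where "lp_coboundary p G F d i =
    (if i = 0 then (\<lambda>_. \<one>\<^bsub>lp_hom p G (F 0)\<^esub>)
     else (\<lambda>\<phi>. compose (carrier (F i)) \<phi> (d i)))"

definition reduced_lp_cohomology ::
    "real \<Rightarrow> ('g, 'b) monoid_scheme \<Rightarrow> (nat \<Rightarrow> ('g \<Rightarrow>\<^sub>0 int, 'm) module) \<Rightarrow> (nat \<Rightarrow> 'm \<Rightarrow> 'm) \<Rightarrow> nat \<Rightarrow>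
     ('m \<Rightarrow> 'g \<Rightarrow> complex) set monoid"
  where "reduced_lp_cohomology p G F d i =
    (lp_hom p G (F i))
      \<lparr>carrier := kernel (lp_hom p G (F i)) (lp_hom p G (F (Suc i))) (lp_coboundary p G F d (Suc i))\<rparr>
    Mod (lp_hom_topology p G (F i) closure_of
           (lp_coboundary p G F d i ` carrier (lp_hom p G (F (i - 1)))))"

end

theory Submission
  imports Defs
begin

text \<open>
  Choose distinct central elements \<open>z\<^sub>0, z\<^sub>1, \<dots>\<close>. The central element \<open>r\<^sub>N = \<Sum>\<^sub>k\<^sub><\<^sub>N (1 - z\<^sub>k)\<close> of the group
  ring has augmentation \<open>0\<close>, so multiplication by it is null-homotopic on a projective resolution,
  and hence \<open>r\<^sub>N/N\<close> maps (co)cycles to (co)boundaries. On \<open>l\<^sup>p(G)\<close> it acts as \<open>1 - A\<^sub>N\<close>, where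
  \<open>A\<^sub>N = (z\<^sub>0 + \<dots> + z\<^sub>N\<^sub>-\<^sub>1)/N\<close>. For \<open>p > 1\<close> the operators \<open>A\<^sub>N\<close> converge to \<open>0\<close> pointwise in norm: this holds on
  finitely supported functions, and the \<open>A\<^sub>N\<close> have norm at most \<open>1\<close>. So every (co)cycle is a limit of
  (co)boundaries. Conversely, such limits are (co)cycles because the (co)boundary maps are
  continuous with Hausdorff targets; in homology the Hausdorff property comes from a finite dual basis
  of the projective module \<open>F\<^sub>i\<^sub>-\<^sub>1\<close>.
\<close>

section \<open>Minkowski's inequality and the space \<open>l\<^sup>p(G)\<close>\<close>

text \<open>Infinitude of the center is used only through an injective sequence. Powers of one
  central element would not do: the center may be a torsion group, and averages over the powers of
  an element of finite order do not tend to zero. Centrality makes multiplication by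
  \<open>r\<^sub>N\<close> linear over the group ring, so that it is an endomorphism of the
  resolution at all. Division by \<open>N\<close> is impossible over the integers. The null-homotopy
  is therefore built integrally, and the factor \<open>1/N\<close> acts only on l^p(G), with which
  the group ring action commutes. The homotopies enter purely algebraically: they exhibit each
  approximant as an exact (co)boundary, and the only limit taken is the one in l^p(G). The two
  closedness arguments differ because pointwise convergence of homomorphisms inherits the Hausdorff
  property from l^p(G), whereas the tensor product is a quotient with a final topology, where
  separation has to be produced by explicit continuous functionals.\<close>

lemma powr_convex_combination:
  fixes u v t p :: real
  assumes "p \<ge> 1" "0 \<le> t" "t \<le> 1" "0 \<le> u" "0 \<le> v"
  shows "(t * u + (1 - t) * v) powr p \<le> t * u powr p + (1 - t) * v powr p"
proof -
  \<comment> \<open>If \<open>u\<close> or \<open>v\<close> vanishes, the claim reduces to this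
    bound for the remaining weight; convexity is applied only between positive points.\<close>
  have scale: "s powr p \<le> s" if "0 \<le> s" "s \<le> 1" for s :: real
    using powr_mono'[of 1 p s] that assms(1) by (cases "s = 0") auto
  consider "u = 0" | "v = 0" | "u > 0" "v > 0"
    using assms by linarith
  then show ?thesis
  proof cases
    case 1
    then show ?thesis
      using scale[of "1 - t"] assms by (simp add: powr_mult mult_right_mono)
  next
    case 2
    then show ?thesis
      using scale[of t] assms by (simp add: powr_mult mult_right_mono)
  next
    case 3
    have "(t *\<^sub>R u + (1 - t) *\<^sub>R v) powr p \<le> t * u powr p + (1 - t) * v powr p"
      using convex_onD[OF powr_convex[OF assms(1)], of "1 - t" u v] assms 3 by simp
    then show ?thesis by simp
  qed
qed

text \<open>Summability and the norm bound both come from one pointwise majorant obtained by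
  convexity, so no dual exponent enters.\<close>

lemma Minkowski_infsum:
  fixes f g :: "'a \<Rightarrow> 'b::real_normed_vector"
  assumes p: "p \<ge> 1"
    and f: "(\<lambda>x. norm (f x) powr p) summable_on X"
    and g: "(\<lambda>x. norm (g x) powr p) summable_on X"
  shows "(\<lambda>x. norm (f x + g x) powr p) summable_on X" (is ?S)
    and "(\<Sum>\<^sub>\<infinity>x\<in>X. norm (f x + g x) powr p) powr (1 / p) \<le>
      (\<Sum>\<^sub>\<infinity>x\<in>X. norm (f x) powr p) powr (1 / p) + (\<Sum>\<^sub>\<infinity>x\<in>X. norm (g x) powr p) powr (1 / p)"
proof -
  define a where "a = (\<Sum>\<^sub>\<infinity>x\<in>X. norm (f x) powr p) powr (1 / p)"
  define b where "b = (\<Sum>\<^sub>\<infinity>x\<in>X. norm (g x) powr p) powr (1 / p)"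
  have nonneg: "0 \<le> (\<Sum>\<^sub>\<infinity>x\<in>X. norm (h x) powr p)" for h :: "'a \<Rightarrow> 'b"
    by (intro infsum_nonneg) auto
  have apow: "(\<Sum>\<^sub>\<infinity>x\<in>X. norm (f x) powr p) = a powr p" "(\<Sum>\<^sub>\<infinity>x\<in>X. norm (g x) powr p) = b powr p"
    using p nonneg by (auto simp: a_def b_def powr_powr)
  have *: "?S \<and> (\<Sum>\<^sub>\<infinity>x\<in>X. norm (f x + g x) powr p) powr (1 / p) \<le> A + B"
    if AB: "A > a" "B > b" for A B
  proof -
    have pos: "a \<ge> 0" "b \<ge> 0" "A > 0" "B > 0" "A + B > 0"
    proof -
      show "a \<ge> 0" "b \<ge> 0"
        by (simp_all add: a_def b_def)
      with AB show "A > 0" "B > 0" "A + B > 0"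
        by linarith+
    qed
    define t where "t = A / (A + B)"
    have t: "0 \<le> t" "t \<le> 1" "1 - t = B / (A + B)"
      using pos by (auto simp: t_def field_simps)
    define h where "h = (\<lambda>x. (A + B) powr p * (t * A powr -p * norm (f x) powr p
      + (1 - t) * B powr -p * norm (g x) powr p))"
    \<comment> \<open>\<open>f + g\<close> is \<open>A + B\<close> times the convex combination of \<open>f / A\<close> and \<open>g / B\<close> with weight \<open>t\<close>; taking \<open>A\<close> and \<open>B\<close>
       strictly larger than the norms avoids division by zero.\<close>
    have le: "norm (f x + g x) powr p \<le> h x" for x
    proof -
      have "norm (f x + g x) \<le> (A + B) * (t * (norm (f x) / A) + (1 - t) * (norm (g x) / B))"
      proof -
        have "(A + B) * (t * (norm (f x) / A)) = norm (f x)" "(A + B) * ((1 - t) * (norm (g x) / B)) = norm (g x)"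
          using pos unfolding t(3) by (simp_all add: t_def)
        then show ?thesis
          using norm_triangle_ineq[of "f x" "g x"] by (simp add: distrib_left)
      qed
      then have "norm (f x + g x) powr p \<le> ((A + B) * (t * (norm (f x) / A) + (1 - t) * (norm (g x) / B))) powr p"
        using p by (intro powr_mono2) simp_all
      also have "\<dots> = (A + B) powr p * (t * (norm (f x) / A) + (1 - t) * (norm (g x) / B)) powr p"
        by (rule powr_mult)
      also have "\<dots> \<le> (A + B) powr p * (t * (norm (f x) / A) powr p + (1 - t) * (norm (g x) / B) powr p)"
        using pos t p by (intro mult_left_mono powr_convex_combination) auto
      also have "\<dots> = h x"
        using pos by (simp add: h_def powr_mult inverse_powr powr_minus divide_inverse mult_ac)
      finally show ?thesis .
    qed
    have hs: "(h has_sum (A + B) powr p * (t * A powr -p * a powr p + (1 - t) * B powr -p * b powr p)) X"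
      unfolding h_def
      by (intro has_sum_cmult_right has_sum_add) (auto simp: f g apow[symmetric])
    then have S: ?S
      by (intro summable_on_comparison_test[OF has_sum_imp_summable le]) simp_all
    have "(\<Sum>\<^sub>\<infinity>x\<in>X. norm (f x + g x) powr p)
        \<le> (A + B) powr p * (t * A powr -p * a powr p + (1 - t) * B powr -p * b powr p)"
      using infsum_mono[OF S has_sum_imp_summable[OF hs] le] infsumI[OF hs] by simp
    also have "\<dots> \<le> (A + B) powr p * (t * 1 + (1 - t) * 1)"
    proof -
      have "A powr -p * a powr p \<le> 1" "B powr -p * b powr p \<le> 1"
        using powr_mono2[of p a A] powr_mono2[of p b B] p pos AB
        by (auto simp: powr_minus divide_simps mult.commute)
      then have "t * (A powr -p * a powr p) \<le> t * 1" "(1 - t) * (B powr -p * b powr p) \<le> (1 - t) * 1"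
        using t by (intro mult_left_mono; simp)+
      then show ?thesis
        by (intro mult_left_mono) (simp_all add: mult.assoc)
    qed
    also have "\<dots> = (A + B) powr p" by simp
    finally have "(\<Sum>\<^sub>\<infinity>x\<in>X. norm (f x + g x) powr p) powr (1 / p) \<le> ((A + B) powr p) powr (1 / p)"
      using p nonneg[of "\<lambda>x. f x + g x"] by (intro powr_mono2) auto
    with S show ?thesis using p pos by (simp add: powr_powr)
  qed
  show ?S
    using *[of "a + 1" "b + 1"] by simp
  \<comment> \<open>The strict bounds \<open>A > a\<close> and \<open>B > b\<close> are relaxed by
    letting their joint excess \<open>e\<close> tend to zero.\<close>
  have "(\<Sum>\<^sub>\<infinity>x\<in>X. norm (f x + g x) powr p) powr (1 / p) \<le> a + b + e" if "e > 0" for e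
    using *[of "a + e / 2" "b + e / 2"] that by (simp add: field_simps)
  then show "(\<Sum>\<^sub>\<infinity>x\<in>X. norm (f x + g x) powr p) powr (1 / p) \<le>
      (\<Sum>\<^sub>\<infinity>x\<in>X. norm (f x) powr p) powr (1 / p) + (\<Sum>\<^sub>\<infinity>x\<in>X. norm (g x) powr p) powr (1 / p)"
    by (fold a_def b_def) (rule field_le_epsilon)
qed


section \<open>The normed space l^p(G)\<close>

locale lp_group = group G for G :: "('g, 'b) monoid_scheme" (structure) +
  fixes p :: real
  assumes p: "1 < p"
begin

abbreviation "L \<equiv> lp_module p G"

lemma lp_simps [simp]:
  "\<zero>\<^bsub>L\<^esub> = (\<lambda>h. 0)" "f \<oplus>\<^bsub>L\<^esub> g = (\<lambda>h. f h + g h)"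
  by (simp_all add: lp_module_def)

lemma lp_carrier:
  "f \<in> carrier L \<longleftrightarrow> (\<forall>g. g \<notin> carrier G \<longrightarrow> f g = 0) \<and> (\<lambda>g. cmod (f g) powr p) summable_on carrier G"
  by (simp add: lp_module_def)

lemma lp_outside: "f \<in> carrier L \<Longrightarrow> g \<notin> carrier G \<Longrightarrow> f g = 0"
  by (simp add: lp_carrier)

lemma lp_add [simp, intro]: "f \<in> carrier L \<Longrightarrow> g \<in> carrier L \<Longrightarrow> (\<lambda>x. f x + g x) \<in> carrier L"
  using Minkowski_infsum(1)[of p f "carrier G" g] p by (simp add: lp_carrier)

lemma lp_norm_add: "f \<in> carrier L \<Longrightarrow> g \<in> carrier L \<Longrightarrow> lp_norm p G (\<lambda>x. f x + g x) \<le> lp_norm p G f + lp_norm p G g"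
  using Minkowski_infsum(2)[of p f "carrier G" g] p by (simp add: lp_carrier lp_norm_def)

lemma lp_zero [simp, intro]: "(\<lambda>_. 0) \<in> carrier L"
  using p by (simp add: lp_carrier)

lemma lp_cmult [simp, intro]: "f \<in> carrier L \<Longrightarrow> (\<lambda>x. c * f x) \<in> carrier L"
  by (simp add: lp_carrier norm_mult powr_mult summable_on_cmult_right)

lemma lp_norm_cmult: "lp_norm p G (\<lambda>x. c * f x) = cmod c * lp_norm p G f"
  using p by (simp add: lp_norm_def norm_mult powr_mult infsum_cmult_right' infsum_nonneg powr_powr)

lemma lp_uminus [simp, intro]: "f \<in> carrier L \<Longrightarrow> (\<lambda>x. - f x) \<in> carrier L"
  using lp_cmult[of f "-1"] by simp

lemma lp_diff [simp, intro]: "f \<in> carrier L \<Longrightarrow> g \<in> carrier L \<Longrightarrow> (\<lambda>x. f x - g x) \<in> carrier L"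
  using lp_add[of f "\<lambda>x. - g x"] by simp

lemma lp_sum [simp, intro]: "(\<And>i. i \<in> I \<Longrightarrow> f i \<in> carrier L) \<Longrightarrow> (\<lambda>x. \<Sum>i\<in>I. f i x) \<in> carrier L"
  by (induction I rule: infinite_finite_induct) auto

lemma lp_norm_sum:
  "(\<And>i. i \<in> I \<Longrightarrow> f i \<in> carrier L) \<Longrightarrow> lp_norm p G (\<lambda>x. \<Sum>i\<in>I. f i x) \<le> (\<Sum>i\<in>I. lp_norm p G (f i))"
proof (induction I rule: infinite_finite_induct)
  case (insert i I)
  then have "lp_norm p G (\<lambda>x. f i x + (\<Sum>i\<in>I. f i x)) \<le> lp_norm p G (f i) + lp_norm p G (\<lambda>x. \<Sum>i\<in>I. f i x)"
    by (intro lp_norm_add) auto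
  with insert show ?case by (auto intro: order_trans)
qed (use p in \<open>simp_all add: lp_norm_def\<close>)

lemma lp_norm_nonneg [simp]: "0 \<le> lp_norm p G f"
  by (simp add: lp_norm_def)

lemma lp_norm_zero [simp]: "lp_norm p G (\<lambda>_. 0) = 0"
  using p by (simp add: lp_norm_def)

lemma lp_norm_eq_0_iff:
  assumes "f \<in> carrier L"
  shows "lp_norm p G f = 0 \<longleftrightarrow> f = (\<lambda>_. 0)"
proof
  assume "lp_norm p G f = 0"
  then have "(\<Sum>\<^sub>\<infinity>g\<in>carrier G. cmod (f g) powr p) \<le> 0"
    by (simp add: lp_norm_def)
  with assms have "cmod (f g) powr p = 0" if "g \<in> carrier G" for g
    using nonneg_infsum_le_0D[of "\<lambda>g. cmod (f g) powr p" "carrier G" g] that by (simp add: lp_carrier)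
  with assms show "f = (\<lambda>_. 0)"
    by (auto simp: lp_carrier fun_eq_iff)
qed (use p in auto)

sublocale lp: Metric_space "carrier L" "\<lambda>f g. lp_norm p G (\<lambda>x. f x - g x)"
proof
  show "lp_norm p G (\<lambda>x. f x - g x) = lp_norm p G (\<lambda>x. g x - f x)" for f g
    using lp_norm_cmult[of "-1" "\<lambda>x. f x - g x"] by simp
  show "lp_norm p G (\<lambda>x. f x - g x) = 0 \<longleftrightarrow> f = g" if "f \<in> carrier L" "g \<in> carrier L" for f g
    using that by (auto simp: lp_norm_eq_0_iff fun_eq_iff)
  show "lp_norm p G (\<lambda>x. f x - h x) \<le> lp_norm p G (\<lambda>x. f x - g x) + lp_norm p G (\<lambda>x. g x - h x)"
    if "f \<in> carrier L" "g \<in> carrier L" "h \<in> carrier L" for f g h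
    using lp_norm_add[of "\<lambda>x. f x - g x" "\<lambda>x. g x - h x"] that by auto
qed auto

lemma lp_topology: "lp_topology p G = lp.mtopology"
  by (simp add: lp_topology_def)

lemma topspace_lp [simp]: "topspace (lp_topology p G) = carrier L"
  by (simp add: lp_topology)

lemma Hausdorff_lp: "Hausdorff_space (lp_topology p G)"
  by (simp add: lp_topology lp.Hausdorff_space_mtopology)

lemma limitin_lp:
  "limitin (lp_topology p G) u f F \<longleftrightarrow> f \<in> carrier L \<and> (\<forall>\<^sub>F n in F. u n \<in> carrier L) \<and>
     ((\<lambda>n. lp_norm p G (\<lambda>x. u n x - f x)) \<longlongrightarrow> 0) F"
proof -
  have "lp_norm p G (\<lambda>x. u n x - f x) < e \<longleftrightarrow> dist (lp_norm p G (\<lambda>x. u n x - f x)) 0 < e" for n e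
    by simp
  \<comment> \<open>The metric form states membership in l^p(G) inside every epsilon clause; the
    instance \<open>1\<close> recovers it as a separate condition.\<close>
  then show ?thesis
    unfolding lp_topology lp.limitin_metric tendsto_iff
    by (auto simp: eventually_conj_iff dest: spec[of _ 1])
qed

end

section \<open>Averages of translates\<close>

context lp_group
begin

definition translate :: "'g \<Rightarrow> ('g \<Rightarrow> complex) \<Rightarrow> 'g \<Rightarrow> complex"
  where "translate g f = (\<lambda>h. if h \<in> carrier G then f (inv g \<otimes> h) else 0)"

lemma translate_powr:
  assumes "f \<in> carrier L" "g \<in> carrier G"
  shows "(\<lambda>h. cmod (translate g f h) powr p) summable_on carrier G"
    and "(\<Sum>\<^sub>\<infinity>h\<in>carrier G. cmod (translate g f h) powr p) = (\<Sum>\<^sub>\<infinity>h\<in>carrier G. cmod (f h) powr p)"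
proof -
  have bij: "bij_betw (\<lambda>h. inv g \<otimes> h) (carrier G) (carrier G)"
  proof (rule bij_betwI[where g = "\<lambda>h. g \<otimes> h"])
    show "g \<otimes> (inv g \<otimes> x) = x" "inv g \<otimes> (g \<otimes> x) = x" if "x \<in> carrier G" for x
      using that assms(2) by (simp_all flip: m_assoc)
  qed (use assms(2) in auto)
  have "(\<lambda>h. cmod (translate g f h) powr p) summable_on carrier G \<longleftrightarrow>
      (\<lambda>h. cmod (f (inv g \<otimes> h)) powr p) summable_on carrier G"
    by (intro summable_on_cong) (simp add: translate_def)
  also have "\<dots>"
    using assms(1) by (subst summable_on_reindex_bij_betw[OF bij]) (simp add: lp_carrier)
  finally show "(\<lambda>h. cmod (translate g f h) powr p) summable_on carrier G" .
  have "(\<Sum>\<^sub>\<infinity>h\<in>carrier G. cmod (translate g f h) powr p) = (\<Sum>\<^sub>\<infinity>h\<in>carrier G. cmod (f (inv g \<otimes> h)) powr p)"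
    by (intro infsum_cong) (simp add: translate_def)
  also have "\<dots> = (\<Sum>\<^sub>\<infinity>h\<in>carrier G. cmod (f h) powr p)"
    by (rule infsum_reindex_bij_betw[OF bij])
  finally show "(\<Sum>\<^sub>\<infinity>h\<in>carrier G. cmod (translate g f h) powr p) = (\<Sum>\<^sub>\<infinity>h\<in>carrier G. cmod (f h) powr p)" .
qed

lemma translate_lp [simp, intro]: "f \<in> carrier L \<Longrightarrow> g \<in> carrier G \<Longrightarrow> translate g f \<in> carrier L"
  using translate_powr(1)[of f g] by (simp add: lp_carrier translate_def)

lemma lp_norm_translate: "f \<in> carrier L \<Longrightarrow> g \<in> carrier G \<Longrightarrow> lp_norm p G (translate g f) = lp_norm p G f"
  by (simp add: lp_norm_def translate_powr)

lemma lp_finite_support: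
  assumes "finite S" "S \<subseteq> carrier G" "\<And>x. x \<notin> S \<Longrightarrow> f x = 0"
  shows "f \<in> carrier L"
    and "lp_norm p G f = (\<Sum>x\<in>S. cmod (f x) powr p) powr (1 / p)"
proof -
  have "(\<lambda>g. cmod (f g) powr p) summable_on carrier G \<longleftrightarrow> (\<lambda>g. cmod (f g) powr p) summable_on S"
    by (intro summable_on_cong_neutral) (use assms p in auto)
  then show "f \<in> carrier L"
    using assms by (auto simp: lp_carrier)
  have "(\<Sum>\<^sub>\<infinity>x\<in>carrier G. cmod (f x) powr p) = (\<Sum>\<^sub>\<infinity>x\<in>S. cmod (f x) powr p)"
    by (intro infsum_cong_neutral) (use assms p in auto)
  with assms(1) show "lp_norm p G f = (\<Sum>x\<in>S. cmod (f x) powr p) powr (1 / p)"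
    by (simp add: lp_norm_def)
qed

lemma average_delta:
  assumes z: "inj z" "range z \<subseteq> carrier G" and x: "x \<in> carrier G"
  shows "lp_norm p G (\<lambda>h. (1 / of_nat N) * (\<Sum>k<N. translate (z k) (\<lambda>y. if y = x then 1 else 0) h)) =
    real N powr (1 / p) / real N"
proof -
  define S where "S = (\<lambda>k. z k \<otimes> x) ` {..<N}"
  have zG: "z k \<in> carrier G" for k using z(2) by auto
  have inj: "inj_on (\<lambda>k. z k \<otimes> x) {..<N}"
    using z(1) zG x by (auto intro!: inj_onI dest: injD)
  have S: "finite S" "S \<subseteq> carrier G" "card S = N"
    using zG x card_image[OF inj] by (auto simp: S_def)
  have eq: "inv g \<otimes> h = x \<longleftrightarrow> h = g \<otimes> x" if "g \<in> carrier G" "h \<in> carrier G" for g h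
    using that x by (auto simp flip: m_assoc)
  have "(\<Sum>k<N. translate (z k) (\<lambda>y. if y = x then 1 else 0) h) = of_bool (h \<in> S)" for h
  proof (cases "h \<in> carrier G")
    case True
    have "(\<Sum>k<N. translate (z k) (\<lambda>y. if y = x then 1 else 0) h) = (\<Sum>k<N. of_bool (h = z k \<otimes> x) :: complex)"
      using True zG by (intro sum.cong) (auto simp: translate_def eq)
    also have "\<dots> = (\<Sum>y\<in>S. of_bool (h = y))"
      unfolding S_def by (simp add: sum.reindex[OF inj] o_def)
    also have "\<dots> = of_bool (h \<in> S)"
      using S(1) by (simp add: of_bool_def if_distrib)
    finally show ?thesis .
  next
    case False
    with S(2) show ?thesis by (auto simp: translate_def)
  qed
  then have "lp_norm p G (\<lambda>h. (1 / of_nat N) * (\<Sum>k<N. translate (z k) (\<lambda>y. if y = x then 1 else 0) h)) =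
      1 / real N * lp_norm p G (\<lambda>h. of_bool (h \<in> S))"
    by (simp only: lp_norm_cmult norm_divide norm_one norm_of_nat)
  also have "lp_norm p G (\<lambda>h. of_bool (h \<in> S)) = real N powr (1 / p)"
    by (subst lp_finite_support(2)[OF S(1,2)]) (use S(3) in auto)
  finally show ?thesis by simp
qed

text \<open>
  The \<open>N\<close> translates have disjoint supports, so the average has norm \<open>N\<^sup>1\<^sup>/\<^sup>p\<^sup>-\<^sup>1\<close>.
  This is where \<open>p > 1\<close> is needed.
\<close>

lemma average_delta_tendsto:
  assumes z: "inj z" "range z \<subseteq> carrier G" and x: "x \<in> carrier G"
  shows "(\<lambda>N. lp_norm p G (\<lambda>h. (1 / of_nat N) * (\<Sum>k<N. translate (z k) (\<lambda>y. if y = x then 1 else 0) h)))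
    \<longlonglongrightarrow> 0"
proof -
  have "1 / p - 1 < 0" using p by simp
  then have "(\<lambda>N. real N powr (1 / p - 1)) \<longlonglongrightarrow> 0"
    by (intro tendsto_neg_powr filterlim_real_sequentially) 
  then show ?thesis
    unfolding average_delta[OF assms] by (simp add: powr_diff cong: if_cong)
qed

lemma average_finite_support_tendsto:
  assumes z: "inj z" "range z \<subseteq> carrier G"
    and S: "finite S" "S \<subseteq> carrier G" "\<And>x. x \<notin> S \<Longrightarrow> f x = 0"
  shows "(\<lambda>N. lp_norm p G (\<lambda>h. (1 / of_nat N) * (\<Sum>k<N. translate (z k) f h))) \<longlonglongrightarrow> 0"
proof -
  define D where "D = (\<lambda>x N h. (1 / of_nat N) * (\<Sum>k<N. translate (z k) (\<lambda>y. if y = x then 1 else 0) h))"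
  have zG: "z k \<in> carrier G" for k using z(2) by auto
  have f: "f = (\<lambda>h. \<Sum>x\<in>S. f x * (if h = x then 1 else 0))"
    using S by (auto simp: fun_eq_iff if_distrib cong: if_cong)
  have tr: "translate (z k) f h = (\<Sum>x\<in>S. f x * translate (z k) (\<lambda>y. if y = x then 1 else 0) h)" for k h
    by (subst f) (simp add: translate_def)
  have eq: "(\<lambda>h. (1 / of_nat N) * (\<Sum>k<N. translate (z k) f h)) = (\<lambda>h. \<Sum>x\<in>S. f x * D x N h)" for N
    unfolding tr D_def by (subst sum.swap) (simp add: sum_distrib_left mult_ac)
  have DL: "D x N \<in> carrier L" if "x \<in> S" for x N
  proof -
    have "(\<lambda>y. if y = x then 1 else 0) \<in> carrier L"
      by (rule lp_finite_support(1)[of "{x}"]) (use S(2) that in auto)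
    then show ?thesis
      unfolding D_def by (intro lp_cmult lp_sum translate_lp zG)
  qed
  have le: "lp_norm p G (\<lambda>h. (1 / of_nat N) * (\<Sum>k<N. translate (z k) f h)) \<le>
      (\<Sum>x\<in>S. cmod (f x) * lp_norm p G (D x N))" for N
    unfolding eq using lp_norm_sum[of S "\<lambda>x h. f x * D x N h"] DL by (auto simp: lp_norm_cmult)
  have "(\<lambda>N. \<Sum>x\<in>S. cmod (f x) * lp_norm p G (D x N)) \<longlonglongrightarrow> (\<Sum>x\<in>S. cmod (f x) * 0)"
    unfolding D_def using S(2) by (intro tendsto_sum tendsto_mult_left average_delta_tendsto z) auto
  then have "(\<lambda>N. \<Sum>x\<in>S. cmod (f x) * lp_norm p G (D x N)) \<longlonglongrightarrow> 0"
    by simp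
  then show ?thesis
    by (rule Lim_null_comparison[rotated]) (use le in simp)
qed


lemma lp_norm_average_le:
  assumes "range z \<subseteq> carrier G" "f \<in> carrier L"
  shows "lp_norm p G (\<lambda>h. (1 / of_nat N) * (\<Sum>k<N. translate (z k) f h)) \<le> lp_norm p G f"
proof -
  have "lp_norm p G (\<lambda>h. \<Sum>k<N. translate (z k) f h) \<le> (\<Sum>k<N. lp_norm p G (translate (z k) f))"
    using assms by (intro lp_norm_sum) auto
  also have "\<dots> = real N * lp_norm p G f"
  proof -
    have "lp_norm p G (translate (z k) f) = lp_norm p G f" for k
      using assms by (intro lp_norm_translate) auto
    then show ?thesis by simp
  qed
  \<comment> \<open>At \<open>N = 0\<close> the factor \<open>1 / of_nat N\<close> is zero, so the
    average is the zero function and the bound still holds.\<close>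
  finally show ?thesis
    unfolding lp_norm_cmult by (cases "N = 0") (auto simp: norm_divide field_simps)
qed

lemma average_tendsto_0:
  assumes z: "inj z" "range z \<subseteq> carrier G" and f: "f \<in> carrier L"
  shows "(\<lambda>N. lp_norm p G (\<lambda>h. (1 / of_nat N) * (\<Sum>k<N. translate (z k) f h))) \<longlonglongrightarrow> 0"
proof (rule LIMSEQ_I)
  fix e :: real assume e: "0 < e"
  have sf: "(\<lambda>g. cmod (f g) powr p) summable_on carrier G"
    using f by (simp add: lp_carrier)
  \<comment> \<open>The set \<open>S\<close> misses at most \<open>(e / 2) powr p\<close> of the
    total mass of p-th powers, so the tail \<open>v\<close> has norm at most \<open>e / 2\<close>;
    the averages never enlarge it.\<close>
  obtain S where S: "finite S" "S \<subseteq> carrier G"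
    "dist (\<Sum>g\<in>S. cmod (f g) powr p) (\<Sum>\<^sub>\<infinity>g\<in>carrier G. cmod (f g) powr p) \<le> (e / 2) powr p"
    using infsum_finite_approximation[OF sf, of "(e / 2) powr p"] e by auto
  define u where "u = (\<lambda>h. if h \<in> S then f h else 0)"
  define v where "v = (\<lambda>h. if h \<in> S then 0 else f h)"
  have uL: "u \<in> carrier L"
    by (rule lp_finite_support(1)[OF S(1,2)]) (simp add: u_def)
  have "v = (\<lambda>h. f h - u h)"
    by (auto simp: u_def v_def)
  with f uL have vL: "v \<in> carrier L" by auto
  have "(\<Sum>\<^sub>\<infinity>g\<in>carrier G. cmod (v g) powr p) = (\<Sum>\<^sub>\<infinity>g\<in>carrier G - S. cmod (f g) powr p)"
    by (intro infsum_cong_neutral) (use p in \<open>auto simp: v_def\<close>)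
  also have "\<dots> = (\<Sum>\<^sub>\<infinity>g\<in>carrier G. cmod (f g) powr p) - (\<Sum>g\<in>S. cmod (f g) powr p)"
    using S by (subst infsum_Diff) (auto intro: sf)
  also have "\<dots> \<le> (e / 2) powr p"
    using S(3) by (simp add: dist_real_def)
  finally have "lp_norm p G v \<le> ((e / 2) powr p) powr (1 / p)"
    unfolding lp_norm_def using p by (intro powr_mono2) (auto intro: infsum_nonneg)
  then have v: "lp_norm p G v \<le> e / 2"
    using p e by (simp add: powr_powr)
  have "(\<lambda>N. lp_norm p G (\<lambda>h. (1 / of_nat N) * (\<Sum>k<N. translate (z k) u h))) \<longlonglongrightarrow> 0"
    by (rule average_finite_support_tendsto[OF z S(1,2)]) (simp add: u_def)
  from LIMSEQ_D[OF this, of "e / 2"] e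
  obtain n where n: "lp_norm p G (\<lambda>h. (1 / of_nat N) * (\<Sum>k<N. translate (z k) u h)) < e / 2" if "N \<ge> n" for N
    by auto
  have "norm (lp_norm p G (\<lambda>h. (1 / of_nat N) * (\<Sum>k<N. translate (z k) f h)) - 0) < e" if "N \<ge> n" for N
  proof -
    have avg: "(\<lambda>h. (1 / of_nat N) * (\<Sum>k<N. translate (z k) w h)) \<in> carrier L" if "w \<in> carrier L" for w
      using that z(2) by (intro lp_cmult lp_sum) auto
    have "(\<lambda>h. (1 / of_nat N) * (\<Sum>k<N. translate (z k) f h)) =
        (\<lambda>h. (1 / of_nat N) * (\<Sum>k<N. translate (z k) u h) + (1 / of_nat N) * (\<Sum>k<N. translate (z k) v h))"
    proof
      fix h
      have "(\<Sum>k<N. translate (z k) f h) = (\<Sum>k<N. translate (z k) u h + translate (z k) v h)"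
        by (intro sum.cong) (auto simp: translate_def u_def v_def)
      then show "(1 / of_nat N) * (\<Sum>k<N. translate (z k) f h) =
          (1 / of_nat N) * (\<Sum>k<N. translate (z k) u h) + (1 / of_nat N) * (\<Sum>k<N. translate (z k) v h)"
        by (simp only: sum.distrib distrib_left)
    qed
    then have "lp_norm p G (\<lambda>h. (1 / of_nat N) * (\<Sum>k<N. translate (z k) f h)) \<le>
        lp_norm p G (\<lambda>h. (1 / of_nat N) * (\<Sum>k<N. translate (z k) u h)) +
        lp_norm p G (\<lambda>h. (1 / of_nat N) * (\<Sum>k<N. translate (z k) v h))"
      using lp_norm_add[OF avg[OF uL] avg[OF vL]] by simp
    also have "\<dots> < e"
      using n[OF that] lp_norm_average_le[OF z(2) vL, of N] v by linarith
    finally show ?thesis by simp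
  qed
  then show "\<exists>n. \<forall>N\<ge>n. norm (lp_norm p G (\<lambda>h. (1 / of_nat N) * (\<Sum>k<N. translate (z k) f h)) - 0) < e"
    by blast
qed

end

section \<open>The group ring and its action on \<open>l\<^sup>p(G)\<close>\<close>

context group
begin

abbreviation "\<R> \<equiv> group_ring G"

lemma group_ring_carrier: "r \<in> carrier \<R> \<longleftrightarrow> Poly_Mapping.keys r \<subseteq> carrier G"
  by (simp add: group_ring_def)

lemma group_ring_simps [simp]: "\<zero>\<^bsub>\<R>\<^esub> = 0" "r \<oplus>\<^bsub>\<R>\<^esub> s = r + s" "\<one>\<^bsub>\<R>\<^esub> = frag_of \<one>"
  by (simp_all add: group_ring_def)

lemma group_ring_of [simp, intro]: "g \<in> carrier G \<Longrightarrow> frag_of g \<in> carrier \<R>"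
  by (simp add: group_ring_carrier)

lemma group_ring_add [simp, intro]: "r \<in> carrier \<R> \<Longrightarrow> s \<in> carrier \<R> \<Longrightarrow> r + s \<in> carrier \<R>"
  using keys_add[of r s] by (auto simp: group_ring_carrier)

lemma group_ring_diff [simp, intro]: "r \<in> carrier \<R> \<Longrightarrow> s \<in> carrier \<R> \<Longrightarrow> r - s \<in> carrier \<R>"
  using keys_diff[of r s] by (auto simp: group_ring_carrier)

text \<open>Reduces additive statements about the group ring to single group elements; closure under
  subtraction reaches all integer coefficients, negative ones included.\<close>

lemma group_ring_induct [consumes 1, case_names zero of diff]:
  assumes "r \<in> carrier \<R>"
    and "P 0" "\<And>g. g \<in> carrier G \<Longrightarrow> P (frag_of g)"
    and "\<And>r s. r \<in> carrier \<R> \<Longrightarrow> s \<in> carrier \<R> \<Longrightarrow> P r \<Longrightarrow> P s \<Longrightarrow> P (r - s)"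
  shows "P r"
  using assms(1) unfolding group_ring_carrier
  by (rule free_Abelian_group_induct) (use assms(2-4) in \<open>auto simp: group_ring_carrier\<close>)

lemma group_ring_mult_of: "frag_of g \<otimes>\<^bsub>\<R>\<^esub> frag_of h = frag_of (g \<otimes> h)"
  by (simp add: group_ring_def)

lemma group_ring_mult_diff:
  "(r - r') \<otimes>\<^bsub>\<R>\<^esub> s = r \<otimes>\<^bsub>\<R>\<^esub> s - r' \<otimes>\<^bsub>\<R>\<^esub> s"
  "r \<otimes>\<^bsub>\<R>\<^esub> (s - s') = r \<otimes>\<^bsub>\<R>\<^esub> s - r \<otimes>\<^bsub>\<R>\<^esub> s'"
proof -
  show "(r - r') \<otimes>\<^bsub>\<R>\<^esub> s = r \<otimes>\<^bsub>\<R>\<^esub> s - r' \<otimes>\<^bsub>\<R>\<^esub> s" for r r' s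
    by (simp add: group_ring_def frag_extend_diff)
  \<comment> \<open>The product extends linearly in its left factor by construction; linearity in
    the right factor needs induction on \<open>r\<close>. Allowing any support keeps the identity
    free of carrier assumptions.\<close>
  have "Poly_Mapping.keys r \<subseteq> UNIV" by simp
  then show "r \<otimes>\<^bsub>\<R>\<^esub> (s - s') = r \<otimes>\<^bsub>\<R>\<^esub> s - r \<otimes>\<^bsub>\<R>\<^esub> s'"
    by (induction r rule: frag_induction) (simp_all add: group_ring_def frag_extend_diff)
qed

lemma group_ring_mult_zero: "0 \<otimes>\<^bsub>\<R>\<^esub> s = 0" "r \<otimes>\<^bsub>\<R>\<^esub> 0 = 0"
  using group_ring_mult_diff(1)[of 0 0 s] group_ring_mult_diff(2)[of r 0 0] by simp_all

lemma group_ring_mult [simp, intro]: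
  assumes "r \<in> carrier \<R>" "s \<in> carrier \<R>"
  shows "r \<otimes>\<^bsub>\<R>\<^esub> s \<in> carrier \<R>"
  using assms(1)
proof (induction r rule: group_ring_induct)
  case (of g)
  from assms(2) show ?case
    by (induction s rule: group_ring_induct)
      (use of in \<open>auto simp: group_ring_mult_of group_ring_mult_diff group_ring_mult_zero group_ring_carrier[of 0]\<close>)
qed (auto simp: group_ring_mult_diff group_ring_mult_zero group_ring_carrier[of 0])

lemma group_ring_assoc:
  assumes "r \<in> carrier \<R>" "s \<in> carrier \<R>" "t \<in> carrier \<R>"
  shows "(r \<otimes>\<^bsub>\<R>\<^esub> s) \<otimes>\<^bsub>\<R>\<^esub> t = r \<otimes>\<^bsub>\<R>\<^esub> (s \<otimes>\<^bsub>\<R>\<^esub> t)"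
  using assms(1)
proof (induction r rule: group_ring_induct)
  case (of g)
  note g = of
  from assms(2) show ?case
  proof (induction s rule: group_ring_induct)
    case (of h)
    from assms(3) show ?case
      by (induction t rule: group_ring_induct)
        (use of g in \<open>auto simp: group_ring_mult_of group_ring_mult_diff group_ring_mult_zero m_assoc\<close>)
  qed (auto simp: group_ring_mult_diff group_ring_mult_zero)
qed (auto simp: group_ring_mult_diff group_ring_mult_zero)

lemma ring_group_ring: "ring \<R>"
proof (rule ringI)
  show "abelian_group \<R>"
  proof (rule abelian_groupI)
    show "\<exists>s\<in>carrier \<R>. s \<oplus>\<^bsub>\<R>\<^esub> r = \<zero>\<^bsub>\<R>\<^esub>" if "r \<in> carrier \<R>" for r
      using that by (intro bexI[of _ "-r"]) (auto simp: group_ring_carrier)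
  qed (auto simp: group_ring_carrier[of 0] add_ac)
  \<comment> \<open>Bilinearity has been established for differences, so sums are rewritten as
    differences.\<close>
  have add: "r + s = r - (0 - s)" for r s :: "'a \<Rightarrow>\<^sub>0 int" by simp
  show "(r \<oplus>\<^bsub>\<R>\<^esub> s) \<otimes>\<^bsub>\<R>\<^esub> t = r \<otimes>\<^bsub>\<R>\<^esub> t \<oplus>\<^bsub>\<R>\<^esub> s \<otimes>\<^bsub>\<R>\<^esub> t"
    "t \<otimes>\<^bsub>\<R>\<^esub> (r \<oplus>\<^bsub>\<R>\<^esub> s) = t \<otimes>\<^bsub>\<R>\<^esub> r \<oplus>\<^bsub>\<R>\<^esub> t \<otimes>\<^bsub>\<R>\<^esub> s" for r s t
    unfolding group_ring_simps by (simp_all only: add group_ring_mult_diff group_ring_mult_zero)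
  show "monoid \<R>"
  proof (rule monoidI)
    show "\<one>\<^bsub>\<R>\<^esub> \<otimes>\<^bsub>\<R>\<^esub> r = r" if "r \<in> carrier \<R>" for r
      using that by (induction r rule: group_ring_induct)
        (auto simp: group_ring_mult_of group_ring_mult_diff group_ring_mult_zero)
    show "r \<otimes>\<^bsub>\<R>\<^esub> \<one>\<^bsub>\<R>\<^esub> = r" if "r \<in> carrier \<R>" for r
      using that by (induction r rule: group_ring_induct)
        (auto simp: group_ring_mult_of group_ring_mult_diff group_ring_mult_zero)
  qed (auto simp: group_ring_assoc)
qed

text \<open>The standard anti-involution of the group ring, which \<open>right_of_left\<close>
  inserts into the action.\<close>

definition bar :: "('a \<Rightarrow>\<^sub>0 int) \<Rightarrow> ('a \<Rightarrow>\<^sub>0 int)"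
  where "bar = frag_extend (\<lambda>g. frag_of (inv g))"

lemma bar_simps [simp]: "bar 0 = 0" "bar (frag_of g) = frag_of (inv g)" "bar (r - s) = bar r - bar s"
  "bar (r + s) = bar r + bar s"
  by (simp_all add: bar_def frag_extend_diff frag_extend_add)

lemma bar_carrier [simp, intro]: "r \<in> carrier \<R> \<Longrightarrow> bar r \<in> carrier \<R>"
  by (induction r rule: group_ring_induct) (auto simp: group_ring_carrier[of 0])

lemma bar_bar [simp]: "r \<in> carrier \<R> \<Longrightarrow> bar (bar r) = r"
  by (induction r rule: group_ring_induct) auto

lemma bar_mult:
  assumes "r \<in> carrier \<R>" "s \<in> carrier \<R>"
  shows "bar (r \<otimes>\<^bsub>\<R>\<^esub> s) = bar s \<otimes>\<^bsub>\<R>\<^esub> bar r"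
  using assms(1)
proof (induction r rule: group_ring_induct)
  case (of g)
  from assms(2) show ?case
    by (induction s rule: group_ring_induct)
      (use of in \<open>auto simp: group_ring_mult_of group_ring_mult_diff group_ring_mult_zero inv_mult_group\<close>)
qed (auto simp: group_ring_mult_diff group_ring_mult_zero)

end

section \<open>The action of the group ring on l^p(G)\<close>

context lp_group
begin

lemma lp_smult: "(r \<odot>\<^bsub>L\<^esub> f) h = (if h \<in> carrier G
    then \<Sum>g\<in>Poly_Mapping.keys r. of_int (Poly_Mapping.lookup r g) * f (inv g \<otimes> h) else 0)"
  by (simp add: lp_module_def)

lemma lp_smult_of [simp]: "frag_of g \<odot>\<^bsub>L\<^esub> f = translate g f"
  by (auto simp: fun_eq_iff lp_smult translate_def)

lemma lp_smult_add: "((r + s) \<odot>\<^bsub>L\<^esub> f) h = (r \<odot>\<^bsub>L\<^esub> f) h + (s \<odot>\<^bsub>L\<^esub> f) h"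
proof -
  \<comment> \<open>Coefficients may cancel in \<open>r + s\<close>, so all three sums are extended
    to one common finite index set.\<close>
  define K where "K = Poly_Mapping.keys r \<union> Poly_Mapping.keys s"
  have "(t \<odot>\<^bsub>L\<^esub> f) h = (if h \<in> carrier G
      then \<Sum>g\<in>K. of_int (Poly_Mapping.lookup t g) * f (inv g \<otimes> h) else 0)"
    if "Poly_Mapping.keys t \<subseteq> K" for t
    unfolding lp_smult using that
    by (auto simp: K_def in_keys_iff intro!: sum.mono_neutral_left)
  from this[of r] this[of s] this[of "r + s"] show ?thesis
    using keys_add[of r s]
    by (simp add: K_def lookup_add distrib_right sum.distrib)
qed

lemma lp_smult_diff: "(r - s) \<odot>\<^bsub>L\<^esub> f = (\<lambda>h. (r \<odot>\<^bsub>L\<^esub> f) h - (s \<odot>\<^bsub>L\<^esub> f) h)"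
  using lp_smult_add[of "r - s" s f] by auto

lemma lp_smult_zero [simp]: "0 \<odot>\<^bsub>L\<^esub> f = (\<lambda>_. 0)"
  by (simp add: fun_eq_iff lp_smult)

lemma lp_smult_sum: "(\<Sum>i\<in>I. r i) \<odot>\<^bsub>L\<^esub> f = (\<lambda>h. \<Sum>i\<in>I. (r i \<odot>\<^bsub>L\<^esub> f) h)"
  by (induction I rule: infinite_finite_induct) (auto simp: lp_smult_add)

lemma lp_smult_closed [simp, intro]: "r \<in> carrier \<R> \<Longrightarrow> f \<in> carrier L \<Longrightarrow> r \<odot>\<^bsub>L\<^esub> f \<in> carrier L"
  by (induction r rule: group_ring_induct) (auto simp: lp_smult_diff)

lemma lp_smult_right:
  "r \<odot>\<^bsub>L\<^esub> (\<lambda>h. f h + f' h) = (\<lambda>h. (r \<odot>\<^bsub>L\<^esub> f) h + (r \<odot>\<^bsub>L\<^esub> f') h)"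
  "r \<odot>\<^bsub>L\<^esub> (\<lambda>h. c * f h) = (\<lambda>h. c * (r \<odot>\<^bsub>L\<^esub> f) h)"
  by (auto simp: fun_eq_iff lp_smult distrib_left sum.distrib sum_distrib_left mult_ac)

lemma translate_diff: "translate g (\<lambda>h. f h - f' h) = (\<lambda>h. translate g f h - translate g f' h)"
  by (auto simp: translate_def)

lemma translate_translate:
  "g \<in> carrier G \<Longrightarrow> g' \<in> carrier G \<Longrightarrow> translate g (translate g' f) = translate (g \<otimes> g') f"
  by (auto simp: translate_def inv_mult_group m_assoc)

lemma lp_smult_assoc:
  assumes "r \<in> carrier \<R>" "s \<in> carrier \<R>"
  shows "(r \<otimes>\<^bsub>\<R>\<^esub> s) \<odot>\<^bsub>L\<^esub> f = r \<odot>\<^bsub>L\<^esub> (s \<odot>\<^bsub>L\<^esub> f)"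
  using assms(1)
proof (induction r rule: group_ring_induct)
  case (of g)
  from assms(2) show ?case
    by (induction s rule: group_ring_induct)
      (use of in \<open>auto simp: group_ring_mult_of group_ring_mult_diff group_ring_mult_zero lp_smult_diff
         translate_translate translate_diff translate_def[of _ "\<lambda>_. 0"]\<close>)
qed (auto simp: group_ring_mult_diff group_ring_mult_zero lp_smult_diff)

lemma abelian_group_lp: "abelian_group L"
proof (rule abelian_groupI)
  show "\<exists>f'\<in>carrier L. f' \<oplus>\<^bsub>L\<^esub> f = \<zero>\<^bsub>L\<^esub>" if "f \<in> carrier L" for f
    using that by (intro bexI[of _ "\<lambda>h. - f h"]) auto
qed (auto simp: add_ac)

end

section \<open>Multiplication by central elements on a resolution\<close>

context left_module
begin

lemma smult_r_null: "r \<in> carrier R \<Longrightarrow> r \<odot>\<^bsub>M\<^esub> \<zero>\<^bsub>M\<^esub> = \<zero>\<^bsub>M\<^esub>"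
  using smult_r_distr[of r "\<zero>\<^bsub>M\<^esub>" "\<zero>\<^bsub>M\<^esub>"] M.add.l_cancel_one'[of "r \<odot>\<^bsub>M\<^esub> \<zero>\<^bsub>M\<^esub>" "r \<odot>\<^bsub>M\<^esub> \<zero>\<^bsub>M\<^esub>"] by simp

lemma smult_r_minus: "r \<in> carrier R \<Longrightarrow> x \<in> carrier M \<Longrightarrow> r \<odot>\<^bsub>M\<^esub> (\<ominus>\<^bsub>M\<^esub> x) = \<ominus>\<^bsub>M\<^esub> (r \<odot>\<^bsub>M\<^esub> x)"
  using smult_r_distr[of r "\<ominus>\<^bsub>M\<^esub> x" x]
  by (intro M.minus_equality[symmetric]) (simp_all add: M.l_neg smult_r_null)

lemma smult_finsum:
  "finite S \<Longrightarrow> v \<in> S \<rightarrow> carrier M \<Longrightarrow> r \<in> carrier R \<Longrightarrow>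
    r \<odot>\<^bsub>M\<^esub> (\<Oplus>\<^bsub>M\<^esub>x\<in>S. v x) = (\<Oplus>\<^bsub>M\<^esub>x\<in>S. r \<odot>\<^bsub>M\<^esub> v x)"
proof (induction S rule: finite_induct)
  case (insert y S)
  then show ?case
    by (subst (1 2) M.finsum_insert) (auto simp: Pi_iff smult_r_distr M.finsum_closed)
qed (simp add: smult_r_null)

text \<open>Moving \<open>r\<close> past a scalar is what linearity over a noncommutative ring
  demands; this is the point at which central elements are required.\<close>

lemma smult_hom:
  assumes "r \<in> carrier R" "\<And>a. a \<in> carrier R \<Longrightarrow> r \<otimes> a = a \<otimes> r"
  shows "(\<lambda>x. r \<odot>\<^bsub>M\<^esub> x) \<in> mod_hom R M M"
  using assms by (auto simp: mod_hom_def smult_r_distr simp flip: smult_assoc1)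

end

lemma mod_homD:
  assumes "f \<in> mod_hom R M N"
  shows "x \<in> carrier M \<Longrightarrow> f x \<in> carrier N"
    and "x \<in> carrier M \<Longrightarrow> y \<in> carrier M \<Longrightarrow> f (x \<oplus>\<^bsub>M\<^esub> y) = f x \<oplus>\<^bsub>N\<^esub> f y"
    and "r \<in> carrier R \<Longrightarrow> x \<in> carrier M \<Longrightarrow> f (r \<odot>\<^bsub>M\<^esub> x) = r \<odot>\<^bsub>N\<^esub> f x"
  using assms by (auto simp: mod_hom_def)

lemma mod_hom_zero:
  assumes "abelian_group M" "abelian_group N" "f \<in> mod_hom R M N"
  shows "f \<zero>\<^bsub>M\<^esub> = \<zero>\<^bsub>N\<^esub>"
proof -
  interpret M: abelian_group M by fact
  interpret N: abelian_group N by fact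
  show ?thesis
    using mod_homD(1)[OF assms(3), of "\<zero>\<^bsub>M\<^esub>"] mod_homD(2)[OF assms(3), of "\<zero>\<^bsub>M\<^esub>" "\<zero>\<^bsub>M\<^esub>"]
    by (simp add: N.add.l_cancel_one')
qed

lemma mod_hom_minus:
  assumes "abelian_group M" "abelian_group N" "f \<in> mod_hom R M N" "x \<in> carrier M"
  shows "f (\<ominus>\<^bsub>M\<^esub> x) = \<ominus>\<^bsub>N\<^esub> f x"
proof -
  interpret M: abelian_group M by fact
  interpret N: abelian_group N by fact
  show ?thesis
    using mod_homD(1)[OF assms(3), of x] mod_homD(1)[OF assms(3), of "\<ominus>\<^bsub>M\<^esub> x"] assms(4)
      mod_homD(2)[OF assms(3), of "\<ominus>\<^bsub>M\<^esub> x" x] mod_hom_zero[OF assms(1-3)]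
    by (intro N.minus_equality[symmetric]) (simp_all add: M.l_neg)
qed

lemma mod_hom_comp:
  "f \<in> mod_hom R M N \<Longrightarrow> g \<in> mod_hom R N P \<Longrightarrow> (\<lambda>x. g (f x)) \<in> mod_hom R M P"
  by (auto simp: mod_hom_def Pi_iff)

lemma mod_hom_diff:
  assumes "left_module R N" "f \<in> mod_hom R M N" "g \<in> mod_hom R M N"
  shows "(\<lambda>x. f x \<ominus>\<^bsub>N\<^esub> g x) \<in> mod_hom R M N"
proof -
  interpret N: left_module R N by fact
  note f = mod_homD[OF assms(2)] and g = mod_homD[OF assms(3)]
  show ?thesis
    by (auto simp: mod_hom_def f g N.M.minus_eq N.M.minus_add N.M.a_ac N.smult_r_distr N.smult_r_minus)
qed

lemma projective_lift_image:
  assumes P: "projective R P" and M: "left_module R M" and N: "left_module R N"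
    and f: "f \<in> mod_hom R P N" and g: "g \<in> mod_hom R M N"
    and sub: "f ` carrier P \<subseteq> g ` carrier M"
  obtains h where "h \<in> mod_hom R P M" "\<And>x. x \<in> carrier P \<Longrightarrow> g (h x) = f x"
proof -
  interpret M: left_module R M by fact
  interpret N: left_module R N by fact
  note g' = mod_homD[OF g]
  define I where "I = N\<lparr>carrier := g ` carrier M\<rparr>"
  have I: "carrier I = g ` carrier M" "\<zero>\<^bsub>I\<^esub> = \<zero>\<^bsub>N\<^esub>" "x \<oplus>\<^bsub>I\<^esub> y = x \<oplus>\<^bsub>N\<^esub> y" "a \<odot>\<^bsub>I\<^esub> x = a \<odot>\<^bsub>N\<^esub> x" for x y a
    by (simp_all add: I_def)
  have z: "\<zero>\<^bsub>N\<^esub> \<in> g ` carrier M"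
    using mod_hom_zero[OF M.M.abelian_group_axioms N.M.abelian_group_axioms g] M.M.zero_closed by (metis imageI)
  have cl: "x \<oplus>\<^bsub>N\<^esub> y \<in> g ` carrier M" "x \<in> carrier N" if "x \<in> g ` carrier M" "y \<in> g ` carrier M" for x y
    using that g' by (auto simp flip: g'(2))
  have "abelian_group I"
  proof (rule abelian_groupI)
    show "\<exists>y\<in>carrier I. y \<oplus>\<^bsub>I\<^esub> x = \<zero>\<^bsub>I\<^esub>" if "x \<in> carrier I" for x
    proof -
      from that obtain m where m: "m \<in> carrier M" "x = g m" by (auto simp: I)
      then have "g (\<ominus>\<^bsub>M\<^esub> m) \<oplus>\<^bsub>N\<^esub> g m = \<zero>\<^bsub>N\<^esub>"
        by (simp add: mod_hom_minus[OF M.M.abelian_group_axioms N.M.abelian_group_axioms g] g' N.M.l_neg)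
      with m show ?thesis by (auto simp: I)
    qed
  qed (simp_all add: I z cl N.M.a_ac)
  then have "left_module R I"
  proof (intro left_module.intro left_module_axioms.intro M.R.ring_axioms)
    show "a \<odot>\<^bsub>I\<^esub> x \<in> carrier I" if "a \<in> carrier R" "x \<in> carrier I" for a x
      using that by (auto simp: I simp flip: g'(3))
  qed (simp_all add: I cl N.smult_l_distr N.smult_r_distr N.smult_assoc1)
  moreover have "f \<in> mod_hom R P I"
    using f sub by (auto simp: mod_hom_def I)
  moreover have "g \<in> mod_hom R M I"
    using g by (auto simp: mod_hom_def I)
  ultimately show ?thesis
    using projective_lift[OF P M, of I f g] that by (auto simp: I)
qed


section \<open>Averaging elements of the group ring\<close>

context group
begin

text \<open>\<open>1/N\<close> times this element is \<open>1\<close> minus the average of \<open>z\<^sub>0, \<dots>, z\<^sub>N\<^sub>-\<^sub>1\<close>.\<close>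

definition averaging_element :: "(nat \<Rightarrow> 'a) \<Rightarrow> nat \<Rightarrow> ('a \<Rightarrow>\<^sub>0 int)"
  where "averaging_element z N = (\<Sum>k<N. frag_of \<one> - frag_of (z k))"

lemma averaging_element_carrier [simp, intro]:
  "range z \<subseteq> carrier G \<Longrightarrow> averaging_element z N \<in> carrier \<R>"
  by (induction N) (auto simp: averaging_element_def group_ring_carrier[of 0] intro!: group_ring_add group_ring_diff)

lemma bar_averaging_element:
  "bar (averaging_element z N) = averaging_element (\<lambda>k. inv (z k)) N"
  by (induction N) (auto simp: averaging_element_def)

lemma group_ring_central_of:
  assumes "z \<in> center G" "r \<in> carrier \<R>"
  shows "frag_of z \<otimes>\<^bsub>\<R>\<^esub> r = r \<otimes>\<^bsub>\<R>\<^esub> frag_of z"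
  using assms(2) by (induction r rule: group_ring_induct)
    (use assms(1) in \<open>auto simp: group_ring_mult_of group_ring_mult_diff group_ring_mult_zero center_def\<close>)

lemma averaging_element_central:
  assumes "range z \<subseteq> center G" "r \<in> carrier \<R>"
  shows "averaging_element z N \<otimes>\<^bsub>\<R>\<^esub> r = r \<otimes>\<^bsub>\<R>\<^esub> averaging_element z N"
proof -
  interpret ring \<R> by (rule ring_group_ring)
  have 1: "\<one> \<in> center G" by (simp add: center_def)
  have zc: "z k \<in> center G" "z k \<in> carrier G" for k
    using assms(1) by (auto simp: center_def)
  \<comment> \<open>Membership is carried through the induction together with commutation, because
    the distributive laws of the ring demand it.\<close>
  then have "averaging_element z N \<in> carrier \<R> \<and>
    averaging_element z N \<otimes>\<^bsub>\<R>\<^esub> r = r \<otimes>\<^bsub>\<R>\<^esub> averaging_element z N"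
  proof (induction N)
    case (Suc N)
    then show ?case
      using l_distr[of "averaging_element z N" "frag_of \<one> - frag_of (z N)" r]
        r_distr[of "averaging_element z N" "frag_of \<one> - frag_of (z N)" r] assms(2)
      by (auto simp: averaging_element_def group_ring_mult_diff
          group_ring_central_of[OF 1 assms(2)] group_ring_central_of[OF zc(1) assms(2)])
  qed (simp_all add: averaging_element_def group_ring_mult_zero group_ring_carrier)
  then show ?thesis ..
qed

lemma trivial_module_smult_add:
  "(r + s) \<odot>\<^bsub>trivial_module\<^esub> k = r \<odot>\<^bsub>trivial_module\<^esub> k + s \<odot>\<^bsub>trivial_module\<^esub> k"
proof -
  define K where "K = Poly_Mapping.keys r \<union> Poly_Mapping.keys s"
  have "t \<odot>\<^bsub>trivial_module\<^esub> k = (\<Sum>g\<in>K. Poly_Mapping.lookup t g) * k" if "Poly_Mapping.keys t \<subseteq> K" for t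
    unfolding trivial_module_def using that
    by (auto simp: K_def in_keys_iff intro!: sum.mono_neutral_left)
  from this[of r] this[of s] this[of "r + s"] show ?thesis
    using keys_add[of r s]
    by (simp add: K_def lookup_add distrib_right sum.distrib)
qed

lemma averaging_element_trivial: "averaging_element z N \<odot>\<^bsub>trivial_module\<^esub> k = 0"
proof (induction N)
  case (Suc N)
  \<comment> \<open>Group elements have augmentation one; additivity applied to
    \<open>(1 - z) + z = 1\<close> leaves zero for the difference.\<close>
  have "(frag_of \<one> - frag_of (z N)) \<odot>\<^bsub>trivial_module\<^esub> k = 0"
    using trivial_module_smult_add[of "frag_of \<one> - frag_of (z N)" "frag_of (z N)" k]
    by (simp add: trivial_module_def)
  with Suc show ?case
    by (simp add: averaging_element_def trivial_module_smult_add)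
qed (simp add: averaging_element_def trivial_module_def)

end

section \<open>Projective resolutions and null-homotopies\<close>

locale resolution = group G for G :: "('g, 'b) monoid_scheme" (structure) +
  fixes F :: "nat \<Rightarrow> ('g \<Rightarrow>\<^sub>0 int, 'm) module" and d :: "nat \<Rightarrow> 'm \<Rightarrow> 'm" and \<epsilon> :: "'m \<Rightarrow> int"
  assumes resolution: "projective_resolution G F d \<epsilon>"
begin

lemma projective_F: "projective \<R> (F i)"
  and d_hom: "d (Suc i) \<in> mod_hom \<R> (F (Suc i)) (F i)"
  and augmentation_hom: "\<epsilon> \<in> mod_hom \<R> (F 0) trivial_module"
  and exact_0: "d (Suc 0) ` carrier (F (Suc 0)) = {x \<in> carrier (F 0). \<epsilon> x = 0}"
  and exact_Suc: "d (Suc (Suc i)) ` carrier (F (Suc (Suc i))) =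
    {x \<in> carrier (F (Suc i)). d (Suc i) x = \<zero>\<^bsub>F i\<^esub>}"
proof -
  \<comment> \<open>This is the shortest truncation whose clauses include exactness at
    \<open>F (Suc i)\<close>.\<close>
  have "partial_resolution (Suc (Suc i)) G F d \<epsilon>"
    using resolution by (simp add: projective_resolution_def)
  then show "projective \<R> (F i)" "d (Suc i) \<in> mod_hom \<R> (F (Suc i)) (F i)"
    "\<epsilon> \<in> mod_hom \<R> (F 0) trivial_module"
    "d (Suc 0) ` carrier (F (Suc 0)) = {x \<in> carrier (F 0). \<epsilon> x = 0}"
    "d (Suc (Suc i)) ` carrier (F (Suc (Suc i))) = {x \<in> carrier (F (Suc i)). d (Suc i) x = \<zero>\<^bsub>F i\<^esub>}"
    by (simp_all add: partial_resolution_def)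
qed

sublocale F: left_module \<R> "F i" for i
  using projective_F[of i] by (simp add: projective_def)

lemma d_closed [simp, intro]: "x \<in> carrier (F (Suc i)) \<Longrightarrow> d (Suc i) x \<in> carrier (F i)"
  using mod_homD(1)[OF d_hom] .

lemma d_d: "x \<in> carrier (F (Suc (Suc i))) \<Longrightarrow> d (Suc i) (d (Suc (Suc i)) x) = \<zero>\<^bsub>F i\<^esub>"
  using exact_Suc[of i] by blast

text \<open>
  Multiplication by a central element \<open>r\<close> is a chain map lifting multiplication by its augmentation,
  here \<open>0\<close>. Only one degree at a time is needed later, so \<open>t\<close> need not be named as the homotopy in
  degree \<open>i - 1\<close>.
\<close>

lemma null_homotopic:
  assumes r: "r \<in> carrier \<R>" "\<And>a. a \<in> carrier \<R> \<Longrightarrow> r \<otimes>\<^bsub>\<R>\<^esub> a = a \<otimes>\<^bsub>\<R>\<^esub> r"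
    and triv: "\<And>k. r \<odot>\<^bsub>trivial_module\<^esub> k = 0"
  shows "\<exists>s\<in>mod_hom \<R> (F i) (F (Suc i)). \<exists>t\<in>mod_hom \<R> (F (i - 1)) (F i). \<forall>x\<in>carrier (F i).
    r \<odot>\<^bsub>F i\<^esub> x = d (Suc i) (s x) \<oplus>\<^bsub>F i\<^esub> (if i = 0 then \<zero>\<^bsub>F i\<^esub> else t (d i x))"
proof (induction i)
  case 0
  \<comment> \<open>Since \<open>r\<close> has augmentation zero, \<open>r x\<close> lies in the
    kernel of \<open>\<epsilon>\<close>, which is the image of \<open>d (Suc 0)\<close>.\<close>
  have "(\<lambda>x. r \<odot>\<^bsub>F 0\<^esub> x) ` carrier (F 0) \<subseteq> d (Suc 0) ` carrier (F (Suc 0))"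
    unfolding exact_0 using r(1) by (auto simp: mod_homD(3)[OF augmentation_hom] triv)
  then obtain s where s: "s \<in> mod_hom \<R> (F 0) (F (Suc 0))"
      "\<And>x. x \<in> carrier (F 0) \<Longrightarrow> d (Suc 0) (s x) = r \<odot>\<^bsub>F 0\<^esub> x"
    using projective_lift_image[OF projective_F F.left_module_axioms F.left_module_axioms
        F.smult_hom[OF r] d_hom] by metis
  \<comment> \<open>In degree zero \<open>i - 1\<close> is again zero and the second summand is
    replaced by zero, so any endomorphism of \<open>F 0\<close> can serve as \<open>t\<close>; the
    identity is taken.\<close>
  moreover have "(\<lambda>x. x) \<in> mod_hom \<R> (F 0) (F 0)"
    by (auto simp: mod_hom_def)
  ultimately show ?case
    using r(1) by (intro bexI[of _ s] bexI[of _ "\<lambda>x. x"]) auto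
next
  case (Suc i)
  then obtain s t where s: "s \<in> mod_hom \<R> (F i) (F (Suc i))" and t: "t \<in> mod_hom \<R> (F (i - 1)) (F i)"
    and st: "\<And>x. x \<in> carrier (F i) \<Longrightarrow>
      r \<odot>\<^bsub>F i\<^esub> x = d (Suc i) (s x) \<oplus>\<^bsub>F i\<^esub> (if i = 0 then \<zero>\<^bsub>F i\<^esub> else t (d i x))"
    by blast
  note s' = mod_homD[OF s] and d' = mod_homD[OF d_hom]
  \<comment> \<open>What the previous homotopy leaves over. It is killed by \<open>d\<close>:
    applying the induction hypothesis to \<open>d x\<close> gives \<open>r d x = d s d x\<close>,
    because \<open>t d d x\<close> vanishes. Exactness and projectivity then lift it to the next
    homotopy.\<close>
  define f where "f = (\<lambda>x. r \<odot>\<^bsub>F (Suc i)\<^esub> x \<ominus>\<^bsub>F (Suc i)\<^esub> s (d (Suc i) x))"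
  have f: "f \<in> mod_hom \<R> (F (Suc i)) (F (Suc i))"
    unfolding f_def by (intro mod_hom_diff F.left_module_axioms F.smult_hom r mod_hom_comp[OF d_hom s])
  have "d (Suc i) (f x) = \<zero>\<^bsub>F i\<^esub>" if x: "x \<in> carrier (F (Suc i))" for x
  proof -
    have dx: "(if i = 0 then \<zero>\<^bsub>F i\<^esub> else t (d i (d (Suc i) x))) = \<zero>\<^bsub>F i\<^esub>"
    proof (cases i)
      case (Suc j)
      with x t show ?thesis
        using mod_hom_zero[OF F.M.abelian_group_axioms F.M.abelian_group_axioms t] by (simp add: d_d)
    qed simp
    have "d (Suc i) (f x) = d (Suc i) (r \<odot>\<^bsub>F (Suc i)\<^esub> x) \<ominus>\<^bsub>F i\<^esub> d (Suc i) (s (d (Suc i) x))"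
      unfolding f_def using x r(1) s'(1)[of "d (Suc i) x"]
      by (simp add: a_minus_def d' mod_hom_minus[OF F.M.abelian_group_axioms F.M.abelian_group_axioms d_hom])
    also have "d (Suc i) (r \<odot>\<^bsub>F (Suc i)\<^esub> x) = d (Suc i) (s (d (Suc i) x))"
      using st[of "d (Suc i) x"] x r(1) s'(1)[of "d (Suc i) x"] by (simp add: dx d'(3))
    finally show ?thesis
      using x s'(1)[of "d (Suc i) x"] by (simp add: F.M.r_neg a_minus_def)
  qed
  then have "f ` carrier (F (Suc i)) \<subseteq> d (Suc (Suc i)) ` carrier (F (Suc (Suc i)))"
    unfolding exact_Suc using mod_homD(1)[OF f] by auto
  then obtain s2 where s2: "s2 \<in> mod_hom \<R> (F (Suc i)) (F (Suc (Suc i)))"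
      "\<And>x. x \<in> carrier (F (Suc i)) \<Longrightarrow> d (Suc (Suc i)) (s2 x) = f x"
    using projective_lift_image[OF projective_F F.left_module_axioms F.left_module_axioms f d_hom]
    by metis
  have "r \<odot>\<^bsub>F (Suc i)\<^esub> x = f x \<oplus>\<^bsub>F (Suc i)\<^esub> s (d (Suc i) x)" if "x \<in> carrier (F (Suc i))" for x
    using that r(1) s'(1)[of "d (Suc i) x"] by (simp add: f_def a_minus_def F.M.a_assoc F.M.l_neg)
  with s2 s show ?case
    by (intro bexI[of _ s2] bexI[of _ s]) auto
qed

end

section \<open>Reduced cohomology\<close>

lemma (in group) trivial_FactGroup_carrier: "trivial_group (G Mod carrier G)"
proof -
  have "carrier G \<lhd> G"
    by (auto simp: normal_inv_iff subgroup_self)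
  then have "group (G Mod carrier G)"
    by (rule normal.factorgroup_is_group)
  moreover have "carrier (G Mod carrier G) = {carrier G}"
    using coset_join2[OF _ subgroup_self] by (auto simp: FactGroup_def RCOSETS_def)
  ultimately show ?thesis
    by (simp add: trivial_group_def FactGroup_def)
qed

text \<open>Turns both vanishing statements into the equality of a closure of (co)boundaries with a
  group of (co)cycles.\<close>

lemma trivial_kernel_Mod:
  assumes "group K" "group H" "h \<in> hom K H" "C = kernel K H h"
  shows "trivial_group (K\<lparr>carrier := kernel K H h\<rparr> Mod C)"
proof -
  interpret group_hom K H h
    using assms by (simp add: group_hom_def group_hom_axioms_def)
  have "group (K\<lparr>carrier := kernel K H h\<rparr>)"
    by (rule subgroup.subgroup_is_group[OF subgroup_kernel assms(1)])
  from group.trivial_FactGroup_carrier[OF this] show ?thesis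
    by (simp add: assms(4))
qed

lemma limitin_closure_of:
  assumes "limitin X u l F" "\<forall>\<^sub>F n in F. u n \<in> S" "F \<noteq> bot"
  shows "l \<in> X closure_of S"
  unfolding in_closure_of
proof (intro conjI allI impI)
  show "l \<in> topspace X"
    using assms(1) by (rule limitin_topspace)
  fix T assume "l \<in> T \<and> openin X T"
  with assms(1) have "\<forall>\<^sub>F n in F. u n \<in> T"
    by (simp add: limitin_def)
  with assms(2) have "\<forall>\<^sub>F n in F. u n \<in> S \<and> u n \<in> T"
    by (rule eventually_conj)
  then show "\<exists>y. y \<in> S \<and> y \<in> T"
    using assms(3) by (metis (mono_tags, lifting) eventually_happens)
qed

lemma (in lp_group) averaging_limit:
  assumes z: "inj z" "range z \<subseteq> carrier G" and f: "f \<in> carrier L"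
  shows "limitin (lp_topology p G) (\<lambda>N h. 1 / of_nat N * (averaging_element z N \<odot>\<^bsub>L\<^esub> f) h) f sequentially"
proof -
  have smult: "(averaging_element z N \<odot>\<^bsub>L\<^esub> f) h = of_nat N * f h - (\<Sum>k<N. translate (z k) f h)" for N h
  proof -
    have "translate \<one> f = f"
      using f by (auto simp: translate_def lp_outside)
    then show ?thesis
      by (simp add: averaging_element_def lp_smult_sum lp_smult_diff sum_subtractf)
  qed
  \<comment> \<open>At \<open>N = 0\<close> the left norm is zero and the right one is the norm of
    \<open>f\<close>, so the two agree in general only for positive \<open>N\<close>.\<close>
  have "\<forall>\<^sub>F N in sequentially. lp_norm p G (\<lambda>h. 1 / of_nat N * (\<Sum>k<N. translate (z k) f h)) =
      lp_norm p G (\<lambda>h. 1 / of_nat N * (averaging_element z N \<odot>\<^bsub>L\<^esub> f) h - f h)"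
    using eventually_gt_at_top[of 0]
  proof eventually_elim
    case (elim N)
    then have "(\<lambda>h. 1 / of_nat N * (averaging_element z N \<odot>\<^bsub>L\<^esub> f) h - f h) =
        (\<lambda>h. - 1 * (1 / of_nat N * (\<Sum>k<N. translate (z k) f h)))"
      by (simp add: smult fun_eq_iff field_simps)
    then show ?case
      by (simp only: lp_norm_cmult) simp
  qed
  from Lim_transform_eventually[OF average_tendsto_0[OF assms] this]
  show ?thesis
    using f z(2) by (simp add: limitin_lp lp_cmult[of _ "1 / of_nat _", simplified] lp_smult_closed averaging_element_carrier)
qed

section \<open>Homomorphisms into l^p(G) and pointwise convergence\<close>

context lp_group
begin

lemma lp_hom_carrier: "\<phi> \<in> carrier (lp_hom p G M) \<longleftrightarrow> \<phi> \<in> mod_hom \<R> M L \<and> \<phi> \<in> extensional (carrier M)"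
  by (simp add: lp_hom_def)

lemma lp_hom_simps:
  "\<phi> \<otimes>\<^bsub>lp_hom p G M\<^esub> \<psi> = (\<lambda>x\<in>carrier M. \<lambda>h. \<phi> x h + \<psi> x h)"
  "\<one>\<^bsub>lp_hom p G M\<^esub> = (\<lambda>x\<in>carrier M. \<lambda>h. 0)"
  by (simp_all add: lp_hom_def)

lemma mod_hom_cmult: "\<phi> \<in> mod_hom \<R> M L \<Longrightarrow> (\<lambda>x h. c * \<phi> x h) \<in> mod_hom \<R> M L"
  by (auto simp: mod_hom_def distrib_left lp_smult_right Pi_iff)

lemma mod_hom_restrict:
  assumes "left_module R M" "f \<in> mod_hom R M N"
  shows "restrict f (carrier M) \<in> mod_hom R M N"
proof -
  interpret left_module R M by fact
  show ?thesis using assms(2) by (auto simp: mod_hom_def)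
qed

lemma group_lp_hom:
  assumes "left_module \<R> M"
  shows "group (lp_hom p G M)"
proof (rule groupI)
  interpret M: left_module \<R> M by fact
  show "\<phi> \<otimes>\<^bsub>lp_hom p G M\<^esub> \<psi> \<in> carrier (lp_hom p G M)"
    if "\<phi> \<in> carrier (lp_hom p G M)" "\<psi> \<in> carrier (lp_hom p G M)" for \<phi> \<psi>
    using that by (auto simp: lp_hom_carrier lp_hom_simps mod_hom_def Pi_iff add_ac lp_smult_right)
  show "\<one>\<^bsub>lp_hom p G M\<^esub> \<in> carrier (lp_hom p G M)"
    by (auto simp: lp_hom_carrier lp_hom_simps mod_hom_def lp_smult)
  show "\<exists>\<psi>\<in>carrier (lp_hom p G M). \<psi> \<otimes>\<^bsub>lp_hom p G M\<^esub> \<phi> = \<one>\<^bsub>lp_hom p G M\<^esub>"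
    if "\<phi> \<in> carrier (lp_hom p G M)" for \<phi>
  proof
    show "(\<lambda>x\<in>carrier M. \<lambda>h. - 1 * \<phi> x h) \<in> carrier (lp_hom p G M)"
      using that mod_hom_restrict[OF assms mod_hom_cmult[of \<phi> M "- 1"]] by (simp add: lp_hom_carrier)
  qed (auto simp: lp_hom_simps fun_eq_iff restrict_def)
qed (auto simp: lp_hom_carrier lp_hom_simps fun_eq_iff restrict_def mod_hom_def extensional_def add_ac)

lemma topspace_lp_hom [simp]: "topspace (lp_hom_topology p G M) = carrier (lp_hom p G M)"
  by (auto simp: lp_hom_topology_def lp_hom_carrier mod_hom_def PiE_def)

lemma limitin_lp_hom:
  "limitin (lp_hom_topology p G M) u \<phi> F \<longleftrightarrow> \<phi> \<in> carrier (lp_hom p G M) \<and>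
     (\<forall>\<^sub>F n in F. u n \<in> carrier (lp_hom p G M)) \<and>
     (\<forall>x\<in>carrier M. limitin (lp_topology p G) (\<lambda>n. u n x) (\<phi> x) F)"
proof -
  have sub: "carrier (lp_hom p G M) \<subseteq> carrier M \<rightarrow>\<^sub>E carrier L"
    by (auto simp: lp_hom_carrier mod_hom_def PiE_def)
  have "\<forall>\<^sub>F n in F. u n \<in> carrier M \<rightarrow>\<^sub>E carrier L" if "\<forall>\<^sub>F n in F. u n \<in> carrier (lp_hom p G M)"
    using that by (rule eventually_mono) (use sub in blast)
  with sub show ?thesis
    unfolding lp_hom_topology_def limitin_subtopology limitin_componentwise
    by (auto simp: lp_hom_carrier)
qed

lemma continuous_map_lp_hom_eval:
  "x \<in> carrier M \<Longrightarrow> continuous_map (lp_hom_topology p G M) (lp_topology p G) (\<lambda>\<phi>. \<phi> x)"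
  unfolding lp_hom_topology_def
  by (intro continuous_map_from_subtopology continuous_map_product_projection)

lemma closedin_lp_singleton: "f \<in> carrier L \<Longrightarrow> closedin (lp_topology p G) {f}"
  by (simp add: closedin_Hausdorff_sing_eq Hausdorff_lp)

end

lemma (in group) inv_center:
  assumes "z \<in> center G"
  shows "inv z \<in> center G"
proof -
  from assms have "inv z \<in> carrier G" "g \<otimes> inv z = inv z \<otimes> g" if "g \<in> carrier G" for g
    using that inv_mult_group[of z "inv g"] inv_mult_group[of "inv g" z] by (auto simp: center_def)
  with assms show ?thesis by (auto simp: center_def)
qed

lemma (in resolution) averaging_null_homotopic:
  assumes "range w \<subseteq> center G"
  shows "\<exists>s\<in>mod_hom \<R> (F i) (F (Suc i)). \<exists>t\<in>mod_hom \<R> (F (i - 1)) (F i). \<forall>x\<in>carrier (F i).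
    averaging_element w N \<odot>\<^bsub>F i\<^esub> x = d (Suc i) (s x) \<oplus>\<^bsub>F i\<^esub> (if i = 0 then \<zero>\<^bsub>F i\<^esub> else t (d i x))"
  by (intro null_homotopic averaging_element_carrier averaging_element_central averaging_element_trivial)
    (use assms in \<open>auto simp: center_def\<close>)

section \<open>The reduced cohomology of a resolution\<close>

locale lp_resolution = lp_group G p + resolution G F d \<epsilon>
  for G :: "('g, 'b) monoid_scheme" (structure) and p :: real
    and F :: "nat \<Rightarrow> ('g \<Rightarrow>\<^sub>0 int, 'm) module" and d :: "nat \<Rightarrow> 'm \<Rightarrow> 'm" and \<epsilon> :: "'m \<Rightarrow> int" +
  fixes z :: "nat \<Rightarrow> 'g"
  assumes inj_z: "inj z" and center_z: "range z \<subseteq> center G"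
begin

lemma carrier_z: "range z \<subseteq> carrier G"
  using center_z by (auto simp: center_def)

lemma lp_coboundary_Suc_apply:
  "x \<in> carrier (F (Suc i)) \<Longrightarrow> lp_coboundary p G F d (Suc i) \<phi> x = \<phi> (d (Suc i) x)"
  by (simp add: lp_coboundary_def compose_def)

lemma lp_coboundary_hom: "lp_coboundary p G F d (Suc i) \<in> hom (lp_hom p G (F i)) (lp_hom p G (F (Suc i)))"
proof (rule homI)
  fix \<phi> \<psi> assume "\<phi> \<in> carrier (lp_hom p G (F i))" "\<psi> \<in> carrier (lp_hom p G (F i))"
  then show "lp_coboundary p G F d (Suc i) \<phi> \<in> carrier (lp_hom p G (F (Suc i)))"
    using mod_hom_restrict[OF F.left_module_axioms mod_hom_comp[OF d_hom, of \<phi> i L]]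
    by (simp add: lp_coboundary_def compose_def lp_hom_carrier)
  show "lp_coboundary p G F d (Suc i) (\<phi> \<otimes>\<^bsub>lp_hom p G (F i)\<^esub> \<psi>) =
      lp_coboundary p G F d (Suc i) \<phi> \<otimes>\<^bsub>lp_hom p G (F (Suc i))\<^esub> lp_coboundary p G F d (Suc i) \<psi>"
    by (auto simp: lp_coboundary_def compose_def lp_hom_simps fun_eq_iff restrict_def)
qed

lemma lp_cocycle_iff:
  "\<phi> \<in> kernel (lp_hom p G (F i)) (lp_hom p G (F (Suc i))) (lp_coboundary p G F d (Suc i)) \<longleftrightarrow>
    \<phi> \<in> carrier (lp_hom p G (F i)) \<and> (\<forall>x\<in>carrier (F (Suc i)). \<phi> (d (Suc i) x) = (\<lambda>h. 0))"
  by (auto simp: kernel_def lp_hom_simps lp_coboundary_def compose_def restrict_def fun_eq_iff)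

lemma lp_coboundary_image_subset:
  "lp_coboundary p G F d i ` carrier (lp_hom p G (F (i - 1))) \<subseteq>
    kernel (lp_hom p G (F i)) (lp_hom p G (F (Suc i))) (lp_coboundary p G F d (Suc i))"
proof (cases i)
  case 0
  have "\<one>\<^bsub>lp_hom p G (F 0)\<^esub> \<in> carrier (lp_hom p G (F 0))"
    by (intro monoid.one_closed group.is_monoid group_lp_hom F.left_module_axioms)
  with 0 show ?thesis
    by (auto simp: lp_cocycle_iff) (simp_all add: lp_coboundary_def lp_hom_simps)
next
  case (Suc j)
  show ?thesis
  proof
    fix \<psi> assume "\<psi> \<in> lp_coboundary p G F d i ` carrier (lp_hom p G (F (i - 1)))"
    then obtain \<phi> where \<phi>: "\<phi> \<in> carrier (lp_hom p G (F j))" "\<psi> = lp_coboundary p G F d (Suc j) \<phi>"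
      by (auto simp: Suc)
    then have "\<phi> \<in> mod_hom \<R> (F j) L"
      by (simp add: lp_hom_carrier)
    then have "\<phi> \<zero>\<^bsub>F j\<^esub> = (\<lambda>h. 0)"
      using mod_hom_zero[OF F.M.abelian_group_axioms abelian_group_lp] by fastforce
    with \<phi> show "\<psi> \<in> kernel (lp_hom p G (F i)) (lp_hom p G (F (Suc i))) (lp_coboundary p G F d (Suc i))"
      using hom_carrier[OF lp_coboundary_hom[of j]] by (auto simp: Suc lp_cocycle_iff lp_coboundary_Suc_apply d_d)
  qed
qed

text \<open>Apply \<open>\<phi>\<close> to the null-homotopy \<open>r x = d s x + t d x\<close>. The
  first term dies because \<open>\<phi>\<close> is a cocycle, and the second is the coboundary of
  \<open>\<phi>\<close> composed with \<open>t\<close>. Hence the approximants \<open>u N\<close>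
  are coboundaries, converging to \<open>\<phi>\<close> at each point.\<close>

lemma lp_cocycle_limit:
  assumes \<phi>: "\<phi> \<in> kernel (lp_hom p G (F i)) (lp_hom p G (F (Suc i))) (lp_coboundary p G F d (Suc i))"
  shows "\<phi> \<in> lp_hom_topology p G (F i) closure_of
    (lp_coboundary p G F d i ` carrier (lp_hom p G (F (i - 1))))"
proof (rule limitin_closure_of)
  from \<phi> have \<phi>h: "\<phi> \<in> mod_hom \<R> (F i) L" and \<phi>d: "\<And>x. x \<in> carrier (F (Suc i)) \<Longrightarrow> \<phi> (d (Suc i) x) = (\<lambda>h. 0)"
    and \<phi>c: "\<phi> \<in> carrier (lp_hom p G (F i))"
    by (auto simp: lp_cocycle_iff lp_hom_carrier)
  define u where "u = (\<lambda>N. \<lambda>x\<in>carrier (F i). \<lambda>h. 1 / of_nat N * (averaging_element z N \<odot>\<^bsub>L\<^esub> \<phi> x) h)"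
  have u: "u N \<in> lp_coboundary p G F d i ` carrier (lp_hom p G (F (i - 1)))" for N
  proof -
    obtain s t where s: "s \<in> mod_hom \<R> (F i) (F (Suc i))" and t: "t \<in> mod_hom \<R> (F (i - 1)) (F i)"
      and st: "\<And>x. x \<in> carrier (F i) \<Longrightarrow> averaging_element z N \<odot>\<^bsub>F i\<^esub> x =
        d (Suc i) (s x) \<oplus>\<^bsub>F i\<^esub> (if i = 0 then \<zero>\<^bsub>F i\<^esub> else t (d i x))"
      using averaging_null_homotopic[OF center_z] by blast
    note s' = mod_homD[OF s] and t' = mod_homD[OF t] and \<phi>' = mod_homD[OF \<phi>h]
    \<comment> \<open>The homotopy \<open>t\<close> cannot be divided by \<open>N\<close>, so the
      factor is put on the values in l^p(G) after composing.\<close>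
    define \<psi> where "\<psi> = (\<lambda>y\<in>carrier (F (i - 1)). \<lambda>h. 1 / of_nat N * \<phi> (t y) h)"
    have "\<psi> \<in> carrier (lp_hom p G (F (i - 1)))"
      using mod_hom_restrict[OF F.left_module_axioms mod_hom_cmult[OF mod_hom_comp[OF t \<phi>h]], of "1 / of_nat N"]
      by (simp add: \<psi>_def lp_hom_carrier)
    moreover have "u N = lp_coboundary p G F d i \<psi>"
    proof -
      have "averaging_element z N \<odot>\<^bsub>L\<^esub> \<phi> x = (if i = 0 then (\<lambda>h. 0) else \<phi> (t (d i x)))"
        if x: "x \<in> carrier (F i)" for x
      proof -
        have "averaging_element z N \<odot>\<^bsub>L\<^esub> \<phi> x = \<phi> (averaging_element z N \<odot>\<^bsub>F i\<^esub> x)"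
          by (simp add: \<phi>'(3) x carrier_z)
        also have "\<dots> = (if i = 0 then (\<lambda>h. 0) else \<phi> (t (d i x)))"
        proof (cases "i = 0")
          case True
          then show ?thesis using st[OF x] s'(1)[OF x] \<phi>d[of "s x"] by simp
        next
          case False
          then have "d i x \<in> carrier (F (i - 1))"
            using x d_closed[of x "i - 1"] by simp
          then show ?thesis
            using False st[OF x] s'(1)[OF x] t'(1)[of "d i x"] \<phi>d[of "s x"] by (simp add: \<phi>'(2))
        qed
        finally show ?thesis .
      qed
      then show ?thesis
        by (cases i) (auto simp: u_def \<psi>_def lp_coboundary_def lp_hom_simps compose_def restrict_def fun_eq_iff)
    qed
    ultimately show ?thesis by blast
  qed
  then show "\<forall>\<^sub>F N in sequentially. u N \<in> lp_coboundary p G F d i ` carrier (lp_hom p G (F (i - 1)))"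
    by simp
  have "u N \<in> carrier (lp_hom p G (F i))" for N
    using u[of N] lp_coboundary_image_subset[of i] by (auto simp: kernel_def)
  with \<phi>c show "limitin (lp_hom_topology p G (F i)) u \<phi> sequentially"
    using averaging_limit[OF inj_z carrier_z mod_homD(1)[OF \<phi>h]] by (simp add: limitin_lp_hom u_def)
qed simp

text \<open>For closedness of the cocycles, each condition \<open>\<phi> (d x) = 0\<close> is the
  preimage of a closed point under the continuous evaluation at \<open>d x\<close>.\<close>

theorem trivial_reduced_lp_cohomology: "trivial_group (reduced_lp_cohomology p G F d i)"
  unfolding reduced_lp_cohomology_def
proof (intro trivial_kernel_Mod group_lp_hom F.left_module_axioms lp_coboundary_hom equalityI subsetI)
  fix \<phi> assume \<phi>: "\<phi> \<in> lp_hom_topology p G (F i) closure_of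
    (lp_coboundary p G F d i ` carrier (lp_hom p G (F (i - 1))))"
  have "\<phi> (d (Suc i) x) = (\<lambda>h. 0)" if x: "x \<in> carrier (F (Suc i))" for x
  proof -
    have "lp_hom_topology p G (F i) closure_of (lp_coboundary p G F d i ` carrier (lp_hom p G (F (i - 1))))
      \<subseteq> {\<psi> \<in> topspace (lp_hom_topology p G (F i)). \<psi> (d (Suc i) x) \<in> {\<lambda>h. 0}}"
      using lp_coboundary_image_subset[of i] x
      by (intro closure_of_minimal closedin_continuous_map_preimage[OF continuous_map_lp_hom_eval]
          closedin_lp_singleton) (auto simp: lp_cocycle_iff)
    with \<phi> show ?thesis by blast
  qed
  moreover have "\<phi> \<in> carrier (lp_hom p G (F i))"
    using \<phi> closure_of_subset_topspace by fastforce
  ultimately show "\<phi> \<in> kernel (lp_hom p G (F i)) (lp_hom p G (F (Suc i))) (lp_coboundary p G F d (Suc i))"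
    by (simp add: lp_cocycle_iff)
qed (rule lp_cocycle_limit)

end

section \<open>Tensor products\<close>

text \<open>Assuming just additive groups with closed actions lets \<open>right_of_left G M\<close>,
  whose action reverses products, occupy the first place.\<close>

locale tensor_factors = M: abelian_group M + N: abelian_group N
  for R :: "('r, 'c) ring_scheme" and M :: "('r, 'm, 'd) module_scheme" and N :: "('r, 'n, 'e) module_scheme" +
  assumes smult_M: "r \<in> carrier R \<Longrightarrow> x \<in> carrier M \<Longrightarrow> r \<odot>\<^bsub>M\<^esub> x \<in> carrier M"
    and smult_N: "r \<in> carrier R \<Longrightarrow> y \<in> carrier N \<Longrightarrow> r \<odot>\<^bsub>N\<^esub> y \<in> carrier N"
begin

abbreviation "T \<equiv> tensor R M N"
abbreviation "pure \<equiv> pure_tensor R M N"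
abbreviation "proj a \<equiv> tensor_null R M N #>\<^bsub>tensor_free M N\<^esub> a"

sublocale free: comm_group "tensor_free M N"
  by (rule abelian_free_Abelian_group)

lemma keys_frag_diff: "Poly_Mapping.keys a \<subseteq> S \<Longrightarrow> Poly_Mapping.keys b \<subseteq> S \<Longrightarrow> Poly_Mapping.keys (a - b) \<subseteq> S"
  using keys_diff[of a b] by auto

lemma tensor_relations_subset: "tensor_relations R M N \<subseteq> carrier (tensor_free M N)"
proof
  fix w assume "w \<in> tensor_relations R M N"
  then have "Poly_Mapping.keys w \<subseteq> carrier M \<times> carrier N"
    unfolding tensor_relations_def
    by (elim UnE CollectE exE conjE) (hypsubst, intro keys_frag_diff; simp add: smult_M smult_N)+
  then show "w \<in> carrier (tensor_free M N)" by simp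
qed

lemma subgroup_tensor_null: "subgroup (tensor_null R M N) (tensor_free M N)"
  unfolding tensor_null_def by (rule free.generate_is_subgroup[OF tensor_relations_subset])

lemma normal_tensor_null: "tensor_null R M N \<lhd> tensor_free M N"
  by (simp add: free.normal_iff_subgroup subgroup_tensor_null)

sublocale T: comm_group T
  unfolding tensor_def by (rule free.abelian_FactGroup[OF subgroup_tensor_null])

lemma carrier_tensor: "carrier T = (\<lambda>a. proj a) ` carrier (tensor_free M N)"
  by (simp add: tensor_def carrier_FactGroup)

sublocale proj: group_hom "tensor_free M N" T "\<lambda>a. proj a"
  using normal.r_coset_hom_Mod[OF normal_tensor_null]
  by (simp add: group_hom_def group_hom_axioms_def tensor_def[symmetric] T.is_group)

lemma proj_diff:
  assumes "Poly_Mapping.keys a \<subseteq> carrier M \<times> carrier N" "Poly_Mapping.keys b \<subseteq> carrier M \<times> carrier N"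
  shows "proj (a - b) = proj a \<otimes>\<^bsub>T\<^esub> inv\<^bsub>T\<^esub> proj b"
  using proj.hom_mult[of a "- b"] proj.hom_inv[of b] assms by simp

lemma proj_eq_one: "a \<in> tensor_relations R M N \<Longrightarrow> proj a = \<one>\<^bsub>T\<^esub>"
proof -
  assume a: "a \<in> tensor_relations R M N"
  then have "a \<in> tensor_null R M N"
    unfolding tensor_null_def by (rule generate.incl)
  then have "proj a = tensor_null R M N"
    using a tensor_relations_subset by (intro free.coset_join2 subgroup_tensor_null) blast+
  then show ?thesis by (simp add: tensor_def FactGroup_def)
qed

lemma pure_eq: "pure x y = proj (frag_of (x, y))"
  by (simp add: pure_tensor_def)

lemma pure_closed [simp, intro]: "x \<in> carrier M \<Longrightarrow> y \<in> carrier N \<Longrightarrow> pure x y \<in> carrier T"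
  unfolding pure_eq by (rule proj.hom_closed) simp

lemma proj_diff_diff_eq_one:
  assumes "a \<in> carrier M \<times> carrier N" "b \<in> carrier M \<times> carrier N" "c \<in> carrier M \<times> carrier N"
    and "frag_of a - frag_of b - frag_of c \<in> tensor_relations R M N"
  shows "proj (frag_of a) = proj (frag_of b) \<otimes>\<^bsub>T\<^esub> proj (frag_of c)"
proof -
  have cl: "proj (frag_of a) \<in> carrier T" "proj (frag_of b) \<in> carrier T" "proj (frag_of c) \<in> carrier T"
    using assms(1-3) by (auto intro!: proj.hom_closed)
  have "Poly_Mapping.keys (frag_of a - frag_of b) \<subseteq> carrier M \<times> carrier N"
    using assms by (intro keys_frag_diff) auto
  then have "proj (frag_of a) \<otimes>\<^bsub>T\<^esub> inv\<^bsub>T\<^esub> proj (frag_of b) \<otimes>\<^bsub>T\<^esub> inv\<^bsub>T\<^esub> proj (frag_of c) = \<one>\<^bsub>T\<^esub>"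
    using proj_eq_one[OF assms(4)] assms(1-3) by (simp add: proj_diff)
  then have "proj (frag_of a) \<otimes>\<^bsub>T\<^esub> inv\<^bsub>T\<^esub> proj (frag_of b) = proj (frag_of c)"
    using cl T.inv_equality[of "proj (frag_of a) \<otimes>\<^bsub>T\<^esub> inv\<^bsub>T\<^esub> proj (frag_of b)" "inv\<^bsub>T\<^esub> proj (frag_of c)"] by simp
  then show ?thesis
    using cl by (metis T.inv_solve_right T.m_comm T.inv_closed)
qed

lemma pure_add_left:
  assumes "x \<in> carrier M" "x' \<in> carrier M" "y \<in> carrier N"
  shows "pure (x \<oplus>\<^bsub>M\<^esub> x') y = pure x y \<otimes>\<^bsub>T\<^esub> pure x' y"
  unfolding pure_eq
  by (rule proj_diff_diff_eq_one) (use assms in \<open>auto simp: tensor_relations_def\<close>)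

lemma pure_add_right:
  assumes "x \<in> carrier M" "y \<in> carrier N" "y' \<in> carrier N"
  shows "pure x (y \<oplus>\<^bsub>N\<^esub> y') = pure x y \<otimes>\<^bsub>T\<^esub> pure x y'"
  unfolding pure_eq
  by (rule proj_diff_diff_eq_one) (use assms in \<open>auto simp: tensor_relations_def\<close>)

lemma pure_balanced:
  assumes "r \<in> carrier R" "x \<in> carrier M" "y \<in> carrier N"
  shows "pure (r \<odot>\<^bsub>M\<^esub> x) y = pure x (r \<odot>\<^bsub>N\<^esub> y)"
proof -
  have "proj (frag_of (r \<odot>\<^bsub>M\<^esub> x, y) - frag_of (x, r \<odot>\<^bsub>N\<^esub> y)) = \<one>\<^bsub>T\<^esub>"
    by (rule proj_eq_one) (use assms in \<open>auto simp: tensor_relations_def\<close>)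
  then have "pure (r \<odot>\<^bsub>M\<^esub> x) y \<otimes>\<^bsub>T\<^esub> inv\<^bsub>T\<^esub> pure x (r \<odot>\<^bsub>N\<^esub> y) = \<one>\<^bsub>T\<^esub>"
    using assms smult_M smult_N by (simp add: proj_diff pure_eq)
  then show ?thesis
    using assms smult_M smult_N
      T.inv_equality[of "pure (r \<odot>\<^bsub>M\<^esub> x) y" "inv\<^bsub>T\<^esub> pure x (r \<odot>\<^bsub>N\<^esub> y)"] by simp
qed

lemma pure_zero_left: "y \<in> carrier N \<Longrightarrow> pure \<zero>\<^bsub>M\<^esub> y = \<one>\<^bsub>T\<^esub>"
  using pure_add_left[of "\<zero>\<^bsub>M\<^esub>" "\<zero>\<^bsub>M\<^esub>" y] T.l_cancel_one'[of "pure \<zero>\<^bsub>M\<^esub> y" "pure \<zero>\<^bsub>M\<^esub> y"] by simp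

lemma pure_zero_right: "x \<in> carrier M \<Longrightarrow> pure x \<zero>\<^bsub>N\<^esub> = \<one>\<^bsub>T\<^esub>"
  using pure_add_right[of x "\<zero>\<^bsub>N\<^esub>" "\<zero>\<^bsub>N\<^esub>"] T.l_cancel_one'[of "pure x \<zero>\<^bsub>N\<^esub>" "pure x \<zero>\<^bsub>N\<^esub>"] by simp

lemma pure_minus_left: "x \<in> carrier M \<Longrightarrow> y \<in> carrier N \<Longrightarrow> pure (\<ominus>\<^bsub>M\<^esub> x) y = inv\<^bsub>T\<^esub> pure x y"
  using pure_add_left[of "\<ominus>\<^bsub>M\<^esub> x" x y]
  by (intro T.inv_equality[symmetric]) (simp_all add: M.l_neg pure_zero_left)

lemma tensor_induct [consumes 1, case_names one pure diff]:
  assumes "c \<in> carrier T" and "P \<one>\<^bsub>T\<^esub>"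
    and "\<And>x y. x \<in> carrier M \<Longrightarrow> y \<in> carrier N \<Longrightarrow> P (pure x y)"
    and "\<And>b c. b \<in> carrier T \<Longrightarrow> c \<in> carrier T \<Longrightarrow> P b \<Longrightarrow> P c \<Longrightarrow> P (b \<otimes>\<^bsub>T\<^esub> inv\<^bsub>T\<^esub> c)"
  shows "P c"
proof -
  obtain a where a: "Poly_Mapping.keys a \<subseteq> carrier M \<times> carrier N" "c = proj a"
    using assms(1) by (auto simp: carrier_tensor)
  have "P (proj a)"
    using a(1)
  proof (rule free_Abelian_group_induct)
    show "P (proj 0)"
      using assms(2) proj.hom_one by simp
    show "P (proj (a - b))" if "Poly_Mapping.keys a \<subseteq> carrier M \<times> carrier N"
      "Poly_Mapping.keys b \<subseteq> carrier M \<times> carrier N" "P (proj a)" "P (proj b)" for a b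
      using that assms(4)[of "proj a" "proj b"] by (simp add: proj_diff carrier_tensor)
    show "P (proj (frag_of ab))" if "ab \<in> carrier M \<times> carrier N" for ab
      using that assms(3) by (auto simp: pure_eq)
  qed
  with a(2) show ?thesis by simp
qed

lemma tensor_hom_eqI:
  assumes "group A" "g \<in> hom T A" "h \<in> hom T A"
    and "\<And>x y. x \<in> carrier M \<Longrightarrow> y \<in> carrier N \<Longrightarrow> g (pure x y) = h (pure x y)" "c \<in> carrier T"
  shows "g c = h c"
proof -
  interpret g: group_hom T A g
    using assms by (simp add: group_hom_def group_hom_axioms_def T.is_group)
  interpret h: group_hom T A h
    using assms by (simp add: group_hom_def group_hom_axioms_def T.is_group)
  from assms(5) show ?thesis
    by (induction c rule: tensor_induct) (simp_all add: assms(4))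
qed

text \<open>The universal property for balanced biadditive maps: extend to the free abelian group,
  observe that the defining relations are killed, and pass to the quotient.\<close>

lemma tensor_lift:
  assumes A: "comm_group A"
    and cl: "\<And>x y. x \<in> carrier M \<Longrightarrow> y \<in> carrier N \<Longrightarrow> \<beta> x y \<in> carrier A"
    and left: "\<And>x x' y. x \<in> carrier M \<Longrightarrow> x' \<in> carrier M \<Longrightarrow> y \<in> carrier N \<Longrightarrow>
      \<beta> (x \<oplus>\<^bsub>M\<^esub> x') y = \<beta> x y \<otimes>\<^bsub>A\<^esub> \<beta> x' y"
    and right: "\<And>x y y'. x \<in> carrier M \<Longrightarrow> y \<in> carrier N \<Longrightarrow> y' \<in> carrier N \<Longrightarrow>
      \<beta> x (y \<oplus>\<^bsub>N\<^esub> y') = \<beta> x y \<otimes>\<^bsub>A\<^esub> \<beta> x y'"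
    and balanced: "\<And>r x y. r \<in> carrier R \<Longrightarrow> x \<in> carrier M \<Longrightarrow> y \<in> carrier N \<Longrightarrow>
      \<beta> (r \<odot>\<^bsub>M\<^esub> x) y = \<beta> x (r \<odot>\<^bsub>N\<^esub> y)"
  obtains h where "h \<in> hom T A"
    and "\<And>x y. x \<in> carrier M \<Longrightarrow> y \<in> carrier N \<Longrightarrow> h (pure x y) = \<beta> x y"
proof -
  interpret A: comm_group A by fact
  obtain h0 where h0: "h0 \<in> hom (tensor_free M N) A"
      "\<And>ab. ab \<in> carrier M \<times> carrier N \<Longrightarrow> h0 (frag_of ab) = (case ab of (x, y) \<Rightarrow> \<beta> x y)"
    by (rule A.free_Abelian_group_universal[of "\<lambda>(x, y). \<beta> x y" "carrier M \<times> carrier N"]) (use cl in auto)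
  interpret h0: group_hom "tensor_free M N" A h0
    using h0 by (simp add: group_hom_def group_hom_axioms_def A.is_group)
  have diff: "h0 (a - b) = h0 a \<otimes>\<^bsub>A\<^esub> inv\<^bsub>A\<^esub> h0 b"
    if "Poly_Mapping.keys a \<subseteq> carrier M \<times> carrier N" "Poly_Mapping.keys b \<subseteq> carrier M \<times> carrier N" for a b
    using h0.hom_mult[of a "- b"] h0.hom_inv[of b] that by simp
  have of: "h0 (frag_of (x, y)) = \<beta> x y" if "x \<in> carrier M" "y \<in> carrier N" for x y
    using h0(2) that by simp
  \<comment> \<open>This is the image of an additivity relation once biadditivity of
    \<open>\<beta>\<close> has been substituted.\<close>
  have cancel: "a \<otimes>\<^bsub>A\<^esub> b \<otimes>\<^bsub>A\<^esub> inv\<^bsub>A\<^esub> a \<otimes>\<^bsub>A\<^esub> inv\<^bsub>A\<^esub> b = \<one>\<^bsub>A\<^esub>"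
    if ab: "a \<in> carrier A" "b \<in> carrier A" for a b
  proof -
    have "b \<otimes>\<^bsub>A\<^esub> a \<otimes>\<^bsub>A\<^esub> inv\<^bsub>A\<^esub> a = b"
      using ab by (simp add: A.m_assoc)
    with ab show ?thesis by (simp add: A.m_comm[of a b])
  qed
  have "h0 w = \<one>\<^bsub>A\<^esub>" if "w \<in> tensor_relations R M N" for w
    using that unfolding tensor_relations_def
    by (auto simp: diff keys_frag_diff of cl left right balanced smult_M smult_N cancel)
  then have "tensor_relations R M N \<subseteq> kernel (tensor_free M N) A h0"
    using tensor_relations_subset by (force simp: kernel_def simp del: carrier_free_Abelian_group_iff)
  then have "tensor_null R M N \<subseteq> kernel (tensor_free M N) A h0"
    unfolding tensor_null_def by (rule free.generate_subgroup_incl[OF _ h0.subgroup_kernel])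
  then obtain h where h: "h \<in> hom T A" "\<And>a. a \<in> carrier (tensor_free M N) \<Longrightarrow> h (proj a) = h0 a"
    using h0.FactGroup_universal_kernel[OF normal_tensor_null] unfolding tensor_def by metis
  show thesis
    by (rule that[OF h(1)]) (simp add: pure_eq h(2) of)
qed

section \<open>Finite sums of pure tensors\<close>

definition pure_sum :: "nat \<Rightarrow> (nat \<Rightarrow> 'm) \<Rightarrow> (nat \<Rightarrow> 'n) \<Rightarrow> ('m \<times> 'n \<Rightarrow>\<^sub>0 int) set"
  where "pure_sum m x y = (\<Otimes>\<^bsub>T\<^esub>j\<in>{..<m}. pure (x j) (y j))"

lemma pure_sum_0: "pure_sum 0 x y = \<one>\<^bsub>T\<^esub>"
  by (simp add: pure_sum_def)

lemma pure_sum_closed: "x \<in> {..<m} \<rightarrow> carrier M \<Longrightarrow> y \<in> {..<m} \<rightarrow> carrier N \<Longrightarrow> pure_sum m x y \<in> carrier T"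
  by (auto simp: pure_sum_def Pi_iff)

lemma pure_sum_Suc:
  assumes "x \<in> {..<Suc m} \<rightarrow> carrier M" "y \<in> {..<Suc m} \<rightarrow> carrier N"
  shows "pure_sum (Suc m) x y = pure_sum m x y \<otimes>\<^bsub>T\<^esub> pure (x m) (y m)"
  using assms pure_sum_closed[of x m y]
  by (simp add: pure_sum_def lessThan_Suc T.m_comm Pi_iff T.finprod_insert)

lemma pure_sum_cong:
  assumes "\<And>j. j < m \<Longrightarrow> pure (x j) (y j) = pure (x' j) (y' j)"
    "x' \<in> {..<m} \<rightarrow> carrier M" "y' \<in> {..<m} \<rightarrow> carrier N"
  shows "pure_sum m x y = pure_sum m x' y'"
  unfolding pure_sum_def by (rule T.finprod_cong') (use assms in \<open>auto simp: Pi_iff\<close>)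

lemma hom_pure_sum:
  assumes A: "comm_group A" and h: "h \<in> hom T A"
    and xy: "x \<in> {..<m} \<rightarrow> carrier M" "y \<in> {..<m} \<rightarrow> carrier N"
  shows "h (pure_sum m x y) = (\<Otimes>\<^bsub>A\<^esub>j\<in>{..<m}. h (pure (x j) (y j)))"
proof -
  interpret A: comm_group A by fact
  interpret h: group_hom T A h
    using h by (simp add: group_hom_def group_hom_axioms_def T.is_group A.is_group)
  from xy show ?thesis
  proof (induction m)
    case (Suc m)
    then have "h (pure_sum m x y) = (\<Otimes>\<^bsub>A\<^esub>j\<in>{..<m}. h (pure (x j) (y j)))"
      by (auto simp: Pi_iff)
    with Suc.prems show ?case
      using pure_sum_closed[of x m y]
      by (simp add: pure_sum_Suc lessThan_Suc A.m_comm Pi_iff A.finprod_insert)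
  qed (simp add: pure_sum_0)
qed

text \<open>Finite sums of pure tensors are closed under subtraction because a sign can be absorbed
  into the first factor.\<close>

lemma tensor_exhaust:
  assumes "c \<in> carrier T"
  obtains m x y where "x \<in> {..<m} \<rightarrow> carrier M" "y \<in> {..<m} \<rightarrow> carrier N" "c = pure_sum m x y"
proof -
  define S where "S = {pure_sum m x y | m x y. x \<in> {..<m} \<rightarrow> carrier M \<and> y \<in> {..<m} \<rightarrow> carrier N}"
  have mult: "s \<otimes>\<^bsub>T\<^esub> pure x y \<in> S" if s: "s \<in> S" and xy: "x \<in> carrier M" "y \<in> carrier N" for s x y
  proof -
    obtain m u v where m: "u \<in> {..<m} \<rightarrow> carrier M" "v \<in> {..<m} \<rightarrow> carrier N" "s = pure_sum m u v"
      using s by (auto simp: S_def)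
    have "pure_sum (Suc m) (u(m := x)) (v(m := y)) = pure_sum m (u(m := x)) (v(m := y)) \<otimes>\<^bsub>T\<^esub> pure x y"
      by (subst pure_sum_Suc) (use m xy in \<open>auto simp: Pi_iff\<close>)
    also have "pure_sum m (u(m := x)) (v(m := y)) = s"
      unfolding m(3) by (rule pure_sum_cong) (use m in auto)
    finally have "s \<otimes>\<^bsub>T\<^esub> pure x y = pure_sum (Suc m) (u(m := x)) (v(m := y))" ..
    moreover have "u(m := x) \<in> {..<Suc m} \<rightarrow> carrier M" "v(m := y) \<in> {..<Suc m} \<rightarrow> carrier N"
      using m xy by (auto simp: Pi_iff)
    ultimately show ?thesis
      unfolding S_def by blast
  qed
  have one: "\<one>\<^bsub>T\<^esub> \<in> S"
    unfolding S_def by (intro CollectI exI[of _ 0]) (simp add: pure_sum_0)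
  have "c \<in> S"
    using assms
  proof (induction c rule: tensor_induct)
    case (pure x y)
    then show ?case using mult[OF one] by simp
  next
    case (diff b c)
    from diff.IH(2) obtain m u v
      where m: "u \<in> {..<m} \<rightarrow> carrier M" "v \<in> {..<m} \<rightarrow> carrier N" "c = pure_sum m u v"
      by (auto simp: S_def)
    from m(1,2) have "b \<otimes>\<^bsub>T\<^esub> inv\<^bsub>T\<^esub> pure_sum m u v \<in> S"
    proof (induction m)
      case 0
      then show ?case using diff by (simp add: pure_sum_0)
    next
      case (Suc m)
      then have um: "u m \<in> carrier M" "v m \<in> carrier N" "pure_sum m u v \<in> carrier T"
        and "b \<otimes>\<^bsub>T\<^esub> inv\<^bsub>T\<^esub> pure_sum m u v \<in> S"
        using pure_sum_closed[of u m v] by (auto simp: Pi_iff)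
      then have "b \<otimes>\<^bsub>T\<^esub> inv\<^bsub>T\<^esub> pure_sum m u v \<otimes>\<^bsub>T\<^esub> pure (\<ominus>\<^bsub>M\<^esub> u m) (v m) \<in> S"
        by (intro mult) auto
      with um diff Suc.prems show ?case
        by (simp add: pure_sum_Suc T.inv_mult pure_minus_left T.m_assoc)
    qed
    with m(3) show ?case by simp
  qed (rule one)
  with that show thesis by (auto simp: S_def)
qed

end

text \<open>The union over representatives in \<open>tensor_map\<close> is matched with the
  homomorphism \<open>h\<close> from the universal property: every representative of a coset yields
  the same image coset, so the union collapses to that one.\<close>

lemma tensor_map_hom:
  fixes M :: "('r, 'm, 'd) module_scheme" and M' :: "('r, 'm2, 'd2) module_scheme"
    and N :: "('r, 'n, 'e) module_scheme"
  assumes "tensor_factors R M N" "tensor_factors R M' N" and \<phi>: "\<phi> \<in> mod_hom R M M'"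
  shows "tensor_map R M M' N \<phi> \<in> hom (tensor R M N) (tensor R M' N)"
    and "x \<in> carrier M \<Longrightarrow> y \<in> carrier N \<Longrightarrow>
      tensor_map R M M' N \<phi> (pure_tensor R M N x y) = pure_tensor R M' N (\<phi> x) y"
proof -
  interpret A: tensor_factors R M N by fact
  interpret B: tensor_factors R M' N by fact
  note \<phi>' = mod_homD[OF \<phi>]
  obtain h where h: "h \<in> hom A.T B.T"
    "\<And>x y. x \<in> carrier M \<Longrightarrow> y \<in> carrier N \<Longrightarrow> h (A.pure x y) = B.pure (\<phi> x) y"
    by (rule A.tensor_lift[OF B.T.comm_group_axioms, of "\<lambda>x y. B.pure (\<phi> x) y"])
      (auto simp: \<phi>' B.pure_add_left B.pure_add_right B.pure_balanced)
  interpret h: group_hom A.T B.T h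
    using h(1) by (simp add: group_hom_def group_hom_axioms_def A.T.is_group B.T.is_group)
  define E where "E = frag_extend (\<lambda>(x, y :: 'n). frag_of (\<phi> x, y))"
  have E: "Poly_Mapping.keys (E a) \<subseteq> carrier M' \<times> carrier N \<and> h (A.proj a) = B.proj (E a)"
    if "Poly_Mapping.keys a \<subseteq> carrier M \<times> carrier N" for a
    using that
  proof (rule free_Abelian_group_induct)
    show "Poly_Mapping.keys (E 0) \<subseteq> carrier M' \<times> carrier N \<and> h (A.proj 0) = B.proj (E 0)"
      using A.proj.hom_one B.proj.hom_one by (simp add: E_def)
    show "Poly_Mapping.keys (E (a - b)) \<subseteq> carrier M' \<times> carrier N \<and> h (A.proj (a - b)) = B.proj (E (a - b))"
      if "Poly_Mapping.keys a \<subseteq> carrier M \<times> carrier N" "Poly_Mapping.keys b \<subseteq> carrier M \<times> carrier N"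
        "Poly_Mapping.keys (E a) \<subseteq> carrier M' \<times> carrier N \<and> h (A.proj a) = B.proj (E a)"
        "Poly_Mapping.keys (E b) \<subseteq> carrier M' \<times> carrier N \<and> h (A.proj b) = B.proj (E b)" for a b
      using that A.proj.hom_closed[of a] A.proj.hom_closed[of b]
      by (simp add: E_def frag_extend_diff B.keys_frag_diff A.proj_diff B.proj_diff)
    show "Poly_Mapping.keys (E (frag_of ab)) \<subseteq> carrier M' \<times> carrier N \<and>
        h (A.proj (frag_of ab)) = B.proj (E (frag_of ab))" if ab: "ab \<in> carrier M \<times> carrier N" for ab
    proof -
      obtain x y where xy: "ab = (x, y)" "x \<in> carrier M" "y \<in> carrier N"
        using ab by auto
      then show ?thesis
        using h(2)[of x y] by (simp add: E_def A.pure_eq B.pure_eq \<phi>')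
    qed
  qed
  have eq: "tensor_map R M M' N \<phi> c = h c" if c: "c \<in> carrier A.T" for c
  proof -
    obtain a where a: "Poly_Mapping.keys a \<subseteq> carrier M \<times> carrier N" "c = A.proj a"
      using c by (auto simp: A.carrier_tensor)
    have "a \<in> c"
      unfolding a(2) by (rule A.free.rcos_self[OF _ A.subgroup_tensor_null]) (use a in simp)
    moreover have "B.proj (E b) = h c" if "b \<in> c" for b
    proof -
      have "A.proj b = c" "Poly_Mapping.keys b \<subseteq> carrier M \<times> carrier N"
        using A.free.repr_independence[OF _ _ A.subgroup_tensor_null, of b a]
          subgroup.elemrcos_carrier[OF A.subgroup_tensor_null A.free.is_group, of a b] that a by simp_all
      with E[of b] show ?thesis by simp
    qed
    ultimately show ?thesis
      unfolding tensor_map_def E_def[symmetric] by auto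
  qed
  show "tensor_map R M M' N \<phi> \<in> hom A.T B.T"
    using h(1) by (auto simp: hom_def eq)
  show "x \<in> carrier M \<Longrightarrow> y \<in> carrier N \<Longrightarrow> tensor_map R M M' N \<phi> (A.pure x y) = B.pure (\<phi> x) y"
    by (simp add: eq h(2) A.pure_closed)
qed

section \<open>Dual bases\<close>

definition regular_module :: "('r, 'c) ring_scheme \<Rightarrow> ('r, 'r) module"
  where "regular_module R = \<lparr>carrier = carrier R, monoid.mult = undefined, one = undefined,
    ring.zero = \<zero>\<^bsub>R\<^esub>, ring.add = ring.add R, smult = monoid.mult R\<rparr>"

text \<open>For finite \<open>S\<close> this is the free module on \<open>S\<close>. Fixing the
  values outside \<open>S\<close> makes the pointwise operations satisfy the group laws as
  equalities of functions.\<close>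

definition power_module :: "('r, 'c) ring_scheme \<Rightarrow> 'm set \<Rightarrow> ('r, 'm \<Rightarrow> 'r) module"
  where "power_module R S = \<lparr>carrier = S \<rightarrow>\<^sub>E carrier R, monoid.mult = undefined, one = undefined,
    ring.zero = (\<lambda>s\<in>S. \<zero>\<^bsub>R\<^esub>), ring.add = (\<lambda>a b. \<lambda>s\<in>S. a s \<oplus>\<^bsub>R\<^esub> b s),
    smult = (\<lambda>r a. \<lambda>s\<in>S. r \<otimes>\<^bsub>R\<^esub> a s)\<rparr>"

lemma left_module_power:
  assumes "ring R"
  shows "left_module R (power_module R S)"
proof -
  interpret ring R by fact
  have "abelian_group (power_module R S)"
  proof (rule abelian_groupI)
    show "\<exists>b\<in>carrier (power_module R S). b \<oplus>\<^bsub>power_module R S\<^esub> a = \<zero>\<^bsub>power_module R S\<^esub>"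
      if "a \<in> carrier (power_module R S)" for a
    proof
      show "(\<lambda>s\<in>S. \<ominus>\<^bsub>R\<^esub> a s) \<in> carrier (power_module R S)"
        using that by (auto simp: power_module_def)
    qed (use that in \<open>auto simp: power_module_def PiE_iff l_neg restrict_def fun_eq_iff\<close>)
  qed (auto simp: power_module_def PiE_iff a_ac restrict_def fun_eq_iff extensional_def)
  then show ?thesis
    by (intro left_module.intro left_module_axioms.intro ring_axioms)
      (auto simp: power_module_def PiE_iff restrict_def fun_eq_iff extensional_def l_distr r_distr m_assoc)
qed

text \<open>A finite generating set \<open>S\<close> gives a surjection onto \<open>P\<close> from
  the free module on \<open>S\<close>; projectivity splits it, and the coordinates of the splitting
  are the functionals.\<close>

theorem dual_basis:
  assumes P: "projective R P" and fg: "finitely_generated R P"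
  obtains S \<pi> where "finite S" "S \<subseteq> carrier P"
    "\<And>s. s \<in> S \<Longrightarrow> \<pi> s \<in> mod_hom R P (regular_module R)"
    "\<And>x. x \<in> carrier P \<Longrightarrow> x = (\<Oplus>\<^bsub>P\<^esub>s\<in>S. \<pi> s x \<odot>\<^bsub>P\<^esub> s)"
proof -
  have LM: "left_module R P"
    using P by (simp add: projective_def)
  then interpret P: left_module R P .
  obtain S where S: "finite S" "S \<subseteq> carrier P"
    and gen: "\<And>x. x \<in> carrier P \<Longrightarrow> \<exists>a\<in>S \<rightarrow> carrier R. x = (\<Oplus>\<^bsub>P\<^esub>s\<in>S. a s \<odot>\<^bsub>P\<^esub> s)"
    using fg unfolding finitely_generated_def by blast
  define Q where "Q = power_module R S"
  define g where "g = (\<lambda>a. \<Oplus>\<^bsub>P\<^esub>s\<in>S. a s \<odot>\<^bsub>P\<^esub> s)"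
  have Q: "carrier Q = S \<rightarrow>\<^sub>E carrier R" "a \<oplus>\<^bsub>Q\<^esub> b = (\<lambda>s\<in>S. a s \<oplus>\<^bsub>R\<^esub> b s)" "r \<odot>\<^bsub>Q\<^esub> a = (\<lambda>s\<in>S. r \<otimes>\<^bsub>R\<^esub> a s)"
    for a b r by (simp_all add: Q_def power_module_def)
  have cl: "a s \<odot>\<^bsub>P\<^esub> s \<in> carrier P" "a s \<in> carrier R" "s \<in> carrier P" if "a \<in> carrier Q" "s \<in> S" for a s
    using that S by (auto simp: Q)
  have g: "g \<in> mod_hom R Q P"
    unfolding mod_hom_def
  proof (intro CollectI conjI ballI Pi_I)
    fix a assume a: "a \<in> carrier Q"
    show "g a \<in> carrier P"
      unfolding g_def by (intro P.M.finsum_closed) (auto simp: cl[OF a])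
    show "g (a \<oplus>\<^bsub>Q\<^esub> b) = g a \<oplus>\<^bsub>P\<^esub> g b" if b: "b \<in> carrier Q" for b
    proof -
      have "g (a \<oplus>\<^bsub>Q\<^esub> b) = (\<Oplus>\<^bsub>P\<^esub>s\<in>S. a s \<odot>\<^bsub>P\<^esub> s \<oplus>\<^bsub>P\<^esub> b s \<odot>\<^bsub>P\<^esub> s)"
        unfolding g_def by (rule P.M.finsum_cong') (auto simp: Q(2) P.smult_l_distr cl[OF a] cl[OF b])
      also have "\<dots> = g a \<oplus>\<^bsub>P\<^esub> g b"
        unfolding g_def by (rule P.M.finsum_addf) (auto simp: cl[OF a] cl[OF b])
      finally show ?thesis .
    qed
    show "g (r \<odot>\<^bsub>Q\<^esub> a) = r \<odot>\<^bsub>P\<^esub> g a" if r: "r \<in> carrier R" for r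
    proof -
      have "g (r \<odot>\<^bsub>Q\<^esub> a) = (\<Oplus>\<^bsub>P\<^esub>s\<in>S. r \<odot>\<^bsub>P\<^esub> (a s \<odot>\<^bsub>P\<^esub> s))"
        unfolding g_def by (rule P.M.finsum_cong') (auto simp: Q(3) P.smult_assoc1 r cl[OF a])
      also have "\<dots> = r \<odot>\<^bsub>P\<^esub> g a"
        unfolding g_def by (rule P.smult_finsum[symmetric]) (auto simp: r S cl[OF a])
      finally show ?thesis .
    qed
  qed
  have surj: "(\<lambda>x. x) ` carrier P \<subseteq> g ` carrier Q"
  proof clarify
    fix x assume "x \<in> carrier P"
    then obtain a where a: "a \<in> S \<rightarrow> carrier R" "x = (\<Oplus>\<^bsub>P\<^esub>s\<in>S. a s \<odot>\<^bsub>P\<^esub> s)"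
      using gen by blast
    have "g (restrict a S) = x"
      unfolding a(2) g_def by (rule P.M.finsum_cong') (use a S in auto)
    moreover have "restrict a S \<in> carrier Q"
      using a(1) by (auto simp: Q)
    ultimately show "x \<in> g ` carrier Q" by blast
  qed
  have "(\<lambda>x. x) \<in> mod_hom R P P"
    by (auto simp: mod_hom_def)
  then obtain h where h: "h \<in> mod_hom R P Q" "\<And>x. x \<in> carrier P \<Longrightarrow> g (h x) = x"
    using projective_lift_image[OF P _ LM _ g surj] left_module_power[OF P.R.ring_axioms]
    unfolding Q_def by metis
  have "(\<lambda>x. h x s) \<in> mod_hom R P (regular_module R)" if "s \<in> S" for s
    using h(1) that by (auto simp: mod_hom_def regular_module_def Q Pi_iff PiE_iff)
  moreover have "x = (\<Oplus>\<^bsub>P\<^esub>s\<in>S. h x s \<odot>\<^bsub>P\<^esub> s)" if "x \<in> carrier P" for x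
    using h(2)[OF that] by (simp add: g_def)
  ultimately show thesis
    using that[of S "\<lambda>s x. h x s"] S by blast
qed

section \<open>Tensor products with \<open>l\<^sup>p(G)\<close>\<close>

lemma right_of_left_simps [simp]:
  "carrier (right_of_left G M) = carrier M" "\<zero>\<^bsub>right_of_left G M\<^esub> = \<zero>\<^bsub>M\<^esub>"
  "x \<oplus>\<^bsub>right_of_left G M\<^esub> y = x \<oplus>\<^bsub>M\<^esub> y"
  by (simp_all add: right_of_left_def)

lemma (in group) right_of_left_smult [simp]: "r \<odot>\<^bsub>right_of_left G M\<^esub> x = bar r \<odot>\<^bsub>M\<^esub> x"
  by (simp add: right_of_left_def bar_def)

lemma abelian_group_right_of_left:
  assumes "abelian_group M"
  shows "abelian_group (right_of_left G M)"
proof -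
  interpret abelian_group M by fact
  show ?thesis
  proof (rule abelian_groupI)
    show "\<exists>y\<in>carrier (right_of_left G M). y \<oplus>\<^bsub>right_of_left G M\<^esub> x = \<zero>\<^bsub>right_of_left G M\<^esub>"
      if "x \<in> carrier (right_of_left G M)" for x
      using that by (intro bexI[of _ "\<ominus>\<^bsub>M\<^esub> x"]) (auto simp: l_neg)
  qed (simp_all add: a_ac)
qed

lemma (in group) mod_hom_right_of_left:
  "f \<in> mod_hom \<R> M N \<Longrightarrow> f \<in> mod_hom \<R> (right_of_left G M) (right_of_left G N)"
  by (auto simp: mod_hom_def)

lemma (in group) hom_mult_hom:
  assumes "comm_group H" "f \<in> hom G H" "g \<in> hom G H"
  shows "(\<lambda>x. f x \<otimes>\<^bsub>H\<^esub> g x) \<in> hom G H"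
proof -
  interpret H: comm_group H by fact
  show ?thesis
    using assms(2,3) by (auto simp: hom_def Pi_iff H.m_ac)
qed

lemma (in group) hom_finprod:
  assumes "comm_group H" "finite S" "\<And>s. s \<in> S \<Longrightarrow> f s \<in> hom G H"
  shows "(\<lambda>x. \<Otimes>\<^bsub>H\<^esub>s\<in>S. f s x) \<in> hom G H"
proof -
  interpret H: comm_group H by fact
  have cl: "f s x \<in> carrier H" if "s \<in> S" "x \<in> carrier G" for s x
    using assms(3)[OF that(1)] that(2) by (auto simp: hom_def)
  show ?thesis
  proof (rule homI)
    show "(\<Otimes>\<^bsub>H\<^esub>s\<in>S. f s (x \<otimes> y)) = (\<Otimes>\<^bsub>H\<^esub>s\<in>S. f s x) \<otimes>\<^bsub>H\<^esub> (\<Otimes>\<^bsub>H\<^esub>s\<in>S. f s y)"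
      if xy: "x \<in> carrier G" "y \<in> carrier G" for x y
    proof -
      have "(\<Otimes>\<^bsub>H\<^esub>s\<in>S. f s (x \<otimes> y)) = (\<Otimes>\<^bsub>H\<^esub>s\<in>S. f s x \<otimes>\<^bsub>H\<^esub> f s y)"
        by (rule H.finprod_cong') (use assms(3) xy cl in \<open>auto simp: hom_mult\<close>)
      also have "\<dots> = (\<Otimes>\<^bsub>H\<^esub>s\<in>S. f s x) \<otimes>\<^bsub>H\<^esub> (\<Otimes>\<^bsub>H\<^esub>s\<in>S. f s y)"
        by (rule H.finprod_multf) (use cl xy in auto)
      finally show ?thesis .
    qed
  qed (use cl in auto)
qed

context lp_group
begin

lemma tensor_factors_lp:
  assumes "left_module \<R> M"
  shows "tensor_factors \<R> (right_of_left G M) L"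
proof -
  interpret M: left_module \<R> M by fact
  show ?thesis
    by (intro tensor_factors.intro tensor_factors_axioms.intro abelian_group_lp
        abelian_group_right_of_left M.M.abelian_group_axioms) auto
qed

lemma comm_group_lp: "comm_group (add_monoid L)"
  by (rule abelian_group.a_comm_group[OF abelian_group_lp])

lemma finprod_lp:
  "finite I \<Longrightarrow> u \<in> I \<rightarrow> carrier L \<Longrightarrow> finprod (add_monoid L) u I = (\<lambda>h. \<Sum>i\<in>I. u i h)"
proof (induction I rule: finite_induct)
  case empty
  interpret L: comm_group "add_monoid L" by (rule comm_group_lp)
  show ?case by (rule trans[OF L.finprod_empty]) simp
next
  case (insert i I)
  interpret L: comm_group "add_monoid L" by (rule comm_group_lp)
  have u: "u \<in> I \<rightarrow> carrier (add_monoid L)" "u i \<in> carrier (add_monoid L)"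
    using insert.prems by auto
  have IH: "finprod (add_monoid L) u I = (\<lambda>h. \<Sum>i\<in>I. u i h)"
    using insert.prems by (intro insert.IH) auto
  show ?case
    unfolding L.finprod_insert[OF insert.hyps u] IH using insert.hyps by simp
qed

text \<open>
  The map \<open>x \<otimes> f \<mapsto> \<pi>(x)\<^sup>* f\<close>, where \<open>*\<close> is the involution \<open>g \<mapsto> g\<^sup>-\<^sup>1\<close>, which accounts for turning
  \<open>M\<close> into a right module.
\<close>

definition contraction :: "('g \<Rightarrow>\<^sub>0 int, 'm) module \<Rightarrow> ('m \<Rightarrow> 'g \<Rightarrow>\<^sub>0 int) \<Rightarrow>
    ('m \<times> ('g \<Rightarrow> complex) \<Rightarrow>\<^sub>0 int) set \<Rightarrow> 'g \<Rightarrow> complex"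
  where "contraction M \<pi> = (SOME h. h \<in> hom (lp_tensor p G M) (add_monoid L) \<and>
    (\<forall>x\<in>carrier M. \<forall>f\<in>carrier L. h (pure_tensor \<R> (right_of_left G M) L x f) = bar (\<pi> x) \<odot>\<^bsub>L\<^esub> f))"

lemma contraction:
  assumes M: "left_module \<R> M" and \<pi>: "\<pi> \<in> mod_hom \<R> M (regular_module \<R>)"
  shows "contraction M \<pi> \<in> hom (lp_tensor p G M) (add_monoid L)"
    and "x \<in> carrier M \<Longrightarrow> f \<in> carrier L \<Longrightarrow>
      contraction M \<pi> (pure_tensor \<R> (right_of_left G M) L x f) = bar (\<pi> x) \<odot>\<^bsub>L\<^esub> f"
proof -
  interpret tensor_factors \<R> "right_of_left G M" L
    by (rule tensor_factors_lp[OF M])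
  interpret M: left_module \<R> M by fact
  have \<pi>': "x \<in> carrier M \<Longrightarrow> y \<in> carrier M \<Longrightarrow> \<pi> (x \<oplus>\<^bsub>M\<^esub> y) = \<pi> x + \<pi> y"
      "r \<in> carrier \<R> \<Longrightarrow> x \<in> carrier M \<Longrightarrow> \<pi> (r \<odot>\<^bsub>M\<^esub> x) = r \<otimes>\<^bsub>\<R>\<^esub> \<pi> x" for x y r
    using mod_homD(2,3)[OF \<pi>] by (simp_all add: regular_module_def)
  have \<pi>c: "\<pi> x \<in> carrier \<R>" if "x \<in> carrier M" for x
    using mod_homD(1)[OF \<pi>] that by (simp add: regular_module_def)
  obtain h where "h \<in> hom T (add_monoid L)"
    "\<And>x f. x \<in> carrier (right_of_left G M) \<Longrightarrow> f \<in> carrier L \<Longrightarrow> h (pure x f) = bar (\<pi> x) \<odot>\<^bsub>L\<^esub> f"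
  proof (rule tensor_lift[OF comm_group_lp, of "\<lambda>x f. bar (\<pi> x) \<odot>\<^bsub>L\<^esub> f"])
    \<comment> \<open>The right action multiplies \<open>\<pi> x\<close> on the left by
      \<open>bar r\<close>; the outer \<open>bar\<close> reverses the product and restores
      \<open>r\<close> on the right.\<close>
    show "bar (\<pi> (r \<odot>\<^bsub>right_of_left G M\<^esub> x)) \<odot>\<^bsub>L\<^esub> f = bar (\<pi> x) \<odot>\<^bsub>L\<^esub> (r \<odot>\<^bsub>L\<^esub> f)"
      if "r \<in> carrier \<R>" "x \<in> carrier (right_of_left G M)" "f \<in> carrier L" for r x f
      using that by (simp add: \<pi>' \<pi>c bar_mult lp_smult_assoc)
  qed (auto simp: \<pi>c \<pi>' lp_smult_add lp_smult_right)
  then have "\<exists>h. h \<in> hom T (add_monoid L) \<and>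
    (\<forall>x\<in>carrier M. \<forall>f\<in>carrier L. h (pure x f) = bar (\<pi> x) \<odot>\<^bsub>L\<^esub> f)" by auto
  from someI_ex[OF this, folded contraction_def]
  show "contraction M \<pi> \<in> hom (lp_tensor p G M) (add_monoid L)"
    "x \<in> carrier M \<Longrightarrow> f \<in> carrier L \<Longrightarrow> contraction M \<pi> (pure x f) = bar (\<pi> x) \<odot>\<^bsub>L\<^esub> f"
    by auto
qed

text \<open>Both sides are additive in \<open>c\<close>, so pure tensors suffice. There
  \<open>x\<close> expands in the dual basis, and each coefficient \<open>\<pi> s x\<close> crosses
  the tensor sign as its \<open>bar\<close>, which is the contraction.\<close>

lemma contraction_dual_basis:
  assumes M: "left_module \<R> M" and S: "finite S" "S \<subseteq> carrier M"
    and \<pi>: "\<And>s. s \<in> S \<Longrightarrow> \<pi> s \<in> mod_hom \<R> M (regular_module \<R>)"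
    and sum: "\<And>x. x \<in> carrier M \<Longrightarrow> x = (\<Oplus>\<^bsub>M\<^esub>s\<in>S. \<pi> s x \<odot>\<^bsub>M\<^esub> s)"
    and c: "c \<in> carrier (lp_tensor p G M)"
  shows "c = (\<Otimes>\<^bsub>lp_tensor p G M\<^esub>s\<in>S. pure_tensor \<R> (right_of_left G M) L s (contraction M (\<pi> s) c))"
proof -
  interpret tensor_factors \<R> "right_of_left G M" L
    by (rule tensor_factors_lp[OF M])
  interpret M: left_module \<R> M by fact
  have \<pi>c: "\<pi> s x \<in> carrier \<R>" if "s \<in> S" "x \<in> carrier M" for s x
    using mod_homD(1)[OF \<pi>] that by (simp add: regular_module_def)
  have pure_hom: "(\<lambda>c. pure s (contraction M (\<pi> s) c)) \<in> hom T T" if s: "s \<in> S" for s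
  proof -
    have sM: "s \<in> carrier (right_of_left G M)" using s S by auto
    have cL: "contraction M (\<pi> s) c \<in> carrier L" if "c \<in> carrier T" for c
      using contraction(1)[OF M \<pi>[OF s]] that by (auto simp: hom_def)
    show ?thesis
    proof (rule homI)
      show "pure s (contraction M (\<pi> s) (b \<otimes>\<^bsub>T\<^esub> c)) =
          pure s (contraction M (\<pi> s) b) \<otimes>\<^bsub>T\<^esub> pure s (contraction M (\<pi> s) c)"
        if "b \<in> carrier T" "c \<in> carrier T" for b c
        using pure_add_right[OF sM cL[OF that(1)] cL[OF that(2)]]
          hom_mult[OF contraction(1)[OF M \<pi>[OF s]] that] by simp
    qed (use sM cL in auto)
  qed
  have pure_finsum: "pure (\<Oplus>\<^bsub>M\<^esub>s\<in>A. v s) f = (\<Otimes>\<^bsub>T\<^esub>s\<in>A. pure (v s) f)"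
    if "finite A" "v \<in> A \<rightarrow> carrier M" "f \<in> carrier L" for A v f
    using that
  proof (induction A rule: finite_induct)
    case empty
    then show ?case using pure_zero_left by simp
  next
    case (insert a A)
    then show ?case
      using pure_add_left[of "v a" "finsum M v A" f]
      by (simp add: M.M.finsum_insert T.finprod_insert Pi_iff M.M.finsum_closed)
  qed
  \<comment> \<open>The identity is applied explicitly so that both sides are homomorphisms
    evaluated at \<open>c\<close>.\<close>
  have "(\<lambda>c. c) c = (\<lambda>c. \<Otimes>\<^bsub>T\<^esub>s\<in>S. pure s (contraction M (\<pi> s) c)) c"
  proof (rule tensor_hom_eqI[OF T.is_group _ _ _ c])
    show "(\<lambda>c. c) \<in> hom T T" by (simp add: hom_def)
    show "(\<lambda>c. \<Otimes>\<^bsub>T\<^esub>s\<in>S. pure s (contraction M (\<pi> s) c)) \<in> hom T T"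
      by (intro T.hom_finprod T.comm_group_axioms S pure_hom)
    fix x f assume x: "x \<in> carrier (right_of_left G M)" and f: "f \<in> carrier L"
    have "pure (\<Oplus>\<^bsub>M\<^esub>s\<in>S. \<pi> s x \<odot>\<^bsub>M\<^esub> s) f = (\<Otimes>\<^bsub>T\<^esub>s\<in>S. pure (\<pi> s x \<odot>\<^bsub>M\<^esub> s) f)"
      by (rule pure_finsum) (use S x f \<pi>c in auto)
    also have "\<dots> = (\<Otimes>\<^bsub>T\<^esub>s\<in>S. pure s (contraction M (\<pi> s) (pure x f)))"
    proof (rule T.finprod_cong'[OF refl])
      show "(\<lambda>s. pure s (contraction M (\<pi> s) (pure x f))) \<in> S \<rightarrow> carrier T"
        using x f by (intro Pi_I hom_in_carrier[OF pure_hom] pure_closed)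
      show "pure (\<pi> s x \<odot>\<^bsub>M\<^esub> s) f = pure s (contraction M (\<pi> s) (pure x f))" if s: "s \<in> S" for s
        using pure_balanced[of "bar (\<pi> s x)" s f] s S x f \<pi>c[OF s, of x]
        by (auto simp: contraction(2)[OF M \<pi>[OF s]])
    qed
    finally show "pure x f = (\<Otimes>\<^bsub>T\<^esub>s\<in>S. pure s (contraction M (\<pi> s) (pure x f)))"
      using sum[of x] x by simp
  qed
  then show ?thesis .
qed

section \<open>Continuous maps into l^p(G)\<close>

lemma continuous_map_lp_iff:
  "continuous_map X (lp_topology p G) u \<longleftrightarrow> (\<forall>x\<in>topspace X. u x \<in> carrier L) \<and>
     (\<forall>x\<in>topspace X. \<forall>e>0. \<exists>U. openin X U \<and> x \<in> U \<and> (\<forall>y\<in>U. lp_norm p G (\<lambda>h. u x h - u y h) < e))"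
  (is "_ \<longleftrightarrow> ?closed \<and> ?continuous")
proof -
  have "continuous_map X (lp_topology p G) u \<Longrightarrow> ?closed"
    using continuous_map_image_subset_topspace[of X "lp_topology p G" u] by auto
  moreover have "continuous_map X (lp_topology p G) u \<longleftrightarrow> ?continuous" if closed: ?closed
  proof -
    have ball: "(\<forall>y\<in>U. u y \<in> lp.mball (u x) e) \<longleftrightarrow> (\<forall>y\<in>U. lp_norm p G (\<lambda>h. u x h - u y h) < e)"
      if "x \<in> topspace X" "openin X U" for x U e
      using closed that openin_subset[OF that(2)] by (auto simp: lp.in_mball subset_iff)
    show ?thesis
      unfolding lp_topology lp.continuous_map_to_metric by (simp only: ball cong: ball_cong conj_cong)
  qed
  ultimately show ?thesis by blast
qed

lemma continuous_map_lp_diff: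
  assumes u: "continuous_map X (lp_topology p G) u" and v: "continuous_map X (lp_topology p G) v"
  shows "continuous_map X (lp_topology p G) (\<lambda>x h. u x h - v x h)"
  unfolding continuous_map_lp_iff
proof (intro conjI ballI allI impI)
  have uv: "u x \<in> carrier L" "v x \<in> carrier L" if "x \<in> topspace X" for x
    using u v that by (auto simp: continuous_map_lp_iff)
  then show "(\<lambda>h. u x h - v x h) \<in> carrier L" if "x \<in> topspace X" for x
    using that by auto
  fix x and e :: real assume x: "x \<in> topspace X" and e: "0 < e"
  obtain U where U: "openin X U" "x \<in> U" "\<And>y. y \<in> U \<Longrightarrow> lp_norm p G (\<lambda>h. u x h - u y h) < e / 2"
    using u x e unfolding continuous_map_lp_iff by (meson half_gt_zero)
  obtain V where V: "openin X V" "x \<in> V" "\<And>y. y \<in> V \<Longrightarrow> lp_norm p G (\<lambda>h. v x h - v y h) < e / 2"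
    using v x e unfolding continuous_map_lp_iff by (meson half_gt_zero)
  have "lp_norm p G (\<lambda>h. u x h - v x h - (u y h - v y h)) < e" if y: "y \<in> U \<inter> V" for y
  proof -
    have "y \<in> topspace X" using y openin_subset[OF U(1)] by auto
    then have "lp_norm p G (\<lambda>h. (u x h - u y h) + (-1) * (v x h - v y h)) \<le>
        lp_norm p G (\<lambda>h. u x h - u y h) + lp_norm p G (\<lambda>h. (-1) * (v x h - v y h))"
      using uv x by (intro lp_norm_add lp_cmult lp_diff) auto
    also have "\<dots> < e"
      unfolding lp_norm_cmult using U(3)[of y] V(3)[of y] y by simp
    finally show ?thesis by (simp add: algebra_simps)
  qed
  with U V show "\<exists>W. openin X W \<and> x \<in> W \<and>
      (\<forall>y\<in>W. lp_norm p G (\<lambda>h. u x h - v x h - (u y h - v y h)) < e)"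
    by (intro exI[of _ "U \<inter> V"]) auto
qed

lemma continuous_map_lp_zero: "continuous_map X (lp_topology p G) (\<lambda>x h. 0)"
  by (simp add: continuous_map_const)

text \<open>Group elements act by isometries, and differences of continuous maps are
  continuous.\<close>

lemma continuous_map_lp_smult:
  assumes r: "r \<in> carrier \<R>" and u: "continuous_map X (lp_topology p G) u"
  shows "continuous_map X (lp_topology p G) (\<lambda>x. r \<odot>\<^bsub>L\<^esub> u x)"
  using r
proof (induction r rule: group_ring_induct)
  case (of g)
  have uL: "u x \<in> carrier L" if "x \<in> topspace X" for x
    using u that by (auto simp: continuous_map_lp_iff)
  have "lp_norm p G (\<lambda>h. translate g (u x) h - translate g (u y) h) = lp_norm p G (\<lambda>h. u x h - u y h)"
    if "x \<in> topspace X" "y \<in> topspace X" for x y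
    using lp_norm_translate[of "\<lambda>h. u x h - u y h" g] uL that of by (auto simp: translate_diff)
  moreover have "openin X U \<Longrightarrow> y \<in> U \<Longrightarrow> y \<in> topspace X" for U y
    using openin_subset by blast
  ultimately show ?case
    using u of unfolding continuous_map_lp_iff by (simp add: Pi_iff) metis
qed (auto simp: lp_smult_diff intro: continuous_map_lp_diff continuous_map_lp_zero)

lemma continuous_map_lp_sum:
  "(\<And>i. i \<in> I \<Longrightarrow> continuous_map X (lp_topology p G) (u i)) \<Longrightarrow>
    continuous_map X (lp_topology p G) (\<lambda>x h. \<Sum>i\<in>I. u i x h)"
proof (induction I rule: infinite_finite_induct)
  case (insert i I)
  \<comment> \<open>Addition is expressed through two subtractions, whose continuity is already
    established.\<close>
  then have "continuous_map X (lp_topology p G) (\<lambda>x h. u i x h - (0 - (\<Sum>i\<in>I. u i x h)))"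
    by (intro continuous_map_lp_diff continuous_map_lp_zero) auto
  with insert show ?case by simp
qed (simp_all add: continuous_map_lp_zero)

section \<open>The topology of the tensor product with l^p(G)\<close>

lemma tensor_sum_pure_sum:
  assumes "left_module \<R> M"
  shows "tensor_sum p G M = tensor_factors.pure_sum \<R> (right_of_left G M) L"
  by (simp add: fun_eq_iff tensor_sum_def tensor_factors.pure_sum_def[OF tensor_factors_lp[OF assms]])

lemma topspace_lp_tensor [simp]:
  assumes "left_module \<R> M"
  shows "topspace (lp_tensor_topology p G M) = carrier (lp_tensor p G M)"
proof (rule antisym)
  interpret tensor_factors \<R> "right_of_left G M" L
    by (rule tensor_factors_lp[OF assms])
  show "topspace (lp_tensor_topology p G M) \<subseteq> carrier T"
    unfolding topspace_def openin_lp_tensor_topology by (auto simp: lp_tensor_open_def)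
  have "lp_tensor_open p G M (carrier T)"
    unfolding lp_tensor_open_def
  proof (intro conjI allI ballI order_refl)
    fix m :: nat and x assume x: "x \<in> {..<m} \<rightarrow> carrier M"
    have "{f \<in> topspace (product_topology (\<lambda>j. lp_topology p G) {..<m}). tensor_sum p G M m x f \<in> carrier T} =
        topspace (product_topology (\<lambda>j. lp_topology p G) {..<m})"
      using pure_sum_closed[of x m] x by (auto simp: tensor_sum_pure_sum[OF assms])
    then show "openin (product_topology (\<lambda>j. lp_topology p G) {..<m})
        {f \<in> topspace (product_topology (\<lambda>j. lp_topology p G) {..<m}). tensor_sum p G M m x f \<in> carrier T}"
      by (simp only: openin_topspace)
  qed
  then show "carrier T \<subseteq> topspace (lp_tensor_topology p G M)"
    using openin_subset[of "lp_tensor_topology p G M"] by (simp add: openin_lp_tensor_topology)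
qed

text \<open>Openness of the complement is tested along every map from a finite power of l^p(G).
  Composed with such a map, the contraction becomes a finite sum of group ring actions on the
  coordinates, which is continuous.\<close>

lemma closedin_contraction_kernel:
  assumes M: "left_module \<R> M" and \<pi>: "\<pi> \<in> mod_hom \<R> M (regular_module \<R>)"
  shows "closedin (lp_tensor_topology p G M) {c \<in> carrier (lp_tensor p G M). contraction M \<pi> c = (\<lambda>h. 0)}"
proof -
  interpret tensor_factors \<R> "right_of_left G M" L
    by (rule tensor_factors_lp[OF M])
  have "lp_tensor_open p G M {c \<in> carrier T. contraction M \<pi> c \<noteq> (\<lambda>h. 0)}"
    unfolding lp_tensor_open_def
  proof (intro conjI allI ballI)
    fix m :: nat and x assume x: "x \<in> {..<m} \<rightarrow> carrier M"
    define X where "X = product_topology (\<lambda>j. lp_topology p G) {..<m}"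
    define u where "u = (\<lambda>f h. \<Sum>j<m. (bar (\<pi> (x j)) \<odot>\<^bsub>L\<^esub> f j) h)"
    have X: "topspace X = {..<m} \<rightarrow>\<^sub>E carrier L" by (simp add: X_def)
    have \<pi>x: "bar (\<pi> (x j)) \<in> carrier \<R>" if "j < m" for j
      using mod_homD(1)[OF \<pi>, of "x j"] x that by (auto simp: regular_module_def)
    have u: "continuous_map X (lp_topology p G) u"
      unfolding u_def X_def
      by (intro continuous_map_lp_sum continuous_map_lp_smult continuous_map_product_projection) (use \<pi>x in auto)
    have "contraction M \<pi> (tensor_sum p G M m x f) = u f" "tensor_sum p G M m x f \<in> carrier T"
      if f: "f \<in> topspace X" for f
    proof -
      have fL: "f \<in> {..<m} \<rightarrow> carrier L" using f by (auto simp: X)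
      then show "tensor_sum p G M m x f \<in> carrier T"
        using x pure_sum_closed[of x m f] by (simp add: tensor_sum_pure_sum[OF M])
      have "contraction M \<pi> (tensor_sum p G M m x f) =
          finprod (add_monoid L) (\<lambda>j. contraction M \<pi> (pure (x j) (f j))) {..<m}"
        unfolding tensor_sum_pure_sum[OF M]
        by (rule hom_pure_sum[OF comm_group_lp contraction(1)[OF M \<pi>]]) (use x fL in auto)
      also have "\<dots> = (\<lambda>h. \<Sum>j<m. contraction M \<pi> (pure (x j) (f j)) h)"
        by (rule finprod_lp) (use x fL \<pi>x in \<open>auto simp: contraction(2)[OF M \<pi>] Pi_iff\<close>)
      also have "\<dots> = u f"
        unfolding u_def by (intro ext sum.cong) (use x fL in \<open>auto simp: contraction(2)[OF M \<pi>] Pi_iff\<close>)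
      finally show "contraction M \<pi> (tensor_sum p G M m x f) = u f" .
    qed
    then have "{f \<in> topspace X. tensor_sum p G M m x f \<in> {c \<in> carrier T. contraction M \<pi> c \<noteq> (\<lambda>h. 0)}} =
        {f \<in> topspace X. u f \<in> topspace (lp_topology p G) - {\<lambda>h. 0}}"
      using u by (auto simp: continuous_map_lp_iff)
    then show "openin X {f \<in> topspace X. tensor_sum p G M m x f \<in> {c \<in> carrier T. contraction M \<pi> c \<noteq> (\<lambda>h. 0)}}"
      using openin_continuous_map_preimage[OF u openin_diff[OF openin_topspace closedin_lp_singleton[OF lp_zero]]]
      by simp
  qed auto
  moreover have "{c \<in> carrier T. contraction M \<pi> c \<noteq> (\<lambda>h. 0)} =
      carrier T - {c \<in> carrier T. contraction M \<pi> c = (\<lambda>h. 0)}" by auto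
  ultimately show ?thesis
    by (auto simp: closedin_def openin_lp_tensor_topology M)
qed

end

section \<open>Reduced homology\<close>

lemmas hom_comp = Group.hom_compose[unfolded o_def]

context lp_group
begin

lemma group_lp: "group (add_monoid L)"
  using comm_group_lp by (rule comm_group.axioms(2))


text \<open>Complex scalars commute with the group ring action on l^p(G), so scaling the second
  factor respects the balancing relations. This is how division by \<open>N\<close> reaches the
  tensor product.\<close>

lemma tensor_scale:
  assumes "left_module \<R> M"
  obtains \<sigma> where "\<sigma> \<in> hom (lp_tensor p G M) (lp_tensor p G M)"
    "\<And>x f. x \<in> carrier M \<Longrightarrow> f \<in> carrier L \<Longrightarrow>
      \<sigma> (pure_tensor \<R> (right_of_left G M) L x f) = pure_tensor \<R> (right_of_left G M) L x (\<lambda>h. a * f h)"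
proof -
  interpret tensor_factors \<R> "right_of_left G M" L
    by (rule tensor_factors_lp[OF assms])
  have add: "pure x (\<lambda>h. a * (f h + f' h)) = pure x (\<lambda>h. a * f h) \<otimes>\<^bsub>T\<^esub> pure x (\<lambda>h. a * f' h)"
    if "x \<in> carrier M" "f \<in> carrier L" "f' \<in> carrier L" for x f f'
    using pure_add_right[of x "\<lambda>h. a * f h" "\<lambda>h. a * f' h"] that by (simp add: distrib_left)
  have balanced: "pure (bar r \<odot>\<^bsub>M\<^esub> x) (\<lambda>h. a * f h) = pure x (\<lambda>h. a * (r \<odot>\<^bsub>L\<^esub> f) h)"
    if "r \<in> carrier \<R>" "x \<in> carrier M" "f \<in> carrier L" for r x f
    using pure_balanced[of r x "\<lambda>h. a * f h"] that by (simp add: lp_smult_right)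
  obtain \<sigma> where "\<sigma> \<in> hom T T"
    "\<And>x f. x \<in> carrier (right_of_left G M) \<Longrightarrow> f \<in> carrier L \<Longrightarrow> \<sigma> (pure x f) = pure x (\<lambda>h. a * f h)"
    by (rule tensor_lift[OF T.comm_group_axioms, of "\<lambda>x f. pure x (\<lambda>h. a * f h)"])
      (simp_all add: lp_cmult pure_add_left[simplified] add balanced)
  with that show thesis by simp
qed

lemma lp_tensor_map_hom:
  assumes "left_module \<R> M" "left_module \<R> N" "\<phi> \<in> mod_hom \<R> M N"
  shows "tensor_map \<R> (right_of_left G M) (right_of_left G N) L \<phi> \<in> hom (lp_tensor p G M) (lp_tensor p G N)"
    and "x \<in> carrier M \<Longrightarrow> f \<in> carrier L \<Longrightarrow>
      tensor_map \<R> (right_of_left G M) (right_of_left G N) L \<phi> (pure_tensor \<R> (right_of_left G M) L x f) =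
      pure_tensor \<R> (right_of_left G N) L (\<phi> x) f"
  using tensor_map_hom[OF tensor_factors_lp[OF assms(1)] tensor_factors_lp[OF assms(2)]
      mod_hom_right_of_left[OF assms(3)]] by simp_all

end

section \<open>The chain complex of tensor products\<close>

context lp_resolution
begin

abbreviation "Tn i \<equiv> lp_tensor p G (F i)"
abbreviation "pt i \<equiv> pure_tensor \<R> (right_of_left G (F i)) L"
abbreviation "tm i j \<equiv> tensor_map \<R> (right_of_left G (F i)) (right_of_left G (F j)) L"

sublocale tensor: tensor_factors \<R> "right_of_left G (F i)" L for i
  by (rule tensor_factors_lp[OF F.left_module_axioms])

lemmas tm_hom = lp_tensor_map_hom(1)[OF F.left_module_axioms F.left_module_axioms]
lemmas tm_pure = lp_tensor_map_hom(2)[OF F.left_module_axioms F.left_module_axioms]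

lemma lp_boundary_Suc: "lp_boundary p G F d (Suc i) = tm (Suc i) i (d (Suc i))"
  by (simp add: lp_boundary_def)

lemma lp_boundary_hom: "lp_boundary p G F d i \<in> hom (Tn i) (Tn (i - 1))"
proof (cases i)
  case 0
  then show ?thesis by (simp add: lp_boundary_def hom_def)
next
  case (Suc j)
  then show ?thesis using tm_hom[OF d_hom[of j]] by (simp add: lp_boundary_Suc)
qed

lemma lp_boundary_boundary:
  assumes "b \<in> carrier (Tn (Suc i))"
  shows "lp_boundary p G F d i (lp_boundary p G F d (Suc i) b) = \<one>\<^bsub>Tn (i - 1)\<^esub>"
proof (cases i)
  case 0
  then show ?thesis by (simp add: lp_boundary_def)
next
  case (Suc j)
  have dd: "(\<lambda>b. tm (Suc j) j (d (Suc j)) (tm (Suc (Suc j)) (Suc j) (d (Suc (Suc j))) b)) \<in> hom (Tn (Suc (Suc j))) (Tn j)"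
    by (rule hom_comp[OF tm_hom[OF d_hom] tm_hom[OF d_hom]])
  have "(\<lambda>b. \<one>\<^bsub>Tn j\<^esub>) \<in> hom (Tn (Suc (Suc j))) (Tn j)"
    by (simp add: hom_def)
  from tensor.tensor_hom_eqI[OF tensor.T.is_group dd this, of b]
  have "tm (Suc j) j (d (Suc j)) (tm (Suc (Suc j)) (Suc j) (d (Suc (Suc j))) b) = \<one>\<^bsub>Tn j\<^esub>"
    using assms Suc by (simp add: tm_pure[OF d_hom] d_d tensor.pure_zero_left[simplified])
  with Suc show ?thesis by (simp add: lp_boundary_Suc)
qed

lemma lp_boundary_image_subset:
  "lp_boundary p G F d (Suc i) ` carrier (Tn (Suc i)) \<subseteq> kernel (Tn i) (Tn (i - 1)) (lp_boundary p G F d i)"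
  using hom_carrier[OF lp_boundary_hom[of "Suc i"]] by (auto simp: kernel_def lp_boundary_boundary)

text \<open>
  By the dual basis of \<open>F\<^sub>i\<close>, contractions detect zero in \<open>F\<^sub>i \<otimes> l\<^sup>p(G)\<close>; they are continuous, so the
  kernel of the boundary map is closed.
\<close>

lemma lp_boundary_kernel_contraction:
  assumes fg: "finitely_generated \<R> (F i)"
  obtains S :: "'m set" and \<pi> where "\<And>s. s \<in> S \<Longrightarrow> \<pi> s \<in> mod_hom \<R> (F (Suc i)) (regular_module \<R>)"
    "\<And>c. c \<in> carrier (Tn (Suc i)) \<Longrightarrow>
      lp_boundary p G F d (Suc i) c = \<one>\<^bsub>Tn i\<^esub> \<longleftrightarrow> (\<forall>s\<in>S. contraction (F (Suc i)) (\<pi> s) c = (\<lambda>h. 0))"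
proof -
  obtain S \<pi> where S: "finite S" "S \<subseteq> carrier (F i)"
    and \<pi>: "\<And>s. s \<in> S \<Longrightarrow> \<pi> s \<in> mod_hom \<R> (F i) (regular_module \<R>)"
    and sum: "\<And>x. x \<in> carrier (F i) \<Longrightarrow> x = (\<Oplus>\<^bsub>F i\<^esub>s\<in>S. \<pi> s x \<odot>\<^bsub>F i\<^esub> s)"
    by (rule dual_basis[OF projective_F fg]) (rule that)
  have \<pi>d: "(\<lambda>x. \<pi> s (d (Suc i) x)) \<in> mod_hom \<R> (F (Suc i)) (regular_module \<R>)" if "s \<in> S" for s
    by (rule mod_hom_comp[OF d_hom \<pi>[OF that]])
  note contr = contraction[OF F.left_module_axioms]
  \<comment> \<open>Absorbing \<open>d\<close> into the functional turns the vanishing of the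
    boundary of \<open>c\<close> into conditions on \<open>c\<close> itself, in the topology of
    \<open>F (Suc i)\<close> tensored with l^p(G).\<close>
  have eq: "contraction (F i) (\<pi> s) (tm (Suc i) i (d (Suc i)) c) =
      contraction (F (Suc i)) (\<lambda>x. \<pi> s (d (Suc i) x)) c" if s: "s \<in> S" and c: "c \<in> carrier (Tn (Suc i))" for s c
  proof -
    have "(\<lambda>c. contraction (F i) (\<pi> s) (tm (Suc i) i (d (Suc i)) c)) \<in> hom (Tn (Suc i)) (add_monoid L)"
      by (rule hom_comp[OF tm_hom[OF d_hom] contr(1)[OF \<pi>[OF s]]])
    from tensor.tensor_hom_eqI[OF group_lp this contr(1)[OF \<pi>d[OF s]] _ c]
    show ?thesis
      by (simp add: tm_pure[OF d_hom] contr(2)[OF \<pi>[OF s]] contr(2)[OF \<pi>d[OF s]])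
  qed
  have "lp_boundary p G F d (Suc i) c = \<one>\<^bsub>Tn i\<^esub> \<longleftrightarrow>
      (\<forall>s\<in>S. contraction (F (Suc i)) (\<lambda>x. \<pi> s (d (Suc i) x)) c = (\<lambda>h. 0))"
    if c: "c \<in> carrier (Tn (Suc i))" for c
  proof -
    define b where "b = tm (Suc i) i (d (Suc i)) c"
    have b: "b \<in> carrier (Tn i)"
      using hom_in_carrier[OF tm_hom[OF d_hom] c] by (simp add: b_def)
    have "b = \<one>\<^bsub>Tn i\<^esub> \<longleftrightarrow> (\<forall>s\<in>S. contraction (F i) (\<pi> s) b = (\<lambda>h. 0))"
    proof
      assume "b = \<one>\<^bsub>Tn i\<^esub>"
      then show "\<forall>s\<in>S. contraction (F i) (\<pi> s) b = (\<lambda>h. 0)"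
        using hom_one[OF contr(1)[OF \<pi>] tensor.T.is_group group_lp] by simp
    next
      assume zero: "\<forall>s\<in>S. contraction (F i) (\<pi> s) b = (\<lambda>h. 0)"
      have "b = (\<Otimes>\<^bsub>Tn i\<^esub>s\<in>S. pt i s (contraction (F i) (\<pi> s) b))"
        by (rule contraction_dual_basis[OF F.left_module_axioms S \<pi> sum b])
      also have "\<dots> = (\<Otimes>\<^bsub>Tn i\<^esub>s\<in>S. \<one>\<^bsub>Tn i\<^esub>)"
        by (rule tensor.T.finprod_cong') (use zero S tensor.pure_zero_right[of _ i] in auto)
      also have "\<dots> = \<one>\<^bsub>Tn i\<^esub>" by (rule tensor.T.finprod_one_eqI) simp
      finally show "b = \<one>\<^bsub>Tn i\<^esub>" .
    qed
    then show ?thesis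
      by (simp add: lp_boundary_Suc b_def eq[OF _ c])
  qed
  with \<pi>d that[of S "\<lambda>s x. \<pi> s (d (Suc i) x)"] show thesis by blast
qed

lemma closure_boundaries_subset:
  assumes fg: "i \<noteq> 0 \<Longrightarrow> finitely_generated \<R> (F (i - 1))"
  shows "lp_tensor_topology p G (F i) closure_of (lp_boundary p G F d (Suc i) ` carrier (Tn (Suc i))) \<subseteq>
    kernel (Tn i) (Tn (i - 1)) (lp_boundary p G F d i)"
proof (cases i)
  case 0
  have "kernel (Tn 0) (Tn 0) (lp_boundary p G F d 0) = carrier (Tn 0)"
    by (auto simp: kernel_def lp_boundary_def)
  then show ?thesis
    using closure_of_subset_topspace[of "lp_tensor_topology p G (F i)"] 0
    by (simp add: topspace_lp_tensor[OF F.left_module_axioms])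
next
  case (Suc j)
  obtain S :: "'m set" and \<pi> where \<pi>: "\<And>s. s \<in> S \<Longrightarrow> \<pi> s \<in> mod_hom \<R> (F (Suc j)) (regular_module \<R>)"
    and ker: "\<And>c. c \<in> carrier (Tn (Suc j)) \<Longrightarrow>
      lp_boundary p G F d (Suc j) c = \<one>\<^bsub>Tn j\<^esub> \<longleftrightarrow> (\<forall>s\<in>S. contraction (F (Suc j)) (\<pi> s) c = (\<lambda>h. 0))"
    by (rule lp_boundary_kernel_contraction[of j]) (use fg Suc in simp, rule that)
  have sub: "lp_tensor_topology p G (F (Suc j)) closure_of (lp_boundary p G F d (Suc (Suc j)) ` carrier (Tn (Suc (Suc j)))) \<subseteq>
      {c \<in> carrier (Tn (Suc j)). contraction (F (Suc j)) (\<pi> s) c = (\<lambda>h. 0)}" if s: "s \<in> S" for s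
  proof (rule closure_of_minimal[OF _ closedin_contraction_kernel[OF F.left_module_axioms \<pi>[OF s]]])
    show "lp_boundary p G F d (Suc (Suc j)) ` carrier (Tn (Suc (Suc j))) \<subseteq>
        {c \<in> carrier (Tn (Suc j)). contraction (F (Suc j)) (\<pi> s) c = (\<lambda>h. 0)}"
      using lp_boundary_image_subset[of "Suc j"] ker s by (auto simp: kernel_def)
  qed
  have "lp_tensor_topology p G (F (Suc j)) closure_of X \<subseteq> carrier (Tn (Suc j))" for X
    using closure_of_subset_topspace[of "lp_tensor_topology p G (F (Suc j))"]
    by (simp add: topspace_lp_tensor[OF F.left_module_axioms])
  with sub show ?thesis
    unfolding Suc kernel_def by (auto simp: ker subset_iff)
qed

text \<open>
  The factor \<open>1/N\<close> acts on \<open>l\<^sup>p(G)\<close> but not on \<open>F\<^sub>i\<close>: first \<open>1 \<otimes> 1/N\<close> is applied to the cycle, then the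
  null-homotopic multiplication by \<open>r \<otimes> 1\<close> on the first factor, where \<open>r\<close> is built from the \<open>z\<^sub>k\<^sup>-\<^sup>1\<close>.
\<close>

lemma lp_cycle_averaging:
  assumes c: "c \<in> kernel (Tn i) (Tn (i - 1)) (lp_boundary p G F d i)"
    and x: "x \<in> {..<m} \<rightarrow> carrier (F i)" and f: "f \<in> {..<m} \<rightarrow> carrier L"
    and eq: "c = tensor.pure_sum i m x f"
  shows "tensor.pure_sum i m x (\<lambda>j h. 1 / of_nat N * (averaging_element z N \<odot>\<^bsub>L\<^esub> f j) h)
    \<in> lp_boundary p G F d (Suc i) ` carrier (Tn (Suc i))"
proof -
  \<comment> \<open>Inverses compensate the \<open>bar\<close> picked up on crossing the tensor
    sign: \<open>r\<close> on the first factor then acts on the second as the averaging element of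
    \<open>z\<close> itself.\<close>
  define w where "w = (\<lambda>k. inv (z k))"
  have w: "range w \<subseteq> center G"
    using center_z by (auto simp: w_def intro: inv_center)
  define r where "r = averaging_element w N"
  have wG: "range w \<subseteq> carrier G" using w by (auto simp: center_def)
  then have rR: "r \<in> carrier \<R>" by (auto simp: r_def)
  have r_bar: "r = bar (averaging_element z N)"
    by (simp add: r_def w_def bar_averaging_element)
  obtain s t where s: "s \<in> mod_hom \<R> (F i) (F (Suc i))" and t: "t \<in> mod_hom \<R> (F (i - 1)) (F i)"
    and st: "\<And>x. x \<in> carrier (F i) \<Longrightarrow> r \<odot>\<^bsub>F i\<^esub> x =
      d (Suc i) (s x) \<oplus>\<^bsub>F i\<^esub> (if i = 0 then \<zero>\<^bsub>F i\<^esub> else t (d i x))"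
    using averaging_null_homotopic[OF w] unfolding r_def by blast
  note s' = mod_homD[OF s] and t' = mod_homD[OF t]
  have r_hom: "(\<lambda>x. r \<odot>\<^bsub>F i\<^esub> x) \<in> mod_hom \<R> (F i) (F i)"
    using rR averaging_element_central[OF w] by (intro F.smult_hom) (auto simp: r_def)
  obtain \<sigma> where \<sigma>: "\<sigma> \<in> hom (Tn i) (Tn i)"
    "\<And>x f. x \<in> carrier (F i) \<Longrightarrow> f \<in> carrier L \<Longrightarrow> \<sigma> (pt i x f) = pt i x (\<lambda>h. 1 / of_nat N * f h)"
    by (rule tensor_scale[OF F.left_module_axioms, where a = "1 / of_nat N"]) (rule that)
  obtain \<sigma>' where \<sigma>': "\<sigma>' \<in> hom (Tn (i - 1)) (Tn (i - 1))"
    "\<And>x f. x \<in> carrier (F (i - 1)) \<Longrightarrow> f \<in> carrier L \<Longrightarrow> \<sigma>' (pt (i - 1) x f) = pt (i - 1) x (\<lambda>h. 1 / of_nat N * f h)"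
    by (rule tensor_scale[OF F.left_module_axioms, where a = "1 / of_nat N"]) (rule that)
  have cT: "c \<in> carrier (Tn i)" and c1: "lp_boundary p G F d i c = \<one>\<^bsub>Tn (i - 1)\<^esub>"
    using c by (auto simp: kernel_def)
  have boundary_pure: "lp_boundary p G F d i (pt i y g) = pt (i - 1) (d i y) g \<and> d i y \<in> carrier (F (i - 1))"
    if "i \<noteq> 0" "y \<in> carrier (F i)" "g \<in> carrier L" for y g
    using that by (cases i) (auto simp: lp_boundary_Suc tm_pure[OF d_hom])
  \<comment> \<open>Scaling the second factor commutes with the boundary, which acts on the first,
    so the scaled element is again a cycle.\<close>
  have cycle: "lp_boundary p G F d i (\<sigma> c) = \<one>\<^bsub>Tn (i - 1)\<^esub>"
  proof (cases "i = 0")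
    case True
    then show ?thesis by (simp add: lp_boundary_def)
  next
    case False
    have "lp_boundary p G F d i (\<sigma> c) = \<sigma>' (lp_boundary p G F d i c)"
    proof (rule tensor.tensor_hom_eqI[OF tensor.T.is_group hom_comp[OF \<sigma>(1) lp_boundary_hom]
          hom_comp[OF lp_boundary_hom \<sigma>'(1)] _ cT])
      fix y g assume "y \<in> carrier (right_of_left G (F i))" and g: "g \<in> carrier L"
      then have y: "y \<in> carrier (F i)" by simp
      show "lp_boundary p G F d i (\<sigma> (pt i y g)) = \<sigma>' (lp_boundary p G F d i (pt i y g))"
        using boundary_pure[OF False y g] boundary_pure[OF False y lp_cmult[OF g]]
        unfolding \<sigma>(2)[OF y g] by (metis \<sigma>'(2) g)
    qed
    then show ?thesis
      using hom_one[OF \<sigma>'(1) tensor.T.is_group tensor.T.is_group] by (simp add: c1)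
  qed
  \<comment> \<open>The null-homotopy tensored with l^p(G). Both sides are homomorphisms, so it is
    enough to compare them on pure tensors, where additivity in the first factor splits
    \<open>r y\<close>.\<close>
  have split: "tm i i (\<lambda>x. r \<odot>\<^bsub>F i\<^esub> x) b = lp_boundary p G F d (Suc i) (tm i (Suc i) s b) \<otimes>\<^bsub>Tn i\<^esub>
      (if i = 0 then \<one>\<^bsub>Tn i\<^esub> else tm (i - 1) i t (lp_boundary p G F d i b))" (is "?A b = ?B b")
    if b: "b \<in> carrier (Tn i)" for b
  proof -
    have B1: "(\<lambda>b. lp_boundary p G F d (Suc i) (tm i (Suc i) s b)) \<in> hom (Tn i) (Tn i)"
      using hom_comp[OF tm_hom[OF s] lp_boundary_hom[of "Suc i"]] by simp
    have B2: "(\<lambda>b. if i = 0 then \<one>\<^bsub>Tn i\<^esub> else tm (i - 1) i t (lp_boundary p G F d i b)) \<in> hom (Tn i) (Tn i)"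
    proof (cases "i = 0")
      case True
      then show ?thesis by (simp add: hom_def)
    next
      case False
      show ?thesis
        unfolding if_not_P[OF False] by (rule hom_comp[OF lp_boundary_hom tm_hom[OF t]])
    qed
    show ?thesis
    proof (rule tensor.tensor_hom_eqI[OF tensor.T.is_group tm_hom[OF r_hom]
          group.hom_mult_hom[OF tensor.T.is_group tensor.T.comm_group_axioms B1 B2] _ b])
      fix y g assume "y \<in> carrier (right_of_left G (F i))" and g: "g \<in> carrier L"
      then have y: "y \<in> carrier (F i)" by simp
      have sy: "s y \<in> carrier (F (Suc i))" by (rule s'(1)[OF y])
      have 1: "?A (pt i y g) = pt i (r \<odot>\<^bsub>F i\<^esub> y) g"
        by (rule tm_pure[OF r_hom y g])
      have 2: "lp_boundary p G F d (Suc i) (tm i (Suc i) s (pt i y g)) = pt i (d (Suc i) (s y)) g"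
        unfolding tm_pure[OF s y g] lp_boundary_Suc by (rule tm_pure[OF d_hom sy g])
      show "?A (pt i y g) = ?B (pt i y g)"
      proof (cases "i = 0")
        case True
        have "r \<odot>\<^bsub>F i\<^esub> y = d (Suc i) (s y)"
          using st[OF y] sy unfolding if_P[OF True] by simp
        then show ?thesis
          unfolding 1 2 if_P[OF True] using sy g by simp
      next
        case False
        then have dy: "d i y \<in> carrier (F (i - 1))" and bp: "lp_boundary p G F d i (pt i y g) = pt (i - 1) (d i y) g"
          using boundary_pure[OF False y g] by auto
        have "t (d i y) \<in> carrier (F i)" by (rule t'(1)[OF dy])
        then show ?thesis
          unfolding 1 2 if_not_P[OF False] bp tm_pure[OF t dy g] st[OF y]
          using tensor.pure_add_left[of "d (Suc i) (s y)" i "t (d i y)" g] g sy by simp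
      qed
    qed
  qed
  have \<sigma>c: "\<sigma> c \<in> carrier (Tn i)"
    by (rule hom_in_carrier[OF \<sigma>(1) cT])
  have xM: "x j \<in> carrier (F i)" and fL: "f j \<in> carrier L" if "j < m" for j
    using x f that by auto
  have comp: "(\<lambda>c. tm i i (\<lambda>x. r \<odot>\<^bsub>F i\<^esub> x) (\<sigma> c)) \<in> hom (Tn i) (Tn i)"
    by (rule hom_comp[OF \<sigma>(1) tm_hom[OF r_hom]])
  have pure: "tm i i (\<lambda>x. r \<odot>\<^bsub>F i\<^esub> x) (\<sigma> (pt i (x j) (f j))) =
      pt i (x j) (\<lambda>h. 1 / of_nat N * (averaging_element z N \<odot>\<^bsub>L\<^esub> f j) h)" if j: "j < m" for j
  proof -
    have "tm i i (\<lambda>x. r \<odot>\<^bsub>F i\<^esub> x) (\<sigma> (pt i (x j) (f j))) = pt i (r \<odot>\<^bsub>F i\<^esub> x j) (\<lambda>h. 1 / of_nat N * f j h)"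
      unfolding \<sigma>(2)[OF xM[OF j] fL[OF j]] by (rule tm_pure[OF r_hom xM[OF j] lp_cmult[OF fL[OF j]]])
    also have "\<dots> = pt i (x j) (averaging_element z N \<odot>\<^bsub>L\<^esub> (\<lambda>h. 1 / of_nat N * f j h))"
      unfolding r_bar right_of_left_smult[symmetric]
      by (rule tensor.pure_balanced[OF averaging_element_carrier[OF carrier_z] _ lp_cmult[OF fL[OF j]]])
        (simp add: xM[OF j])
    finally show ?thesis by (simp only: lp_smult_right)
  qed
  have "tm i i (\<lambda>x. r \<odot>\<^bsub>F i\<^esub> x) (\<sigma> c) = (\<Otimes>\<^bsub>Tn i\<^esub>j\<in>{..<m}. tm i i (\<lambda>x. r \<odot>\<^bsub>F i\<^esub> x) (\<sigma> (pt i (x j) (f j))))"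
    unfolding eq by (rule tensor.hom_pure_sum[OF tensor.T.comm_group_axioms comp]) (use x f in auto)
  also have "\<dots> = tensor.pure_sum i m x (\<lambda>j h. 1 / of_nat N * (averaging_element z N \<odot>\<^bsub>L\<^esub> f j) h)"
    unfolding tensor.pure_sum_def
  proof (rule tensor.T.finprod_cong'[OF refl])
    show "(\<lambda>j. pt i (x j) (\<lambda>h. 1 / of_nat N * (averaging_element z N \<odot>\<^bsub>L\<^esub> f j) h)) \<in> {..<m} \<rightarrow> carrier (Tn i)"
      using xM fL carrier_z by (intro Pi_I tensor.pure_closed lp_cmult lp_smult_closed) auto
  qed (use pure in auto)
  finally have "tensor.pure_sum i m x (\<lambda>j h. 1 / of_nat N * (averaging_element z N \<odot>\<^bsub>L\<^esub> f j) h) =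
      lp_boundary p G F d (Suc i) (tm i (Suc i) s (\<sigma> c)) \<otimes>\<^bsub>Tn i\<^esub>
      (if i = 0 then \<one>\<^bsub>Tn i\<^esub> else tm (i - 1) i t (lp_boundary p G F d i (\<sigma> c)))"
    using split[OF \<sigma>c] by simp
  \<comment> \<open>On a cycle the summand through \<open>t\<close> vanishes and only a boundary
    remains; in cohomology it is the other summand that vanishes.\<close>
  also have "\<dots> = lp_boundary p G F d (Suc i) (tm i (Suc i) s (\<sigma> c))"
    using hom_in_carrier[OF lp_boundary_hom[of "Suc i"] hom_in_carrier[OF tm_hom[OF s] \<sigma>c]]
      hom_one[OF tm_hom[OF t] tensor.T.is_group tensor.T.is_group] by (simp add: cycle)
  finally show ?thesis
    using hom_in_carrier[OF tm_hom[OF s] \<sigma>c] by blast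
qed

text \<open>Fix one expression of the cycle as a finite sum of \<open>x j \<otimes> f j\<close>.
  Open sets pull back to open sets of coefficient tuples, so it suffices to let the coefficients
  converge in a finite power of l^p(G) while the \<open>x j\<close> stay fixed.\<close>

lemma lp_cycle_limit:
  assumes c: "c \<in> kernel (Tn i) (Tn (i - 1)) (lp_boundary p G F d i)"
  shows "c \<in> lp_tensor_topology p G (F i) closure_of (lp_boundary p G F d (Suc i) ` carrier (Tn (Suc i)))"
  unfolding in_closure_of
proof (intro conjI allI impI)
  have cT: "c \<in> carrier (Tn i)" using c by (simp add: kernel_def)
  then show "c \<in> topspace (lp_tensor_topology p G (F i))"
    by (simp add: topspace_lp_tensor[OF F.left_module_axioms])
  fix U assume U: "c \<in> U \<and> openin (lp_tensor_topology p G (F i)) U"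
  obtain m x f where x: "x \<in> {..<m} \<rightarrow> carrier (F i)" and f: "f \<in> {..<m} \<rightarrow> carrier L"
    and eq: "c = tensor.pure_sum i m x f"
    by (rule tensor.tensor_exhaust[OF cT]) (rule that, simp_all)
  define X where "X = product_topology (\<lambda>j::nat. lp_topology p G) {..<m}"
  define W where "W = {g \<in> topspace X. tensor_sum p G (F i) m x g \<in> U}"
  have W: "openin X W"
    using U x unfolding openin_lp_tensor_topology lp_tensor_open_def W_def X_def by blast
  \<comment> \<open>Points of the product space are undefined outside the index set, so tuples are
    restricted; the tensor sum reads only the indices below \<open>m\<close>.\<close>
  have restr: "tensor_sum p G (F i) m x (restrict g {..<m}) = tensor.pure_sum i m x g"
    if "g \<in> {..<m} \<rightarrow> carrier L" for g
    unfolding tensor_sum_pure_sum[OF F.left_module_axioms]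
    by (rule tensor.pure_sum_cong) (use x that in auto)
  have fW: "restrict f {..<m} \<in> W"
    using U f by (simp add: W_def X_def restr eq)
  define u where "u = (\<lambda>N j h. 1 / of_nat N * (averaging_element z N \<odot>\<^bsub>L\<^esub> f j) h)"
  have uL: "u N \<in> {..<m} \<rightarrow> carrier L" for N
    unfolding u_def using f carrier_z by (intro Pi_I lp_cmult lp_smult_closed averaging_element_carrier) auto
  have "limitin X (\<lambda>N. restrict (u N) {..<m}) (restrict f {..<m}) sequentially"
    unfolding X_def limitin_componentwise
  proof (intro conjI ballI)
    show "\<forall>\<^sub>F N in sequentially. restrict (u N) {..<m} \<in> topspace (product_topology (\<lambda>j. lp_topology p G) {..<m})"
      using uL by simp
    show "limitin (lp_topology p G) (\<lambda>N. restrict (u N) {..<m} j) (restrict f {..<m} j) sequentially"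
      if "j \<in> {..<m}" for j
      using averaging_limit[OF inj_z carrier_z, of "f j"] f that by (auto simp: u_def)
  qed simp
  then have "\<forall>\<^sub>F N in sequentially. restrict (u N) {..<m} \<in> W"
    using W fW by (rule limitinD)
  then obtain N where "restrict (u N) {..<m} \<in> W"
    using eventually_happens sequentially_bot by blast
  then have "tensor.pure_sum i m x (u N) \<in> U"
    using restr[OF uL] by (simp add: W_def)
  moreover have "tensor.pure_sum i m x (u N) \<in> lp_boundary p G F d (Suc i) ` carrier (Tn (Suc i))"
    unfolding u_def by (rule lp_cycle_averaging[OF c x f eq])
  ultimately show "\<exists>b. b \<in> lp_boundary p G F d (Suc i) ` carrier (Tn (Suc i)) \<and> b \<in> U"
    by blast
qed

lemma trivial_reduced_lp_homology:
  assumes "i \<noteq> 0 \<Longrightarrow> finitely_generated \<R> (F (i - 1))"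
  shows "trivial_group (reduced_lp_homology p G F d i)"
  unfolding reduced_lp_homology_def
  using closure_boundaries_subset[OF assms] lp_cycle_limit
  by (intro trivial_kernel_Mod tensor.T.is_group lp_boundary_hom) blast+

end

theorem theorem5p4:
  fixes G :: "('g, 'b) monoid_scheme"
    and F :: "nat \<Rightarrow> ('g \<Rightarrow>\<^sub>0 int, 'm) module"
    and d :: "nat \<Rightarrow> 'm \<Rightarrow> 'm"
    and \<epsilon> :: "'m \<Rightarrow> int"
    and p :: real and n :: nat
  assumes "p > 1"
    and "group G"
    and "type_FP n G"
    and "infinite (center G)"
    and "projective_resolution G F d \<epsilon>"
    and "\<And>i. i \<le> n \<Longrightarrow> finitely_generated (group_ring G) (F i)"
  shows "\<forall>i\<le>n. trivial_group (reduced_lp_homology p G F d i) \<and>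
               trivial_group (reduced_lp_cohomology p G F d i)"
proof -
  obtain z :: "nat \<Rightarrow> 'g" where "inj z" "range z \<subseteq> center G"
    using infinite_countable_subset[OF assms(4)] by blast
  with assms interpret lp_resolution G p F d \<epsilon> z
    by (simp add: lp_resolution_def lp_group_def lp_group_axioms_def resolution_def
        resolution_axioms_def lp_resolution_axioms_def)
  \<comment> \<open>The homology argument in degree \<open>i > 0\<close> takes a dual basis one
    degree lower, and \<open>i - 1\<close> also stays within the bound \<open>n\<close>.\<close>
  show ?thesis
    using assms(6) by (auto intro: trivial_reduced_lp_homology trivial_reduced_lp_cohomology)
qed

end
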